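(* There exist absolute constants $c,C>0$ such that the following holds. Let $D\in\mathcal{D}^{n,d}_{\mathrm{rch}_{\min}}(f_{\min},f_{\max},L)$ with support $M$, let $\Gamma=f_{\min}/(f_{\max}+L\,\mathrm{rch}_{\min})$, $\tau>0$, $\Lambda>0$, and assume $$\frac{\tau}{\omega_d f_{\min}\mathrm{rch}_{\min}^d}\le c^{d(d+1)}\Gamma^d\quad\text{and}\quad\Lambda\le\frac{\mathrm{rch}_{\min}}{16}.$$ Then for every $x_0\in\mathbb{R}^n$ with $\mathrm{d}(x_0,M)\le\Lambda$, there exists an SQ algorithm making $2n+1$ queries to $\mathrm{STAT}(\tau)$ that, for every valid $\mathrm{STAT}(\tau)$ oracle for $D$, outputs a point $\hat\pi(x_0)\in\mathbb{R}^n$ with $$\|\hat\pi(x_0)-\pi_M(x_0)\|\le\frac{C^d}{\Gamma}\max\left\{\frac{\Lambda^2}{\mathrm{rch}_{\min}},\ \Gamma^{\frac{2}{d+1}}\mathrm{rch}_{\min}\left(\frac{\tau}{\omega_d f_{\min}\mathrm{rch}_{\min}^d}\right)^{\frac{2}{d+1}}\right\}.$$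
   Context: Notation: $\omega_d$ is the volume of the unit ball of $\mathbb{R}^d$. $\mathrm{d}(z,K)=\inf_{p\in K}\|p-z\|$. The medial axis of a closed $K$ is the set of points with at least two distinct nearest points in $K$; the reach $\mathrm{rch}_K$ is the infimum of $\mathrm{d}(z,K)$ over the medial axis; $\pi_M(z)$ denotes the (unique, off the medial axis) nearest point of $M$ to $z$. $\mathcal{M}^{n,d}_{\rho}$ is the set of compact connected $d$-dimensional $C^2$ submanifolds of $\mathbb{R}^n$ without boundary with reach $\ge\rho$. $\mathcal{D}^{n,d}_{\mathrm{rch}_{\min}}(f_{\min},f_{\max},L)$ is the set of Borel probability distributions $D$ on $\mathbb{R}^n$ with support $M\in\mathcal{M}^{n,d}_{\mathrm{rch}_{\min}}$ having a density $f$ w.r.t. the $d$-dimensional Hausdorff measure restricted to $M$ with $0<f_{\min}\le f\le f_{\max}$ and $f$ $L$-Lipschitz on $M$. SQ framework: a $\mathrm{STAT}(\tau)$ oracle for $D$ answers each measurable query $r:\mathbb{R}^n\to[-1,1]$ with an arbitrary adversarial real $a$ with $|a-\mathbb{E}_D[r]|\le\tau$; an SQ algorithm chooses its queries adaptively as functions of previous answers and outputs a function of all answers. *)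

theory Defs
  imports "HOL-Probability.Probability"
begin

text \<open>Finitely supported real sequences with the standard (l2) inner product.
  R^n is identified with the subspace of sequences supported in {0..<n}, with
  its standard Euclidean structure.  Using one ambient type for all n allows
  quantifying over the dimensions n, d inside the statement (needed because the
  constants c, C are absolute).\<close>

typedef fsv = "{f :: nat \<Rightarrow> real. finite {i. f i \<noteq> 0}}"
  morphisms coord Abs_fsv
  by (rule exI[of _ "\<lambda>_. 0"]) simp

setup_lifting type_definition_fsv

lemma fsv_eqI: "(\<And>i. coord x i = coord y i) \<Longrightarrow> x = y"
  by (metis coord_inject ext)

lemma finite_supp_coord: "finite {i. coord x i \<noteq> 0}"
  using coord by auto

instantiation fsv :: real_vector
begin
lift_definition zero_fsv :: fsv is "\<lambda>_. 0" by simp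
lift_definition plus_fsv :: "fsv \<Rightarrow> fsv \<Rightarrow> fsv" is "\<lambda>f g i. f i + g i"
proof -
  fix f g :: "nat \<Rightarrow> real"
  assume "finite {i. f i \<noteq> 0}" "finite {i. g i \<noteq> 0}"
  then show "finite {i. f i + g i \<noteq> 0}"
    by (rule finite_subset[rotated, OF finite_UnI]) auto
qed
lift_definition uminus_fsv :: "fsv \<Rightarrow> fsv" is "\<lambda>f i. - f i" by simp
lift_definition minus_fsv :: "fsv \<Rightarrow> fsv \<Rightarrow> fsv" is "\<lambda>f g i. f i - g i"
proof -
  fix f g :: "nat \<Rightarrow> real"
  assume "finite {i. f i \<noteq> 0}" "finite {i. g i \<noteq> 0}"
  then show "finite {i. f i - g i \<noteq> 0}"
    by (rule finite_subset[rotated, OF finite_UnI]) auto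
qed
lift_definition scaleR_fsv :: "real \<Rightarrow> fsv \<Rightarrow> fsv" is "\<lambda>a f i. a * f i"
  by (rule finite_subset[rotated]) auto
instance
  by standard (auto intro!: fsv_eqI simp: plus_fsv.rep_eq zero_fsv.rep_eq uminus_fsv.rep_eq
      minus_fsv.rep_eq scaleR_fsv.rep_eq algebra_simps)
end

lemma coord_simps [simp]:
  "coord 0 i = 0" "coord (x + y) i = coord x i + coord y i" "coord (x - y) i = coord x i - coord y i"
  "coord (- x) i = - coord x i" "coord (a *\<^sub>R x) i = a * coord x i"
  by (simp_all add: plus_fsv.rep_eq zero_fsv.rep_eq uminus_fsv.rep_eq
      minus_fsv.rep_eq scaleR_fsv.rep_eq)

definition supp_fsv :: "fsv \<Rightarrow> nat set" where
  "supp_fsv x = {i. coord x i \<noteq> 0}"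

definition inner_fsv_def_aux :: "fsv \<Rightarrow> fsv \<Rightarrow> real" where
  "inner_fsv_def_aux x y = (\<Sum>i\<in>supp_fsv x. coord x i * coord y i)"

lemma inner_aux_eq:
  assumes "finite T" "supp_fsv x \<subseteq> T"
  shows "inner_fsv_def_aux x y = (\<Sum>i\<in>T. coord x i * coord y i)"
  unfolding inner_fsv_def_aux_def
  by (rule sum.mono_neutral_left) (use assms in \<open>auto simp: supp_fsv_def\<close>)

lemma finite_supp_fsv [simp]: "finite (supp_fsv x)"
  using finite_supp_coord by (simp add: supp_fsv_def)

instantiation fsv :: real_inner
begin
definition inner_fsv :: "fsv \<Rightarrow> fsv \<Rightarrow> real" where
  "inner_fsv = inner_fsv_def_aux"
definition norm_fsv :: "fsv \<Rightarrow> real" where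
  "norm_fsv x = sqrt (inner x x)"
definition sgn_fsv :: "fsv \<Rightarrow> fsv" where
  "sgn_fsv x = x /\<^sub>R norm x"
definition dist_fsv :: "fsv \<Rightarrow> fsv \<Rightarrow> real" where
  "dist_fsv x y = norm (x - y)"
definition uniformity_fsv :: "(fsv \<times> fsv) filter" where
  "uniformity_fsv = (INF e\<in>{0<..}. principal {(x, y). dist x y < e})"
definition open_fsv :: "fsv set \<Rightarrow> bool" where
  "open_fsv U \<longleftrightarrow> (\<forall>x\<in>U. \<forall>\<^sub>F (x', y) in uniformity. x' = x \<longrightarrow> y \<in> U)"

lemma inner_fsv_sum:
  assumes "finite T" "supp_fsv x \<subseteq> T"
  shows "inner x y = (\<Sum>i\<in>T. coord x i * coord y i)"
  using inner_aux_eq[OF assms] by (simp add: inner_fsv_def)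

instance
proof
  fix x y z :: fsv and r :: real
  let ?T = "supp_fsv x \<union> supp_fsv y \<union> supp_fsv z"
  have fT: "finite ?T" by simp
  have sx: "supp_fsv (x + y) \<subseteq> ?T" by (auto simp: supp_fsv_def)
  show "inner x y = inner y x"
    using inner_fsv_sum[OF fT, of x y] inner_fsv_sum[OF fT, of y x]
    by (simp add: mult.commute le_supI1 le_supI2)
  show "inner (x + y) z = inner x z + inner y z"
    using inner_fsv_sum[OF fT sx, of z] inner_fsv_sum[OF fT, of x z] inner_fsv_sum[OF fT, of y z]
    by (simp add: distrib_right sum.distrib le_supI1 le_supI2)
  have sr: "supp_fsv (r *\<^sub>R x) \<subseteq> ?T" by (auto simp: supp_fsv_def)
  show "inner (r *\<^sub>R x) y = r * inner x y"
    using inner_fsv_sum[OF fT sr, of y] inner_fsv_sum[OF fT, of x y]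
    by (simp add: sum_distrib_left mult.assoc le_supI1 le_supI2)
  have ii: "inner x x = (\<Sum>i\<in>supp_fsv x. (coord x i)\<^sup>2)"
    using inner_fsv_sum[of "supp_fsv x" x x] by (simp add: power2_eq_square)
  show "0 \<le> inner x x" unfolding ii by (simp add: sum_nonneg)
  show "(inner x x = 0) = (x = 0)"
  proof
    assume "inner x x = 0"
    then have "\<forall>i\<in>supp_fsv x. (coord x i)\<^sup>2 = 0"
      unfolding ii by (subst (asm) sum_nonneg_eq_0_iff) auto
    then show "x = 0" by (auto intro!: fsv_eqI simp: supp_fsv_def)
  next
    assume "x = 0" then show "inner x x = 0" unfolding ii by (simp add: supp_fsv_def)
  qed
  show "norm x = sqrt (inner x x)" by (simp add: norm_fsv_def)
  show "sgn x = x /\<^sub>R norm x" by (simp add: sgn_fsv_def)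
  show "dist x y = norm (x - y)" by (simp add: dist_fsv_def)
  show "(uniformity :: (fsv \<times> fsv) filter) = (INF e\<in>{0<..}. principal {(x, y). dist x y < e})"
    by (simp add: uniformity_fsv_def)
  show "open U = (\<forall>x\<in>U. \<forall>\<^sub>F (x', y) in uniformity. x' = x \<longrightarrow> y \<in> U)" for U :: "fsv set"
    by (simp add: open_fsv_def)
qed
end

definition Rn :: "nat \<Rightarrow> fsv set" where
  "Rn n = {x. \<forall>i\<ge>n. coord x i = 0}"

definition medial_axis :: "nat \<Rightarrow> fsv set \<Rightarrow> fsv set" where
  "medial_axis n K = {z \<in> Rn n. \<exists>p q. p \<in> K \<and> q \<in> K \<and> p \<noteq> q \<and>
      dist p z = infdist z K \<and> dist q z = infdist z K}"

text \<open>Reach (infimum over the empty set is +infinity).\<close>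
definition reach :: "nat \<Rightarrow> fsv set \<Rightarrow> ereal" where
  "reach n K = (INF z\<in>medial_axis n K. ereal (infdist z K))"

text \<open>The (unique, off the medial axis) nearest point of M to z.\<close>
definition proj :: "fsv set \<Rightarrow> fsv \<Rightarrow> fsv" where
  "proj M z = (SOME p. p \<in> M \<and> dist p z = infdist z M)"

text \<open>M is a d-dimensional C^2 embedded submanifold (without boundary) of R^n:
  every point p of M has an open neighbourhood U such that M \<inter> U is the image of
  a relatively open set V of R^d under a C^2 map phi which is a homeomorphism
  onto M \<inter> U and whose differential is injective on R^d (an immersion).
  Derivatives are taken within the subspace R^d; C^2 means the first
  derivative (an operator-valued map) is differentiable with continuous
  derivative.\<close>
definition C2_submanifold :: "nat \<Rightarrow> nat \<Rightarrow> fsv set \<Rightarrow> bool" where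
  "C2_submanifold n d M \<longleftrightarrow> M \<subseteq> Rn n \<and>
     (\<forall>p\<in>M. \<exists>U W (phi :: fsv \<Rightarrow> fsv) (D1 :: fsv \<Rightarrow> (fsv \<Rightarrow>\<^sub>L fsv))
                 (D2 :: fsv \<Rightarrow> (fsv \<Rightarrow>\<^sub>L (fsv \<Rightarrow>\<^sub>L fsv))).
        open U \<and> p \<in> U \<and> open W \<and>
        (let V = W \<inter> Rn d in
          phi ` V = M \<inter> U \<and> inj_on phi V \<and>
          continuous_on V phi \<and> continuous_on (M \<inter> U) (inv_into V phi) \<and>
          (\<forall>v\<in>V. (phi has_derivative blinfun_apply (D1 v)) (at v within Rn d)) \<and>
          (\<forall>v\<in>V. (D1 has_derivative blinfun_apply (D2 v)) (at v within Rn d)) \<and>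
          continuous_on V D2 \<and>
          (\<forall>v\<in>V. inj_on (blinfun_apply (D1 v)) (Rn d))))"

definition manifold_class :: "nat \<Rightarrow> nat \<Rightarrow> real \<Rightarrow> fsv set set" where
  "manifold_class n d \<rho> = {M. M \<noteq> {} \<and> compact M \<and> connected M \<and>
      C2_submanifold n d M \<and> ereal \<rho> \<le> reach n M}"

text \<open>d-dimensional Hausdorff measure, normalised by the volume omega_d of the
  unit ball (so that it agrees with Lebesgue measure on R^d).\<close>
definition omega :: "nat \<Rightarrow> real" where
  "omega d = unit_ball_vol (real d)"

definition hausdorff_pre :: "nat \<Rightarrow> real \<Rightarrow> fsv set \<Rightarrow> ennreal" where
  "hausdorff_pre d \<delta> A = (INF C\<in>{C :: nat \<Rightarrow> fsv set. A \<subseteq> (\<Union>i. C i) \<and>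
        (\<forall>i. bounded (C i) \<and> diameter (C i) < \<delta>)}.
      (\<Sum>i. if C i = {} then 0 else ennreal (omega d * (diameter (C i) / 2) ^ d)))"

definition hausdorff_outer :: "nat \<Rightarrow> fsv set \<Rightarrow> ennreal" where
  "hausdorff_outer d A = (SUP \<delta>\<in>{0<..}. hausdorff_pre d \<delta> A)"

definition hausdorff_measure :: "nat \<Rightarrow> fsv measure" where
  "hausdorff_measure d = measure_of UNIV (sets borel) (hausdorff_outer d)"

definition in_model :: "nat \<Rightarrow> nat \<Rightarrow> real \<Rightarrow> real \<Rightarrow> real \<Rightarrow> real \<Rightarrow>
    fsv measure \<Rightarrow> fsv set \<Rightarrow> (fsv \<Rightarrow> real) \<Rightarrow> bool" where
  "in_model n d rch fmin fmax L D M f \<longleftrightarrow>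
     M \<in> manifold_class n d rch \<and> prob_space D \<and>
     D = density (hausdorff_measure d) (\<lambda>x. ennreal (indicator M x * f x)) \<and>
     0 < fmin \<and> (\<forall>x\<in>M. fmin \<le> f x \<and> f x \<le> fmax) \<and> L-lipschitz_on M f"

text \<open>A deterministic adaptive SQ algorithm with k queries is given by a query
  map Q (the query asked after having received the list of previous answers)
  and an output map out (applied to the list of all k answers).  Queries are
  Borel measurable with values in [-1,1]; outputs lie in R^n.\<close>
definition SQ_algorithm :: "nat \<Rightarrow> (real list \<Rightarrow> fsv \<Rightarrow> real) \<Rightarrow> (real list \<Rightarrow> fsv) \<Rightarrow> bool" where
  "SQ_algorithm n Q out \<longleftrightarrow>
     (\<forall>as. Q as \<in> borel_measurable borel \<and> (\<forall>x. \<bar>Q as x\<bar> \<le> 1)) \<and>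
     (\<forall>as. out as \<in> Rn n)"

text \<open>A list of k answers that a STAT(tau) oracle for D may give to the
  algorithm's (adaptive) queries: each answer is within tau of the expectation
  of the query asked at that step.  Ranging over all such lists is the same as
  ranging over all (adversarial, possibly adaptive) valid oracles.\<close>
definition valid_answers :: "nat \<Rightarrow> real \<Rightarrow> fsv measure \<Rightarrow> (real list \<Rightarrow> fsv \<Rightarrow> real) \<Rightarrow>
    real list \<Rightarrow> bool" where
  "valid_answers k \<tau> D Q as \<longleftrightarrow> length as = k \<and>
     (\<forall>j<k. \<bar>as ! j - (\<integral>x. Q (take j as) x \<partial>D)\<bar> \<le> \<tau>)"

end

theory Submission
  imports Defs
begin

text \<open>
  Let \<open>p\<close> be the nearest point to \<open>x0\<close> on \<open>M\<close>.  The algorithm estimates the mean of \<open>D\<close> conditioned on a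
  ball of radius \<open>h\<close> around \<open>x0\<close>.  Its bias is of order \<open>h\<^sup>2 / \<rho>\<close>: near \<open>p\<close> the manifold is a graph over
  its tangent space at \<open>p\<close> with deviation at most \<open>|y - p|\<^sup>2 / \<rho>\<close>, the tangential projection distorts
  lengths only by a factor \<open>1 + O(h / \<rho>)\<close>, and on a centrally symmetric disc the tangential first moment
  vanishes.  The noise does not depend on the ambient dimension, because by Kashin's theorem the unit ball
  of \<open>R\<^sup>n\<close> has representations \<open>x = \<Sum>\<^sub>j a\<^sub>j(x) u\<^sub>j\<close> with \<open>2 n\<close> coefficients bounded by one such that
  perturbing every coefficient by \<open>\<tau>\<close> moves \<open>x\<close> only by \<open>O(\<tau>)\<close>.

  The graph property comes from the rolling ball condition: a ball of radius \<open>\<rho> / 2\<close> touching \<open>M\<close> from a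
  normal direction contains no point of \<open>M\<close>.  Together with continuity of the tangent spaces it bounds the
  angle between tangent spaces at points of distance \<open>s\<close> by \<open>O(s / \<rho>)\<close>, first at infinitesimal scales and
  then, by passing to approximate midpoints on \<open>M\<close>, at all scales up to a fraction of the reach.
\<close>

section \<open>The finite-dimensional spaces Rn\<close>

text \<open>Constants may be as large as \<open>C ^ d\<close> but must not see \<open>n\<close>, and
  this decides where the argument can be crude. The Hausdorff measure \<kappa> of the unit tangent
  disc is never computed: it cancels between the first moment and the mass of the ball, and only the
  noise term needs \<kappa> \<ge> omega d / 2 ^ d, which follows from covering by balls in place of
  the isodiametric inequality. There is no area formula either: \<open>M\<close> near
  \<open>x0\<close> is caught between two concentric tangent discs by maps with Lipschitz constants
  1 and 1 + O(h / \<rho>).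

  The radius solves bias = noise. With \<tau>' = \<tau> / (omega d fmin \<rho>^d), equating h^2 /
  (\<rho> \<Gamma>) and h \<tau> / (omega d fmin h^d) gives h^(d+1) = \<rho>^(d+1) \<Gamma> \<tau>',
  whence the exponent 2 / (d + 1). If 2 \<Lambda> exceeds the largest admissible radius,
  \<open>x0\<close> itself is accurate enough. Besides the 2 n Kashin coefficients one more query is
  spent on the mass of the ball.\<close>

lift_definition unit_fsv :: "nat \<Rightarrow> fsv" is "\<lambda>i j. if j = i then 1 else 0"
  by simp

lemma coord_unit_fsv [simp]: "coord (unit_fsv i) j = (if j = i then 1 else 0)"
  by transfer simp

lemma coord_sum [simp]: "coord (\<Sum>i\<in>A. f i) j = (\<Sum>i\<in>A. coord (f i) j)"
  by (induction A rule: infinite_finite_induct) auto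

lemma inner_unit_fsv_left [simp]: "inner (unit_fsv i) x = coord x i"
  using inner_fsv_sum[of "{i}" "unit_fsv i" x] by (auto simp: supp_fsv_def)

lemma norm_unit_fsv [simp]: "norm (unit_fsv i) = 1"
  by (simp add: norm_eq_sqrt_inner)

lemma abs_coord_le_norm: "\<bar>coord x i\<bar> \<le> norm x"
  using Cauchy_Schwarz_ineq2[of "unit_fsv i" x] by simp

lemma RnI: "(\<And>i. n \<le> i \<Longrightarrow> coord x i = 0) \<Longrightarrow> x \<in> Rn n"
  by (auto simp: Rn_def)

lemma Rn_coord: "x \<in> Rn n \<Longrightarrow> n \<le> i \<Longrightarrow> coord x i = 0"
  by (auto simp: Rn_def)

lemma subspace_Rn: "subspace (Rn n)"
  by (auto simp: subspace_def Rn_def)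

lemmas Rn_intros [simp, intro] = subspace_0[OF subspace_Rn] subspace_add[OF subspace_Rn]
  subspace_diff[OF subspace_Rn] subspace_scale[OF subspace_Rn]

lemma Rn_sum [simp, intro]: "(\<And>i. i \<in> A \<Longrightarrow> f i \<in> Rn n) \<Longrightarrow> sum f A \<in> Rn n"
  by (rule subspace_sum[OF subspace_Rn])

lemma unit_fsv_in_Rn: "i < n \<Longrightarrow> unit_fsv i \<in> Rn n"
  by (auto simp: Rn_def)

lemma Rn_expand:
  assumes "x \<in> Rn n"
  shows "x = (\<Sum>i<n. coord x i *\<^sub>R unit_fsv i)"
proof (rule fsv_eqI)
  fix j
  have "(\<Sum>i<n. coord x i * (if j = i then 1 else 0)) = (if j < n then coord x j else 0)"
    by (simp add: if_distrib cong: if_cong)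
  then show "coord x j = coord (\<Sum>i<n. coord x i *\<^sub>R unit_fsv i) j"
    using assms by (auto simp: Rn_coord)
qed

lemma inner_Rn: "x \<in> Rn n \<Longrightarrow> inner x y = (\<Sum>i<n. coord x i * coord y i)"
  by (rule inner_fsv_sum) (auto simp: supp_fsv_def Rn_def not_le intro: ccontr)

lemma norm_Rn: "x \<in> Rn n \<Longrightarrow> (norm x)\<^sup>2 = (\<Sum>i<n. (coord x i)\<^sup>2)"
  by (subst power2_norm_eq_inner, subst inner_Rn) (auto simp: power2_eq_square)

lemma bounded_linear_coord: "bounded_linear (\<lambda>x. coord x i)"
  using bounded_linear_inner_right[of "unit_fsv i"] by simp

lemmas continuous_on_coord [continuous_intros] =
  bounded_linear.continuous_on[OF bounded_linear_coord]

lemma closed_Rn: "closed (Rn n)"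
proof -
  have "Rn n = (\<Inter>i\<in>{n..}. {x. coord x i = 0})"
    by (auto simp: Rn_def)
  also have "closed \<dots>"
    by (intro closed_INT ballI closed_Collect_eq continuous_intros)
  finally show ?thesis .
qed

lemma Rn_Suc_split:
  assumes "x \<in> Rn (Suc n)"
  obtains y where "y \<in> Rn n" "x = y + coord x n *\<^sub>R unit_fsv n"
proof
  show "x - coord x n *\<^sub>R unit_fsv n \<in> Rn n"
    using assms by (auto simp: Rn_def not_less_eq_eq le_Suc_eq)
qed simp

text \<open>\<open>fsv\<close> is infinite-dimensional, so closed bounded sets need not be compact.
  Boxes are: each is a continuous image of a lower-dimensional box times an interval.\<close>

lemma compact_Rn_box: "compact {x \<in> Rn n. \<forall>i<n. \<bar>coord x i\<bar> \<le> b}"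
proof (induction n)
  case 0
  have "{x \<in> Rn 0. \<forall>i<0. \<bar>coord x i\<bar> \<le> b} = {0}"
    by (auto simp: Rn_def intro!: fsv_eqI)
  then show ?case by simp
next
  case (Suc n)
  let ?B = "\<lambda>n. {x \<in> Rn n. \<forall>i<n. \<bar>coord x i\<bar> \<le> b}"
  have "compact ((\<lambda>(x, t). x + t *\<^sub>R unit_fsv n) ` (?B n \<times> {-b..b}))"
    by (intro compact_continuous_image compact_Times Suc)
       (auto simp: case_prod_beta intro!: continuous_intros)
  also have "(\<lambda>(x, t). x + t *\<^sub>R unit_fsv n) ` (?B n \<times> {-b..b}) = ?B (Suc n)"
  proof safe
    fix x assume x: "x \<in> Rn (Suc n)" "\<forall>i<Suc n. \<bar>coord x i\<bar> \<le> b"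
    obtain y where y: "y \<in> Rn n" "x = y + coord x n *\<^sub>R unit_fsv n"
      using Rn_Suc_split[OF x(1)] .
    have "coord y i = coord x i" if "i < n" for i
      using that arg_cong[OF y(2), of "\<lambda>z. coord z i"] by simp
    then have "y \<in> ?B n" using y x by auto
    then show "x \<in> (\<lambda>(x, t). x + t *\<^sub>R unit_fsv n) ` (?B n \<times> {-b..b})"
      using x(2)[rule_format, of n]
      by (intro image_eqI[of _ _ "(y, coord x n)"]) (use y in \<open>auto\<close>)
  qed (auto simp: Rn_def less_Suc_eq)
  finally show ?case .
qed

lemma compact_in_Rn:
  assumes "closed S" "bounded S" "S \<subseteq> Rn n"
  shows "compact S"
proof -
  obtain b where b: "\<And>x. x \<in> S \<Longrightarrow> norm x \<le> b"
    using assms(2) by (auto simp: bounded_iff)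
  have "S = {x \<in> Rn n. \<forall>i<n. \<bar>coord x i\<bar> \<le> b} \<inter> S"
    using assms(3) b by (auto intro: order_trans[OF abs_coord_le_norm])
  then show ?thesis
    using compact_Int_closed[OF compact_Rn_box assms(1), of n b] by simp
qed

lemma compact_cball_Rn: "compact (cball x r \<inter> Rn n)"
  by (rule compact_in_Rn[of _ n]) (auto intro: closed_Rn bounded_subset[OF bounded_cball])

section \<open>Orthonormal frames\<close>

definition orthonormal :: "nat \<Rightarrow> (nat \<Rightarrow> fsv) \<Rightarrow> bool" where
  "orthonormal d b \<longleftrightarrow> (\<forall>i<d. \<forall>j<d. inner (b i) (b j) = (if i = j then 1 else 0))"

definition frame_proj :: "nat \<Rightarrow> (nat \<Rightarrow> fsv) \<Rightarrow> fsv \<Rightarrow> fsv" where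
  "frame_proj d b x = (\<Sum>i<d. inner x (b i) *\<^sub>R b i)"

definition frame_span :: "nat \<Rightarrow> (nat \<Rightarrow> fsv) \<Rightarrow> fsv set" where
  "frame_span d b = range (\<lambda>c. \<Sum>i<d. c i *\<^sub>R b i)"

lemma inner_frame_comb:
  assumes "orthonormal d b" "j < d"
  shows "inner (\<Sum>i<d. c i *\<^sub>R b i) (b j) = c j"
proof -
  have "inner (\<Sum>i<d. c i *\<^sub>R b i) (b j) = (\<Sum>i<d. if i = j then c i else 0)"
    unfolding inner_sum_left using assms
    by (intro sum.cong) (auto simp: orthonormal_def)
  then show ?thesis using assms(2) by simp
qed

lemma norm_frame_comb:
  assumes "orthonormal d b"
  shows "(norm (\<Sum>i<d. c i *\<^sub>R b i))\<^sup>2 = (\<Sum>i<d. (c i)\<^sup>2)"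
  unfolding power2_norm_eq_inner
  by (subst inner_sum_right) (simp add: inner_frame_comb[OF assms] power2_eq_square)

lemma frame_proj_in_span [simp, intro]: "frame_proj d b x \<in> frame_span d b"
  by (auto simp: frame_proj_def frame_span_def)

lemma frame_proj_id: "orthonormal d b \<Longrightarrow> x \<in> frame_span d b \<Longrightarrow> frame_proj d b x = x"
  by (auto simp: frame_proj_def frame_span_def inner_frame_comb)

lemma linear_frame_proj: "linear (frame_proj d b)"
  by (auto intro!: linearI simp: frame_proj_def inner_add_left scaleR_add_left sum.distrib
      scaleR_sum_right)

lemmas frame_proj_diff = linear_diff[OF linear_frame_proj]
lemmas frame_proj_add = linear_add[OF linear_frame_proj]
lemmas frame_proj_scale = linear_scale[OF linear_frame_proj]

lemma frame_proj_orthogonal: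
  assumes "orthonormal d b" "y \<in> frame_span d b"
  shows "inner (x - frame_proj d b x) y = 0"
proof -
  obtain c where y: "y = (\<Sum>i<d. c i *\<^sub>R b i)"
    using assms(2) by (auto simp: frame_span_def)
  have "inner (x - frame_proj d b x) (b i) = 0" if "i < d" for i
    using inner_frame_comb[OF assms(1) that, of "\<lambda>i. inner x (b i)"]
    by (simp add: inner_diff_left frame_proj_def)
  then show ?thesis by (simp add: y inner_sum_right)
qed

lemma frame_proj_pythagoras:
  assumes "orthonormal d b"
  shows "(norm x)\<^sup>2 = (norm (frame_proj d b x))\<^sup>2 + (norm (x - frame_proj d b x))\<^sup>2"
proof -
  have "inner (x - frame_proj d b x) (frame_proj d b x) = 0"
    by (intro frame_proj_orthogonal assms) simp
  then show ?thesis
    by (simp add: power2_norm_eq_inner inner_diff_left inner_diff_right inner_commute)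
qed

lemma norm_frame_proj_le: "orthonormal d b \<Longrightarrow> norm (frame_proj d b x) \<le> norm x"
  using frame_proj_pythagoras[of d b x] by (auto intro: power2_le_imp_le)

lemma norm_frame_coproj_le: "orthonormal d b \<Longrightarrow> norm (x - frame_proj d b x) \<le> norm x"
  using frame_proj_pythagoras[of d b x] by (auto intro: power2_le_imp_le)

lemma frame_coproj_minimal:
  assumes "orthonormal d b" "y \<in> frame_span d b"
  shows "norm (x - frame_proj d b x) \<le> norm (x - y)"
proof -
  have "x - frame_proj d b x = (x - y) - frame_proj d b (x - y)"
    using frame_proj_id[OF assms] by (simp add: frame_proj_diff)
  then show ?thesis using norm_frame_coproj_le[OF assms(1)] by metis
qed

lemma bounded_linear_frame_proj: "orthonormal d b \<Longrightarrow> bounded_linear (frame_proj d b)"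
  by (rule bounded_linear_intro[where K=1])
     (auto simp: frame_proj_add frame_proj_scale norm_frame_proj_le)

lemmas continuous_on_frame_proj = bounded_linear.continuous_on[OF bounded_linear_frame_proj]

lemma subspace_frame_span: "subspace (frame_span d b)"
proof -
  have 1: "(\<Sum>i<d. c i *\<^sub>R b i) + (\<Sum>i<d. c' i *\<^sub>R b i) \<in> frame_span d b" for c c'
    by (auto simp: frame_span_def sum.distrib[symmetric] scaleR_add_left[symmetric])
  have 2: "r *\<^sub>R (\<Sum>i<d. c i *\<^sub>R b i) \<in> frame_span d b" for c r
    by (auto simp: frame_span_def scaleR_sum_right)
  have "0 \<in> frame_span d b" using 2[of 0 "\<lambda>_. 0"] by simp
  then show ?thesis
    using 1 2 by (auto simp: subspace_def frame_span_def)
qed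

lemma closed_frame_span: assumes "orthonormal d b" shows "closed (frame_span d b)"
proof -
  have "frame_span d b = {x. frame_proj d b x = x}"
    using frame_proj_id[OF assms] frame_proj_in_span by (auto, metis)
  then show ?thesis
    by (simp add: closed_Collect_eq continuous_on_frame_proj[OF assms])
qed

text \<open>Tangent spaces arise as such images, and a frame supplies the orthogonal projection onto
  them. The next frame vector is the normalised part of \<open>A (unit_fsv d)\<close> orthogonal to
  the frame so far; injectivity keeps it nonzero.\<close>

lemma gram_schmidt_image:
  assumes "linear A" "inj_on A (Rn d)"
  shows "\<exists>b. orthonormal d b \<and> frame_span d b = A ` Rn d"
  using assms(2)
proof (induction d)
  case 0
  have "Rn 0 = {0}" by (auto simp: Rn_def intro!: fsv_eqI)
  then show ?case
    using linear_0[OF assms(1)] by (auto simp: orthonormal_def frame_span_def)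
next
  case (Suc d)
  have sub: "Rn d \<subseteq> Rn (Suc d)" by (auto simp: Rn_def)
  obtain b where b: "orthonormal d b" "frame_span d b = A ` Rn d"
    using Suc.IH inj_on_subset[OF Suc.prems sub] by blast
  define w where "w = A (unit_fsv d) - frame_proj d b (A (unit_fsv d))"
  have "A (unit_fsv d) \<notin> A ` Rn d"
  proof
    assume "A (unit_fsv d) \<in> A ` Rn d"
    then obtain x where x: "x \<in> Rn d" "A (unit_fsv d) = A x" by auto
    then have "unit_fsv d = x"
      using Suc.prems sub unit_fsv_in_Rn[of d "Suc d"] by (auto dest!: inj_onD)
    then have "coord (unit_fsv d) d = 0" using x(1) by (simp only: Rn_coord)
    then show False by simp
  qed
  then have "w \<noteq> 0"
    unfolding w_def using frame_proj_in_span b(2) by (metis eq_iff_diff_eq_0)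
  define b' where "b' = b(d := w /\<^sub>R norm w)"
  have orth: "inner w (b i) = 0" if "i < d" for i
  proof -
    have "b i \<in> frame_span d b"
      using that by (auto simp: frame_span_def intro!: image_eqI[of _ _ "\<lambda>j. if j = i then 1 else 0"]
          simp: if_distrib[of "\<lambda>c. c *\<^sub>R _"] cong: if_cong)
    then show ?thesis unfolding w_def by (intro frame_proj_orthogonal b)
  qed
  have "orthonormal (Suc d) b'"
    using b(1) orth \<open>w \<noteq> 0\<close>
    by (auto simp: orthonormal_def b'_def less_Suc_eq inner_commute power2_norm_eq_inner[symmetric]
        field_simps power2_eq_square)
  moreover have "frame_span (Suc d) b' = A ` Rn (Suc d)"
  proof safe
    fix y assume "y \<in> frame_span (Suc d) b'"
    then obtain c where "y = (\<Sum>i<Suc d. c i *\<^sub>R b' i)" by (auto simp: frame_span_def)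
    then have y: "y = (\<Sum>i<d. c i *\<^sub>R b i) + (c d / norm w) *\<^sub>R w"
      by (simp add: b'_def divide_inverse)
    define z where "z = (\<Sum>i<d. c i *\<^sub>R b i) - (c d / norm w) *\<^sub>R frame_proj d b (A (unit_fsv d))"
    have "z \<in> frame_span d b"
      unfolding z_def
      by (intro subspace_diff subspace_scale subspace_frame_span frame_proj_in_span) (simp add: frame_span_def)
    then obtain x where x: "x \<in> Rn d" "A x = z"
      unfolding b(2) by auto
    have "y = A (x + (c d / norm w) *\<^sub>R unit_fsv d)"
      by (simp add: linear_add[OF assms(1)] linear_scale[OF assms(1)] x y w_def z_def algebra_simps)
    moreover have "x + (c d / norm w) *\<^sub>R unit_fsv d \<in> Rn (Suc d)"
      using x(1) sub by (auto simp: unit_fsv_in_Rn)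
    ultimately show "y \<in> A ` Rn (Suc d)" by (rule image_eqI)
  next
    fix x assume "x \<in> Rn (Suc d)"
    then obtain y where y: "y \<in> Rn d" "x = y + coord x d *\<^sub>R unit_fsv d"
      by (rule Rn_Suc_split)
    have "A y + coord x d *\<^sub>R frame_proj d b (A (unit_fsv d)) \<in> frame_span d b"
      using y b(2) by (intro subspace_add subspace_scale subspace_frame_span) auto
    then obtain c where c: "A y + coord x d *\<^sub>R frame_proj d b (A (unit_fsv d)) = (\<Sum>i<d. c i *\<^sub>R b i)"
      by (auto simp: frame_span_def)
    have "A x = A y + coord x d *\<^sub>R A (unit_fsv d)"
      by (subst y(2)) (simp add: linear_add[OF assms(1)] linear_scale[OF assms(1)])
    also have "\<dots> = (\<Sum>i<d. c i *\<^sub>R b i) + coord x d *\<^sub>R w"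
      unfolding c[symmetric] by (simp add: w_def algebra_simps)
    also have "(\<Sum>i<d. c i *\<^sub>R b i) = (\<Sum>i<d. (c(d := coord x d * norm w)) i *\<^sub>R b' i)"
      by (intro sum.cong) (auto simp: b'_def)
    also have "coord x d *\<^sub>R w = (c(d := coord x d * norm w)) d *\<^sub>R b' d"
      using \<open>w \<noteq> 0\<close> by (simp only: b'_def fun_upd_same scaleR_scaleR) (simp add: mult.assoc)
    finally have "A x = (\<Sum>i<Suc d. (c(d := coord x d * norm w)) i *\<^sub>R b' i)"
      by (simp only: sum.lessThan_Suc)
    then show "A x \<in> frame_span (Suc d) b'" unfolding frame_span_def
      by (rule range_eqI[of _ _ "c(d := coord x d * norm w)"])
  qed
  ultimately show ?case by (intro exI[of _ b'] conjI)
qed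

section \<open>Sets of positive reach\<close>

locale positive_reach =
  fixes n :: nat and M :: "fsv set" and \<rho> :: real
  assumes compact_M: "compact M" and nonempty_M: "M \<noteq> {}" and M_subset: "M \<subseteq> Rn n"
    and rho_pos: "0 < \<rho>" and rho_le_reach: "ereal \<rho> \<le> reach n M"
begin

abbreviation \<delta> :: "fsv \<Rightarrow> real" where "\<delta> z \<equiv> infdist z M"

lemma M_in_Rn: "x \<in> M \<Longrightarrow> x \<in> Rn n"
  using M_subset by auto

lemma nearest_unique:
  assumes "z \<in> Rn n" "\<delta> z < \<rho>" "p \<in> M" "q \<in> M" "dist p z = \<delta> z" "dist q z = \<delta> z"
  shows "p = q"
proof (rule ccontr)
  assume "p \<noteq> q"
  then have "z \<in> medial_axis n M"
    using assms unfolding medial_axis_def by blast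
  then have "reach n M \<le> ereal (\<delta> z)"
    unfolding reach_def by (rule INF_lower)
  with rho_le_reach have "ereal \<rho> \<le> ereal (\<delta> z)" by (rule order_trans)
  with assms(2) show False by simp
qed

lemma proj_nearest: "proj M z \<in> M" "dist (proj M z) z = \<delta> z"
proof -
  obtain x where x: "x \<in> M" "\<And>y. y \<in> M \<Longrightarrow> dist z x \<le> dist z y"
    using continuous_attains_inf[OF compact_M nonempty_M, of "dist z"]
      continuous_on_dist[OF continuous_on_const continuous_on_id] by blast
  then have "\<delta> z = dist z x"
    unfolding infdist_def using nonempty_M
    by (auto intro!: antisym cINF_greatest cINF_lower2[OF _ x(1)])
  then have "\<exists>p. p \<in> M \<and> dist p z = \<delta> z"
    using x(1) by (auto simp: dist_commute)
  from someI_ex[OF this] show "proj M z \<in> M" "dist (proj M z) z = \<delta> z"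
    unfolding proj_def by auto
qed

lemma proj_eqI:
  assumes "z \<in> Rn n" "\<delta> z < \<rho>" "p \<in> M" "dist p z = \<delta> z"
  shows "proj M z = p"
  using nearest_unique[OF assms(1,2) proj_nearest(1) assms(3) proj_nearest(2) assms(4)] .

section \<open>Growth of the distance function along normals\<close>

lemma infdist_le_dist: "y \<in> M \<Longrightarrow> \<delta> z \<le> norm (z - y)"
  by (metis dist_norm infdist_le)

text \<open>Outside a ball around \<open>proj M c\<close> the compact set \<open>M\<close> stays
  farther from \<open>c\<close> than \<open>\<delta> c\<close> by a fixed excess, because the
  nearest point is unique below the reach. Moving \<open>c\<close> by less than half of that excess
  cannot push the projection out of the ball.\<close>

lemma proj_continuous:
  assumes c: "c \<in> Rn n" "\<delta> c < \<rho>" and "0 < e"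
  shows "\<exists>\<eta>>0. \<forall>z\<in>Rn n. norm (z - c) < \<eta> \<longrightarrow> norm (proj M z - proj M c) < e"
proof (cases "M - ball (proj M c) e = {}")
  case True
  then have "norm (proj M z - proj M c) < e" for z
    using proj_nearest(1)[of z] by (auto simp: dist_norm norm_minus_commute)
  then show ?thesis by (intro exI[of _ 1]) auto
next
  case False
  have "compact (M - ball (proj M c) e)"
    by (intro compact_diff compact_M open_ball)
  then obtain q where q: "q \<in> M - ball (proj M c) e"
      "\<And>y. y \<in> M - ball (proj M c) e \<Longrightarrow> dist c q \<le> dist c y"
    using continuous_attains_inf[OF _ False, of "dist c"]
      continuous_on_dist[OF continuous_on_const continuous_on_id] by blast
  have "dist q c \<noteq> \<delta> c"
    using proj_eqI[OF c, of q] q(1) \<open>0 < e\<close> by auto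
  moreover have "\<delta> c \<le> dist q c"
    using q(1) by (simp add: infdist_le dist_commute)
  ultimately have gap: "0 < dist q c - \<delta> c" by simp
  show ?thesis
  proof (intro exI[of _ "(dist q c - \<delta> c) / 2"] conjI ballI impI)
    fix z assume z: "z \<in> Rn n" "norm (z - c) < (dist q c - \<delta> c) / 2"
    have "dist c (proj M z) \<le> dist c z + dist z (proj M z)"
      by (rule dist_triangle)
    also have "dist z (proj M z) = \<delta> z" using proj_nearest(2)[of z] by (simp add: dist_commute)
    also have "\<delta> z \<le> \<delta> c + dist z c" by (rule infdist_triangle)
    also have "dist c z + (\<delta> c + dist z c) < dist c q"
      using z by (simp add: dist_norm norm_minus_commute)
    finally have "proj M z \<in> ball (proj M c) e"
      using q(2)[of "proj M z"] proj_nearest(1)[of z] by fastforce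
    then show "norm (proj M z - proj M c) < e"
      by (simp add: dist_norm norm_minus_commute)
  qed (use gap in simp)
qed

text \<open>The projection \<open>q\<close> of the moved point is near \<open>proj M c\<close>, so
  \<open>a = c - q\<close> is nearly parallel to \<open>g\<close>, while its length is at least
  \<open>\<delta> c\<close>. Cauchy-Schwarz for \<open>a\<close> and
  \<open>a + \<eta> *\<^sub>R g\<close> converts this alignment into growth at a rate close to
  1.\<close>

lemma infdist_gradient_step:
  assumes c: "c \<in> Rn n" "0 < \<delta> c" "\<delta> c < \<rho>" and e: "0 < e"
    and g: "g = (c - proj M c) /\<^sub>R \<delta> c"
  shows "\<exists>\<eta>\<^sub>0>0. \<forall>\<eta>. 0 < \<eta> \<and> \<eta> < \<eta>\<^sub>0 \<longrightarrow> \<delta> c + (1 - e) * \<eta> \<le> \<delta> (c + \<eta> *\<^sub>R g)"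
proof -
  let ?d = "\<delta> c"
  have nd: "norm (c - proj M c) = ?d"
    using proj_nearest(2)[of c] by (simp add: dist_norm norm_minus_commute)
  have ng: "norm g = 1" using nd c by (simp add: g)
  have gR: "g \<in> Rn n" using c M_in_Rn[OF proj_nearest(1)] by (simp add: g)
  \<comment> \<open>Chosen so that (1 - e) (d + e') \<le> d - e', where d is
    \<open>\<delta> c\<close>. The minimum covers e \<ge> 1, where the left factor is nonpositive
    and e' \<le> d is all that is asked.\<close>
  define e' where "e' = min 1 e * ?d / 2"
  have e': "0 < e'" using e c by (simp add: e'_def)
  obtain \<eta>\<^sub>0 where \<eta>\<^sub>0: "\<eta>\<^sub>0 > 0"
      "\<And>z. z \<in> Rn n \<Longrightarrow> norm (z - c) < \<eta>\<^sub>0 \<Longrightarrow> norm (proj M z - proj M c) < e'"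
    using proj_continuous[OF c(1,3) e'] by auto
  have "?d + (1 - e) * \<eta> \<le> \<delta> (c + \<eta> *\<^sub>R g)" if \<eta>: "0 < \<eta>" "\<eta> < \<eta>\<^sub>0" for \<eta>
  proof -
    define q where "q = proj M (c + \<eta> *\<^sub>R g)"
    define a where "a = c - q"
    have qe: "norm (q - proj M c) < e'"
      unfolding q_def by (intro \<eta>\<^sub>0) (use \<eta> ng c gR in auto)
    have dn: "\<delta> (c + \<eta> *\<^sub>R g) = norm (a + \<eta> *\<^sub>R g)"
      using proj_nearest(2)[of "c + \<eta> *\<^sub>R g"]
      by (simp add: q_def a_def dist_norm norm_minus_commute algebra_simps)
    have a1: "?d \<le> norm a"
      unfolding a_def q_def by (rule infdist_le_dist[OF proj_nearest(1)])
    have "norm a \<le> norm (c - proj M c) + norm (proj M c - q)"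
      unfolding a_def using norm_triangle_ineq[of "c - proj M c" "proj M c - q"] by simp
    with qe nd have a2: "norm a \<le> ?d + e'" by (simp add: norm_minus_commute)
    have "inner g a = inner g (c - proj M c) - inner g (q - proj M c)"
      by (simp add: a_def inner_diff_right)
    moreover have "inner g (c - proj M c) = ?d"
      using c nd by (simp add: g power2_norm_eq_inner[symmetric] power2_eq_square)
    moreover have "inner g (q - proj M c) \<le> e'"
      using norm_cauchy_schwarz[of g "q - proj M c"] ng qe by simp
    ultimately have ga: "?d - e' \<le> inner g a" by simp
    have "(1 - e) * norm a \<le> ?d - e'"
    proof (cases "e \<ge> 1")
      case True
      then have "(1 - e) * norm a \<le> 0" by (simp add: mult_nonpos_nonneg)
      also have "0 \<le> ?d - e'" using c True by (simp add: e'_def)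
      finally show ?thesis .
    next
      case False
      then have "(1 - e) * norm a \<le> (1 - e) * (?d + e')" by (intro mult_left_mono a2) auto
      also have "\<dots> = (1 - e) * (1 + e / 2) * ?d" using False by (simp add: e'_def algebra_simps)
      also have "\<dots> \<le> (1 - e / 2) * ?d"
        using c e by (intro mult_right_mono) (auto simp: algebra_simps)
      also have "\<dots> = ?d - e'" using False by (simp add: e'_def algebra_simps)
      finally show ?thesis .
    qed
    with ga have key: "(1 - e) * norm a \<le> inner a g" by (simp add: inner_commute)
    have "norm a * (norm a + (1 - e) * \<eta>) = norm a * norm a + \<eta> * ((1 - e) * norm a)"
      by (simp add: algebra_simps)
    also have "\<dots> \<le> inner a a + \<eta> * inner a g"
      using key \<eta> by (intro add_mono mult_left_mono) (auto simp: power2_norm_eq_inner[symmetric] power2_eq_square)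
    also have "\<dots> = inner a (a + \<eta> *\<^sub>R g)" by (simp add: inner_add_right)
    also have "\<dots> \<le> norm a * norm (a + \<eta> *\<^sub>R g)" by (rule norm_cauchy_schwarz)
    finally have "norm a + (1 - e) * \<eta> \<le> norm (a + \<eta> *\<^sub>R g)"
      by (rule mult_left_le_imp_le) (use a1 c in linarith)
    then show ?thesis using a1 dn by simp
  qed
  then show ?thesis using \<eta>\<^sub>0(1) by auto
qed

text \<open>Federer's argument follows the gradient flow of the distance function; maximising
  \<open>\<delta> y - (1 - e) |y - c|\<close> over a ball around \<open>c\<close> yields the end point of the flow line
  without an ODE, because a gradient step would increase this functional at an interior maximum.\<close>

lemma infdist_normal_ray:
  assumes c: "c \<in> Rn n" "0 < \<delta> c" "\<delta> c \<le> t" "t < \<rho>"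
  shows "\<delta> (proj M c + (t / \<delta> c) *\<^sub>R (c - proj M c)) = t"
proof -
  let ?z = "proj M c"
  let ?d = "\<delta> c"
  define s where "s = t - ?d"
  define B where "B = cball c s \<inter> Rn n"
  have s0: "0 \<le> s" using c by (simp add: s_def)
  have cB: "c \<in> B" using c s0 by (simp add: B_def)
  have compB: "compact B" unfolding B_def by (rule compact_cball_Rn)
  have nd: "norm (c - ?z) = ?d"
    using proj_nearest(2)[of c] by (simp add: dist_norm norm_minus_commute)
  have dB: "\<delta> y \<le> t" if "y \<in> B" for y
    using infdist_triangle[of y M c] that by (auto simp: B_def s_def dist_commute)
  \<comment> \<open>The slack e is what a gradient step of rate 1 - e / 2 can beat; e tends to 0
    afterwards, with a single maximiser of \<open>\<delta>\<close> on \<open>B\<close> dominating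
    all these points.\<close>
  have step: "\<exists>y\<in>B. ?d + (1 - e) * s \<le> \<delta> y" if e: "0 < e" "e < 1" for e
  proof -
    let ?F = "\<lambda>y. \<delta> y - (1 - e) * norm (y - c)"
    have "continuous_on B ?F" by (intro continuous_intros continuous_on_infdist)
    then obtain y where y: "y \<in> B" "\<And>w. w \<in> B \<Longrightarrow> ?F w \<le> ?F y"
      using continuous_attains_sup[OF compB, of ?F] cB by blast
    have "?F c \<le> ?F y" using y(2)[OF cB] .
    then have dy: "?d + (1 - e) * norm (y - c) \<le> \<delta> y" by simp
    have yR: "y \<in> Rn n" "norm (y - c) \<le> s" using y(1) by (auto simp: B_def dist_norm norm_minus_commute)
    have "norm (y - c) = s"
    proof (rule ccontr)
      assume "norm (y - c) \<noteq> s"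
      then have lt: "norm (y - c) < s" using yR by simp
      have "0 \<le> (1 - e) * norm (y - c)" using e by simp
      then have ypos: "0 < \<delta> y" using dy c by linarith
      have y\<rho>: "\<delta> y < \<rho>" using dB[OF y(1)] c by simp
      define g where "g = (y - proj M y) /\<^sub>R \<delta> y"
      have ng: "norm g = 1"
        using proj_nearest(2)[of y] ypos by (simp add: g_def dist_norm norm_minus_commute)
      obtain \<eta>\<^sub>0 where \<eta>\<^sub>0: "\<eta>\<^sub>0 > 0"
          "\<And>\<eta>. 0 < \<eta> \<Longrightarrow> \<eta> < \<eta>\<^sub>0 \<Longrightarrow> \<delta> y + (1 - e / 2) * \<eta> \<le> \<delta> (y + \<eta> *\<^sub>R g)"
        using infdist_gradient_step[OF yR(1) ypos y\<rho>, of "e / 2" g] e g_def by auto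
      define \<eta> where "\<eta> = min (\<eta>\<^sub>0 / 2) (s - norm (y - c))"
      have \<eta>: "0 < \<eta>" "\<eta> < \<eta>\<^sub>0" "\<eta> \<le> s - norm (y - c)"
        using \<eta>\<^sub>0 lt by (auto simp: \<eta>_def)
      have tri: "norm (y + \<eta> *\<^sub>R g - c) \<le> norm (y - c) + \<eta>"
        using norm_triangle_ineq[of "y - c" "\<eta> *\<^sub>R g"] ng \<eta> by (simp add: algebra_simps)
      have "g \<in> Rn n" using yR M_in_Rn[OF proj_nearest(1)] by (simp add: g_def)
      then have "y + \<eta> *\<^sub>R g \<in> B"
        using tri \<eta> yR by (auto simp: B_def dist_norm norm_minus_commute)
      from y(2)[OF this] have "\<delta> (y + \<eta> *\<^sub>R g) - (1 - e) * norm (y + \<eta> *\<^sub>R g - c) \<le> ?F y" .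
      moreover have "(1 - e) * norm (y + \<eta> *\<^sub>R g - c) \<le> (1 - e) * (norm (y - c) + \<eta>)"
        using tri e by (intro mult_left_mono) auto
      moreover have "\<delta> y + (1 - e / 2) * \<eta> \<le> \<delta> (y + \<eta> *\<^sub>R g)" using \<eta>\<^sub>0(2) \<eta> by blast
      moreover have "0 < e * \<eta>" using e \<eta> by simp
      ultimately show False by (simp add: algebra_simps)
    qed
    then show ?thesis using dy y(1) by auto
  qed
  obtain y where y: "y \<in> B" "\<And>w. w \<in> B \<Longrightarrow> \<delta> w \<le> \<delta> y"
    using continuous_attains_sup[OF compB, of \<delta>] cB
      continuous_on_infdist[OF continuous_on_id, of B M] by blast
  have "t \<le> \<delta> y"
  proof (rule field_le_epsilon)
    fix e :: real assume "0 < e"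
    define e' where "e' = min (1/2) (e / (s + 1))"
    have e': "0 < e'" "e' < 1" "e' * (s + 1) \<le> e"
      using \<open>0 < e\<close> s0 mult_right_mono[of e' "e / (s + 1)" "s + 1"] by (auto simp: e'_def)
    obtain w where w: "w \<in> B" "?d + (1 - e') * s \<le> \<delta> w" using step[OF e'(1,2)] by blast
    have "e' * s \<le> e" using e' by (simp add: algebra_simps)
    then show "t \<le> \<delta> y + e" using w y(2)[OF w(1)] by (simp add: s_def algebra_simps)
  qed
  moreover have "\<delta> y \<le> norm (y - ?z)" by (rule infdist_le_dist[OF proj_nearest(1)])
  moreover have yc: "norm (y - c) \<le> s" using y(1) by (auto simp: B_def dist_norm norm_minus_commute)
  moreover have "norm (y - ?z) \<le> norm (c - ?z) + norm (y - c)"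
    using norm_triangle_ineq[of "c - ?z" "y - c"] by simp
  ultimately have eq: "norm (y - ?z) = norm (c - ?z) + norm (y - c)" "norm (y - c) = s"
    using nd by (auto simp: s_def)
  \<comment> \<open>All of t \<le> \<open>\<delta> y\<close> \<le> |y - z| \<le>
    \<open>\<delta> c\<close> + s = t are equalities, with z the projection of \<open>c\<close>.
    Equality in the triangle inequality forces \<open>y\<close> onto the ray from z through
    \<open>c\<close>.\<close>
  then have "norm ((c - ?z) + (y - c)) = norm (c - ?z) + norm (y - c)" by simp
  then have "?d *\<^sub>R (y - c) = s *\<^sub>R (c - ?z)"
    unfolding norm_triangle_eq using nd eq by simp
  then have "(1 / ?d) *\<^sub>R ?d *\<^sub>R (y - c) = (1 / ?d) *\<^sub>R s *\<^sub>R (c - ?z)" by simp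
  then have "y - c = (s / ?d) *\<^sub>R (c - ?z)"
    using c unfolding scaleR_scaleR by simp
  then have "y = ?z + (c - ?z) + (s / ?d) *\<^sub>R (c - ?z)" by (simp add: algebra_simps)
  also have "\<dots> = ?z + (1 + s / ?d) *\<^sub>R (c - ?z)" by (simp add: scaleR_add_left)
  also have "1 + s / ?d = t / ?d" using c by (simp add: s_def field_simps)
  finally have "\<delta> (?z + (t / ?d) *\<^sub>R (c - ?z)) = \<delta> y" by simp
  with \<open>t \<le> \<delta> y\<close> dB[OF y(1)] show ?thesis by simp
qed

text \<open>The point at distance \<rho> / 2 along the normal still has distance exactly \<rho> / 2
  to \<open>M\<close>, so the open ball around it misses \<open>M\<close>; expanding the square
  gives the inequality. Stopping at \<rho> / 2 costs a factor 2 against Federer's constant.\<close>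

lemma rolling_ball:
  assumes c: "c \<in> Rn n" "\<delta> c \<le> \<rho> / 2" and y: "y \<in> M"
  shows "\<rho> * inner (y - proj M c) (c - proj M c) \<le> (norm (y - proj M c))\<^sup>2 * \<delta> c"
proof (cases "\<delta> c = 0")
  case True
  then have "c = proj M c" using proj_nearest(2)[of c] by simp
  then have "c - proj M c = 0" by simp
  then show ?thesis by (simp only: True inner_zero_right)
next
  case False
  then have pos: "0 < \<delta> c" using infdist_nonneg[of c M] by simp
  let ?z = "proj M c"
  let ?v = "(\<rho> / (2 * \<delta> c)) *\<^sub>R (c - ?z)"
  have nd: "norm (c - ?z) = \<delta> c"
    using proj_nearest(2)[of c] by (simp add: dist_norm norm_minus_commute)
  have nv: "norm ?v = \<rho> / 2" using nd pos rho_pos by simp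
  have "\<delta> (?z + ?v) = \<rho> / 2"
    using infdist_normal_ray[OF c(1) pos c(2)] rho_pos by simp
  then have "\<rho> / 2 \<le> norm (?z + ?v - y)"
    using infdist_le_dist[OF y] by metis
  then have "(norm ?v)\<^sup>2 \<le> (norm (?v - (y - ?z)))\<^sup>2"
    unfolding nv using rho_pos by (intro power_mono) (auto simp: algebra_simps)
  then have "2 * inner (y - ?z) ?v \<le> (norm (y - ?z))\<^sup>2"
    unfolding power2_norm_eq_inner by (simp add: inner_diff_left inner_diff_right inner_commute)
  then have "\<rho> * inner (y - ?z) (c - ?z) / \<delta> c \<le> (norm (y - ?z))\<^sup>2"
    unfolding inner_scaleR_right by simp
  then show ?thesis using pos by (simp only: pos_divide_le_eq)
qed

text \<open>Any quadratic bound in direction \<open>u\<close>, however bad its constant, makes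
  \<open>z\<close> the nearest point to z + t u for small t. \<open>rolling_ball\<close> applied
  there replaces the constant by 1 / \<rho>.\<close>

lemma proximal_normal:
  assumes z: "z \<in> M" and u: "u \<in> Rn n" "norm u = 1"
    and K: "\<And>y. y \<in> M \<Longrightarrow> inner (y - z) u \<le> K * (norm (y - z))\<^sup>2"
    and y: "y \<in> M"
  shows "\<rho> * inner (y - z) u \<le> (norm (y - z))\<^sup>2"
proof -
  \<comment> \<open>The second bound gives 2 t |K| \<le> 1, which keeps all of \<open>M\<close> at
    distance at least t from z + t u; the first admits \<open>rolling_ball\<close>.\<close>
  define t where "t = min (\<rho> / 2) (1 / (2 * (\<bar>K\<bar> + 1)))"
  have t: "0 < t" "t \<le> \<rho> / 2" "2 * t * \<bar>K\<bar> \<le> 1"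
    using rho_pos by (auto simp: t_def min_def field_simps)
  let ?c = "z + t *\<^sub>R u"
  have cR: "?c \<in> Rn n" using z u M_in_Rn by auto
  have "t \<le> norm (?c - w)" if "w \<in> M" for w
  proof -
    have "2 * t * inner (w - z) u \<le> 2 * t * (\<bar>K\<bar> * (norm (w - z))\<^sup>2)"
      using K[OF that] t(1) by (intro mult_left_mono order_trans[OF K[OF that]] mult_right_mono) auto
    also have "\<dots> \<le> (norm (w - z))\<^sup>2"
      using mult_right_mono[OF t(3), of "(norm (w - z))\<^sup>2"] by (simp add: mult.assoc)
    finally have "t\<^sup>2 \<le> (norm (t *\<^sub>R u - (w - z)))\<^sup>2"
      using u(2) unfolding power2_norm_eq_inner
      by (simp add: inner_diff_left inner_diff_right inner_commute norm_eq_1 power2_eq_square)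
    then have "t \<le> norm (t *\<^sub>R u - (w - z))" by (rule power2_le_imp_le) simp
    then show ?thesis by (simp add: algebra_simps)
  qed
  then have "t \<le> \<delta> ?c"
    unfolding infdist_def using nonempty_M by (auto simp: dist_norm intro!: cINF_greatest)
  moreover have "\<delta> ?c \<le> t" using infdist_le_dist[OF z, of ?c] t u by simp
  ultimately have d: "\<delta> ?c = t" by simp
  have "proj M ?c = z"
    by (rule proj_eqI) (use cR d t z u rho_pos in \<open>auto simp: dist_norm\<close>)
  with rolling_ball[OF cR, of y] d t y have "\<rho> * (t * inner (y - z) u) \<le> (norm (y - z))\<^sup>2 * t"
    by simp
  then have "t * (\<rho> * inner (y - z) u) \<le> t * (norm (y - z))\<^sup>2" by (simp add: algebra_simps)
  then show ?thesis using t(1) by (simp add: mult_le_cancel_left_pos)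
qed

text \<open>Adding the rolling ball inequalities for \<open>x\<close> and \<open>y\<close> at the
  projection of their Euclidean midpoint shows that this midpoint is within r^2 / (2 \<rho>) of
  \<open>M\<close>, where r = |x - y|. For r \<le> \<rho> / 16 that is at most r / 32, and 1/2 +
  1/32 = 17/32.\<close>

lemma midpoint_near:
  assumes "x \<in> M" "y \<in> M" "norm (x - y) \<le> \<rho> / 16"
  shows "\<exists>z\<in>M. norm (x - z) \<le> 17 / 32 * norm (x - y) \<and> norm (y - z) \<le> 17 / 32 * norm (x - y)"
proof
  let ?m = "(1/2) *\<^sub>R (x + y)" let ?z = "proj M ?m" let ?r = "norm (x - y)"
  let ?v = "?m - ?z"
  show "?z \<in> M" by (rule proj_nearest)
  have mR: "?m \<in> Rn n" using assms M_in_Rn by auto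
  have xm: "x - ?m = (1/2) *\<^sub>R (x - y)" "y - ?m = - ((1/2) *\<^sub>R (x - y))"
    by (simp_all add: algebra_simps flip: scaleR_add_left)
  have nd: "norm ?v = \<delta> ?m"
    using proj_nearest(2)[of ?m] by (simp add: dist_norm norm_minus_commute)
  have d1: "\<delta> ?m \<le> ?r / 2"
    using infdist_le_dist[OF assms(1), of ?m] by (subst (asm) norm_minus_commute) (simp only: xm, simp)
  have d2: "\<delta> ?m \<le> \<rho> / 2" using d1 assms(3) rho_pos by simp
  have "\<rho> * inner (x - ?z) ?v + \<rho> * inner (y - ?z) ?v
      \<le> ((norm (x - ?z))\<^sup>2 + (norm (y - ?z))\<^sup>2) * \<delta> ?m"
    using rolling_ball[OF mR d2 assms(1)] rolling_ball[OF mR d2 assms(2)]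
    by (simp add: distrib_right)
  moreover have "inner (x - ?z) ?v + inner (y - ?z) ?v = 2 * (\<delta> ?m)\<^sup>2"
  proof -
    have "(x - ?z) + (y - ?z) = 2 *\<^sub>R ?v" by (simp add: algebra_simps scaleR_2)
    then have "inner (x - ?z) ?v + inner (y - ?z) ?v = inner (2 *\<^sub>R ?v) ?v"
      by (metis inner_add_left)
    then show ?thesis by (simp add: power2_norm_eq_inner[symmetric] nd del: scaleR_scaleR)
  qed
  moreover have "(norm (x - ?z))\<^sup>2 + (norm (y - ?z))\<^sup>2 = 2 * (\<delta> ?m)\<^sup>2 + ?r\<^sup>2 / 2"
  proof -
    have 1: "x - ?z = ?v + (1/2) *\<^sub>R (x - y)" "y - ?z = ?v - (1/2) *\<^sub>R (x - y)"
      using xm by (auto simp: algebra_simps)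
    have "(norm (x - ?z))\<^sup>2 + (norm (y - ?z))\<^sup>2 = 2 * inner ?v ?v + inner (x - y) (x - y) / 2"
      unfolding power2_norm_eq_inner 1
      by (simp only: inner_add_left inner_add_right inner_diff_left[of ?v] inner_diff_right[of _ ?v]
          inner_scaleR_left inner_scaleR_right) (simp add: inner_commute field_simps)
    then show ?thesis by (simp add: power2_norm_eq_inner[symmetric] nd)
  qed
  ultimately have "\<rho> * (2 * (\<delta> ?m)\<^sup>2) \<le> (2 * (\<delta> ?m)\<^sup>2 + ?r\<^sup>2 / 2) * \<delta> ?m"
    by (simp add: distrib_left[symmetric])
  then have "\<delta> ?m * (2 * \<rho> * \<delta> ?m) \<le> \<delta> ?m * (2 * (\<delta> ?m)\<^sup>2 + ?r\<^sup>2 / 2)"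
    by (simp add: algebra_simps power2_eq_square)
  then have "\<delta> ?m = 0 \<or> 2 * \<rho> * \<delta> ?m \<le> 2 * (\<delta> ?m)\<^sup>2 + ?r\<^sup>2 / 2"
    using infdist_nonneg[of ?m M] by (auto simp: mult_le_cancel_left)
  moreover have "2 * (\<delta> ?m)\<^sup>2 \<le> \<rho> * \<delta> ?m"
    using d2 infdist_nonneg[of ?m M] mult_right_mono[of "2 * \<delta> ?m" \<rho> "\<delta> ?m"]
    by (simp add: power2_eq_square)
  ultimately have "\<rho> * \<delta> ?m \<le> ?r\<^sup>2 / 2" by auto
  also have "\<dots> \<le> \<rho> * (?r / 32)"
    using mult_right_mono[OF assms(3), of "norm (x - y)"] by (simp add: power2_eq_square)
  finally have d: "\<delta> ?m \<le> ?r / 32" using rho_pos by (simp add: mult_le_cancel_left_pos)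
  have "norm (x - ?z) \<le> norm (x - ?m) + norm ?v"
    using norm_triangle_ineq[of "x - ?m" ?v] by simp
  moreover have "norm (y - ?z) \<le> norm (y - ?m) + norm ?v"
    using norm_triangle_ineq[of "y - ?m" ?v] by simp
  moreover have "norm (x - ?m) = ?r / 2" "norm (y - ?m) = ?r / 2" unfolding xm by auto
  ultimately show "norm (x - ?z) \<le> 17 / 32 * ?r \<and> norm (y - ?z) \<le> 17 / 32 * ?r"
    using d nd by simp
qed

end

section \<open>Tangent spaces of submanifolds\<close>

text \<open>The adjacent tangent cone: \<open>M\<close> comes within o(s) of x + s \<xi> as s tends
  to 0. Being free of charts, it lets tangent spaces at points of different charts be
  compared.\<close>

definition tangent_set :: "fsv set \<Rightarrow> fsv \<Rightarrow> fsv set" where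
  "tangent_set M x = {\<xi>. \<forall>e>0. \<exists>s\<^sub>0>0. \<forall>s. 0 < s \<and> s < s\<^sub>0 \<longrightarrow> (\<exists>y\<in>M. norm (y - x - s *\<^sub>R \<xi>) \<le> e * s)}"

text \<open>For subspaces this bounds the gap, that is, the norm of the difference of the two
  orthogonal projections. Both directions are demanded so that the relation is symmetric and can be
  chained.\<close>

definition gap_le :: "fsv set \<Rightarrow> fsv set \<Rightarrow> real \<Rightarrow> bool" where
  "gap_le S T e \<longleftrightarrow> (\<forall>\<xi>\<in>S. \<exists>\<eta>\<in>T. norm (\<xi> - \<eta>) \<le> e * norm \<xi>) \<and> (\<forall>\<eta>\<in>T. \<exists>\<xi>\<in>S. norm (\<xi> - \<eta>) \<le> e * norm \<eta>)"

lemma gap_le_commute: "gap_le S T e \<Longrightarrow> gap_le T S e"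
  unfolding gap_le_def by (metis norm_minus_commute)

lemma gap_le_mono: "gap_le S T e \<Longrightarrow> e \<le> e' \<Longrightarrow> gap_le S T e'"
  unfolding gap_le_def by (meson mult_right_mono norm_ge_zero order_trans)

lemma half_gap_trans:
  assumes 1: "\<forall>\<xi>\<in>S. \<exists>\<eta>\<in>T. norm (\<xi> - \<eta>) \<le> e * norm \<xi>"
    and 2: "\<forall>\<xi>\<in>T. \<exists>\<eta>\<in>U. norm (\<xi> - \<eta>) \<le> e' * norm \<xi>" and "0 \<le> e'"
  shows "\<forall>\<xi>\<in>S. \<exists>\<eta>\<in>U. norm (\<xi> - \<eta>) \<le> (e + e' + e * e') * norm \<xi>"
proof
  fix \<xi> assume "\<xi> \<in> S"
  then obtain \<eta> where \<eta>: "\<eta> \<in> T" "norm (\<xi> - \<eta>) \<le> e * norm \<xi>" using 1 by blast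
  then obtain \<zeta> where \<zeta>: "\<zeta> \<in> U" "norm (\<eta> - \<zeta>) \<le> e' * norm \<eta>" using 2 by blast
  have "norm \<eta> \<le> norm \<xi> + norm (\<xi> - \<eta>)"
    using norm_triangle_ineq[of \<xi> "\<eta> - \<xi>"] by (simp add: norm_minus_commute)
  with \<eta> have "norm \<eta> \<le> norm \<xi> + e * norm \<xi>" by simp
  then have "e' * norm \<eta> \<le> e' * (norm \<xi> + e * norm \<xi>)" using assms(3) by (rule mult_left_mono)
  moreover have "norm (\<xi> - \<zeta>) \<le> norm (\<xi> - \<eta>) + norm (\<eta> - \<zeta>)"
    using norm_triangle_ineq[of "\<xi> - \<eta>" "\<eta> - \<zeta>"] by simp
  ultimately have "norm (\<xi> - \<zeta>) \<le> (e + e' + e * e') * norm \<xi>"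
    using \<eta> \<zeta> by (simp add: algebra_simps)
  with \<zeta> show "\<exists>\<eta>\<in>U. norm (\<xi> - \<eta>) \<le> (e + e' + e * e') * norm \<xi>" by blast
qed

lemma gap_le_trans:
  assumes "gap_le S T e" "gap_le T U e'" "0 \<le> e" "0 \<le> e'"
  shows "gap_le S U (e + e' + e * e')"
  using half_gap_trans[of S T e U e'] half_gap_trans[of U T e' S e] assms
  unfolding gap_le_def by (simp add: norm_minus_commute add.commute mult.commute)

lemma injective_on_Rn_bounded_below:
  assumes "bounded_linear A" "inj_on A (Rn d)"
  obtains m where "0 < m" "\<And>a. a \<in> Rn d \<Longrightarrow> m * norm a \<le> norm (A a)"
proof (cases "Rn d = {0}")
  case True
  then show ?thesis using that[of 1] by simp
next
  case False
  interpret bounded_linear A by fact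
  define S where "S = {a \<in> Rn d. norm a = 1}"
  have "compact S"
  proof (rule compact_in_Rn[of _ d])
    have "closed {a::fsv. norm a = 1}" by (intro closed_Collect_eq continuous_intros)
    moreover have "S = Rn d \<inter> {a. norm a = 1}" by (auto simp: S_def)
    ultimately show "closed S" using closed_Int[OF closed_Rn[of d]] by simp
    show "bounded S" by (auto simp: bounded_iff S_def)
  qed (auto simp: S_def)
  obtain a where a: "a \<in> Rn d" "a \<noteq> 0" using False by blast
  then have "(1 / norm a) *\<^sub>R a \<in> S" by (simp add: S_def)
  then have "S \<noteq> {}" by blast
  then obtain x where x: "x \<in> S" "\<And>y. y \<in> S \<Longrightarrow> norm (A x) \<le> norm (A y)"
    using continuous_attains_inf[OF \<open>compact S\<close>, of "\<lambda>x. norm (A x)"]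
      continuous_on_norm[OF continuous_on[OF continuous_on_id]] by blast
  have "A x \<noteq> 0"
  proof
    assume "A x = 0"
    then have "x = 0" using assms(2) x(1) zero by (auto simp: S_def dest!: inj_onD[of _ _ x 0])
    then show False using x(1) by (simp add: S_def)
  qed
  moreover have "norm (A x) * norm a \<le> norm (A a)" if "a \<in> Rn d" for a
  proof (cases "a = 0")
    case False
    then have "(1 / norm a) *\<^sub>R a \<in> S" using that by (simp add: S_def)
    from x(2)[OF this] show ?thesis using False by (simp add: scaleR field_simps)
  qed (simp add: zero)
  ultimately show ?thesis using that[of "norm (A x)"] by simp
qed

text \<open>Differentiability of \<open>D1\<close> at \<open>v\<close> bounds D1 w - D1 v linearly
  in |w - v|. The mean value inequality for \<phi> - D1 v, on the convex intersection of a ball with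
  \<open>Rn d\<close>, integrates this to a quadratic remainder.\<close>

lemma second_order_remainder:
  fixes \<phi> :: "fsv \<Rightarrow> fsv" and D1 :: "fsv \<Rightarrow> (fsv \<Rightarrow>\<^sub>L fsv)"
  assumes "open W" "v \<in> W" "v \<in> Rn d"
    and d1: "\<And>w. w \<in> W \<inter> Rn d \<Longrightarrow> (\<phi> has_derivative blinfun_apply (D1 w)) (at w within Rn d)"
    and d2: "(D1 has_derivative D2) (at v within Rn d)"
  obtains K r where "0 < r" "0 \<le> K" "\<And>w. w \<in> Rn d \<Longrightarrow> norm (w - v) < r \<Longrightarrow> w \<in> W"
    "\<And>w. w \<in> Rn d \<Longrightarrow> norm (w - v) < r \<Longrightarrow> norm (D1 w - D1 v) \<le> K * norm (w - v)"
    "\<And>w. w \<in> Rn d \<Longrightarrow> norm (w - v) < r \<Longrightarrow> norm (\<phi> w - \<phi> v - D1 v (w - v)) \<le> K * (norm (w - v))\<^sup>2"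
proof -
  obtain r1 where r1: "0 < r1" "ball v r1 \<subseteq> W"
    using assms(1,2) open_contains_ball by blast
  obtain B where B: "0 < B" "\<And>x. norm (D2 x) \<le> norm x * B"
    using bounded_linear.pos_bounded[OF has_derivative_bounded_linear[OF d2]] by blast
  obtain r2 where r2: "0 < r2" "\<And>w. w \<in> Rn d \<Longrightarrow> norm (w - v) < r2 \<Longrightarrow>
      norm (D1 w - D1 v - D2 (w - v)) \<le> 1 * norm (w - v)"
    using d2 unfolding has_derivative_within_alt by (meson zero_less_one)
  define r where "r = min r1 r2"
  define K where "K = B + 1"
  have inW: "w \<in> W" if "norm (w - v) < r" for w
    using r1 that by (auto simp: r_def dist_norm norm_minus_commute)
  have lip: "norm (D1 w - D1 v) \<le> K * norm (w - v)" if "w \<in> Rn d" "norm (w - v) < r" for w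
    using r2(2)[of w] that B(2)[of "w - v"] norm_triangle_ineq[of "D1 w - D1 v - D2 (w - v)" "D2 (w - v)"]
    by (simp add: r_def K_def algebra_simps)
  have "norm (\<phi> w - \<phi> v - D1 v (w - v)) \<le> K * (norm (w - v))\<^sup>2" if w: "w \<in> Rn d" "norm (w - v) < r" for w
  proof -
    let ?S = "cball v (norm (w - v)) \<inter> Rn d"
    let ?f = "\<lambda>w. \<phi> w - D1 v w"
    have S: "x \<in> Rn d" "norm (x - v) \<le> norm (w - v)" if "x \<in> ?S" for x
      using that by (auto simp: dist_norm norm_minus_commute)
    have "norm (?f w - ?f v) \<le> (K * norm (w - v)) * norm (w - v)"
    proof (rule differentiable_bound)
      show "convex ?S" by (intro convex_Int convex_cball subspace_imp_convex subspace_Rn)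
      show "(?f has_derivative blinfun_apply (D1 x - D1 v)) (at x within ?S)" if "x \<in> ?S" for x
      proof -
        have "x \<in> W \<inter> Rn d" using S[OF that] w inW by auto
        then have "(\<phi> has_derivative blinfun_apply (D1 x)) (at x within ?S)"
          by (rule has_derivative_subset[OF d1]) auto
        then show ?thesis
          by (auto intro!: derivative_eq_intros blinfun.bounded_linear_right
              bounded_linear.has_derivative[OF blinfun.bounded_linear_right] simp: blinfun.diff_left)
      qed
      show "onorm (blinfun_apply (D1 x - D1 v)) \<le> K * norm (w - v)" if "x \<in> ?S" for x
      proof -
        have "norm (D1 x - D1 v) \<le> K * norm (x - v)" using S[OF that] w by (intro lip) auto
        also have "\<dots> \<le> K * norm (w - v)" using S[OF that] B by (intro mult_left_mono) (auto simp: K_def)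
        finally show ?thesis by (simp add: norm_blinfun.rep_eq)
      qed
    qed (use w assms in \<open>auto simp: dist_norm norm_minus_commute\<close>)
    then show ?thesis by (simp add: blinfun.diff_right power2_eq_square algebra_simps)
  qed
  with lip inW r1 r2 B show ?thesis by (intro that[of r K]) (auto simp: r_def K_def)
qed

text \<open>Following \<xi> inside \<open>M\<close> would increase the inner product with
  \<open>u\<close> at first order in s, which an upper bound of order s^2 forbids.\<close>

lemma tangent_normal_inner_nonpos:
  assumes \<xi>: "\<xi> \<in> tangent_set M x" and K: "\<And>y. y \<in> M \<Longrightarrow> inner (y - x) u \<le> K * (norm (y - x))\<^sup>2"
  shows "inner \<xi> u \<le> 0"
proof (rule ccontr)
  assume "\<not> inner \<xi> u \<le> 0"
  then have pos: "0 < inner \<xi> u" by simp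
  then have u0: "0 < norm u" by auto
  \<comment> \<open>One third of \<open>inner \<xi> u\<close> pays for the approximation error e
    |u|, one third for the quadratic term s k, and the remaining third is the contradiction.\<close>
  define e where "e = inner \<xi> u / (3 * norm u)"
  have e: "0 < e" using pos u0 by (simp add: e_def)
  define k where "k = (\<bar>K\<bar> + 1) * (norm \<xi> + e)\<^sup>2"
  have k: "0 < k" using e by (auto simp: k_def add_nonneg_pos intro!: mult_pos_pos zero_less_power)
  obtain s\<^sub>0 where s\<^sub>0: "0 < s\<^sub>0" "\<And>s. 0 < s \<Longrightarrow> s < s\<^sub>0 \<Longrightarrow> \<exists>y\<in>M. norm (y - x - s *\<^sub>R \<xi>) \<le> e * s"
    using \<xi> e unfolding tangent_set_def by blast
  define s where "s = min (s\<^sub>0 / 2) (inner \<xi> u / (3 * k))"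
  have s: "0 < s" "s < s\<^sub>0" "s \<le> inner \<xi> u / (3 * k)" using s\<^sub>0 k pos by (auto simp: s_def)
  then obtain y where y: "y \<in> M" "norm (y - x - s *\<^sub>R \<xi>) \<le> e * s" using s\<^sub>0(2) by blast
  have "norm (y - x) \<le> norm (s *\<^sub>R \<xi>) + norm (y - x - s *\<^sub>R \<xi>)"
    using norm_triangle_ineq[of "s *\<^sub>R \<xi>" "y - x - s *\<^sub>R \<xi>"] by simp
  then have n: "norm (y - x) \<le> s * (norm \<xi> + e)" using y s by (simp add: algebra_simps)
  have "s * inner \<xi> u = inner (y - x) u - inner (y - x - s *\<^sub>R \<xi>) u"
    by (simp add: inner_diff_left)
  also have "\<dots> \<le> \<bar>K\<bar> * (norm (y - x))\<^sup>2 + e * s * norm u"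
  proof -
    have "inner (y - x) u \<le> \<bar>K\<bar> * (norm (y - x))\<^sup>2"
      by (rule order_trans[OF K[OF y(1)]]) (auto intro: mult_right_mono)
    moreover have "- inner (y - x - s *\<^sub>R \<xi>) u \<le> e * s * norm u"
      using norm_cauchy_schwarz[of "- (y - x - s *\<^sub>R \<xi>)" u] y(2)
      by (simp only: inner_minus_left norm_minus_cancel) (meson mult_right_mono norm_ge_zero order_trans)
    ultimately show ?thesis by simp
  qed
  also have "\<dots> \<le> (\<bar>K\<bar> + 1) * (s * (norm \<xi> + e))\<^sup>2 + s * inner \<xi> u / 3"
    using n u0 by (intro add_mono mult_mono power_mono) (auto simp: e_def)
  also have "(\<bar>K\<bar> + 1) * (s * (norm \<xi> + e))\<^sup>2 = s * (s * k)"
    by (simp add: k_def power_mult_distrib power2_eq_square)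
  finally have "s * inner \<xi> u \<le> s * (s * k + inner \<xi> u / 3)" by (simp add: algebra_simps)
  then have "inner \<xi> u \<le> s * k + inner \<xi> u / 3" using s(1) by (rule mult_left_le_imp_le)
  moreover have "s * k \<le> inner \<xi> u / 3" using s(3) k by (simp add: field_simps)
  ultimately show False using pos by simp
qed

section \<open>Tangent spaces seen in a single chart\<close>

locale tangent_chart =
  fixes n d :: nat and M U W :: "fsv set" and \<phi> :: "fsv \<Rightarrow> fsv"
    and D1 :: "fsv \<Rightarrow> (fsv \<Rightarrow>\<^sub>L fsv)" and D2 :: "fsv \<Rightarrow> (fsv \<Rightarrow>\<^sub>L (fsv \<Rightarrow>\<^sub>L fsv))"
    and V :: "fsv set"
  assumes M_sub: "M \<subseteq> Rn n" and V_def: "V = W \<inter> Rn d" and open_U: "open U" and open_W: "open W"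
    and image_V: "\<phi> ` V = M \<inter> U" and inj_V: "inj_on \<phi> V"
    and cont_inv: "continuous_on (M \<inter> U) (inv_into V \<phi>)"
    and D1: "v \<in> V \<Longrightarrow> (\<phi> has_derivative blinfun_apply (D1 v)) (at v within Rn d)"
    and D2: "v \<in> V \<Longrightarrow> (D1 has_derivative blinfun_apply (D2 v)) (at v within Rn d)"
    and inj_D1: "v \<in> V \<Longrightarrow> inj_on (blinfun_apply (D1 v)) (Rn d)"
begin

text \<open>Continuity of the inverse chart excludes other sheets of \<open>M\<close> that return
  arbitrarily close to \<open>\<phi> v\<close>.\<close>

lemma chart_inverse_near:
  assumes "v \<in> V" "0 < e"
  obtains r where "0 < r" "\<And>y. y \<in> M \<Longrightarrow> norm (y - \<phi> v) < r \<Longrightarrow> \<exists>w\<in>V. y = \<phi> w \<and> norm (w - v) < e"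
proof -
  have pv: "\<phi> v \<in> M \<inter> U" using assms(1) image_V by blast
  obtain r1 where r1: "0 < r1" "ball (\<phi> v) r1 \<subseteq> U"
    using open_U pv open_contains_ball by blast
  obtain r2 where r2: "0 < r2" "\<And>y. y \<in> M \<inter> U \<Longrightarrow> dist y (\<phi> v) < r2 \<Longrightarrow>
      dist (inv_into V \<phi> y) (inv_into V \<phi> (\<phi> v)) < e"
    using cont_inv pv assms(2) unfolding continuous_on_iff by meson
  show ?thesis
  proof (rule that[of "min r1 r2"])
    fix y assume y: "y \<in> M" "norm (y - \<phi> v) < min r1 r2"
    then have "y \<in> U" using r1 by (auto simp: dist_norm norm_minus_commute)
    then have yU: "y \<in> \<phi> ` V" using y image_V by auto
    have "dist (inv_into V \<phi> y) v < e"
      using r2(2)[of y] y \<open>y \<in> U\<close> assms(1) inj_V by (simp add: dist_norm)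
    then show "\<exists>w\<in>V. y = \<phi> w \<and> norm (w - v) < e"
      using yU by (intro bexI[of _ "inv_into V \<phi> y"]) (auto simp: f_inv_into_f inv_into_into dist_norm)
  qed (use r1 r2 in auto)
qed

text \<open>Near \<open>\<phi> v\<close> the first-order part is orthogonal to \<open>u\<close>, so
  only the quadratic remainder counts; at distance r' or more a linear bound is quadratic at the
  price of a factor 1 / r'. The constant is uncontrolled, to be improved by
  \<open>proximal_normal\<close>.\<close>

lemma chart_normal_quadratic:
  assumes v: "v \<in> V" and u: "\<And>a. a \<in> Rn d \<Longrightarrow> inner (D1 v a) u = 0"
  shows "\<exists>K. \<forall>y\<in>M. inner (y - \<phi> v) u \<le> K * (norm (y - \<phi> v))\<^sup>2"
proof -
  have vW: "v \<in> W" "v \<in> Rn d" using v V_def by auto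
  obtain K r where K: "0 < r" "0 \<le> K"
    "\<And>w. w \<in> Rn d \<Longrightarrow> norm (w - v) < r \<Longrightarrow> norm (\<phi> w - \<phi> v - D1 v (w - v)) \<le> K * (norm (w - v))\<^sup>2"
    using second_order_remainder[OF open_W vW, of \<phi> D1 "blinfun_apply (D2 v)"] D1 D2[OF v] V_def
    by metis
  obtain m where m: "0 < m" "\<And>a. a \<in> Rn d \<Longrightarrow> m * norm a \<le> norm (D1 v a)"
    using injective_on_Rn_bounded_below[OF blinfun.bounded_linear_right inj_D1[OF v]] by blast
  \<comment> \<open>Keeps the remainder below m / 2 |w - v|, so that |w - v| is at most 2 / m times
    |y - \<phi> v|.\<close>
  define e where "e = min r (m / (2 * (K + 1)))"
  have e: "0 < e" using K m by (simp add: e_def)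
  obtain r' where r': "0 < r'" "\<And>y. y \<in> M \<Longrightarrow> norm (y - \<phi> v) < r' \<Longrightarrow> \<exists>w\<in>V. y = \<phi> w \<and> norm (w - v) < e"
    using chart_inverse_near[OF v e] by blast
  define K' where "K' = norm u * (4 * K / m\<^sup>2) + norm u / r'"
  have "inner (y - \<phi> v) u \<le> K' * (norm (y - \<phi> v))\<^sup>2" if y: "y \<in> M" for y
  proof (cases "norm (y - \<phi> v) < r'")
    case True
    then obtain w where w: "w \<in> V" "y = \<phi> w" "norm (w - v) < e" using r'(2) y by blast
    have wR: "w \<in> Rn d" "w - v \<in> Rn d" using w v V_def by auto
    have rem: "norm (y - \<phi> v - D1 v (w - v)) \<le> K * (norm (w - v))\<^sup>2"
      unfolding w(2) using w wR by (intro K) (auto simp: e_def)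
    have "inner (y - \<phi> v) u = inner (y - \<phi> v - D1 v (w - v)) u"
      using u[OF wR(2)] by (simp add: inner_diff_left)
    also have "\<dots> \<le> norm (y - \<phi> v - D1 v (w - v)) * norm u" by (rule norm_cauchy_schwarz)
    also have "\<dots> \<le> K * (norm (w - v))\<^sup>2 * norm u" by (intro mult_right_mono rem) auto
    finally have 1: "inner (y - \<phi> v) u \<le> K * (norm (w - v))\<^sup>2 * norm u" .
    have "K * norm (w - v) \<le> (K + 1) * (m / (2 * (K + 1)))"
      using w(3) K by (intro mult_mono) (auto simp: e_def)
    also have "\<dots> = m / 2" using K by (simp add: field_simps)
    finally have "K * norm (w - v) * norm (w - v) \<le> m / 2 * norm (w - v)"
      by (intro mult_right_mono) auto
    moreover have "m * norm (w - v) \<le> norm (y - \<phi> v) + norm (y - \<phi> v - D1 v (w - v))"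
      using m(2)[OF wR(2)] norm_triangle_ineq4[of "y - \<phi> v" "y - \<phi> v - D1 v (w - v)"] by simp
    ultimately have "m / 2 * norm (w - v) \<le> norm (y - \<phi> v)"
      using rem by (simp add: power2_eq_square algebra_simps)
    then have "norm (w - v) \<le> 2 / m * norm (y - \<phi> v)" using m by (simp add: field_simps)
    then have "(norm (w - v))\<^sup>2 \<le> (2 / m * norm (y - \<phi> v))\<^sup>2" by (intro power_mono) auto
    then have "K * (norm (w - v))\<^sup>2 * norm u \<le> K * (2 / m * norm (y - \<phi> v))\<^sup>2 * norm u"
      using K by (intro mult_right_mono mult_left_mono) auto
    also have "\<dots> = norm u * (4 * K / m\<^sup>2) * (norm (y - \<phi> v))\<^sup>2"
      by (simp add: power_mult_distrib power_divide)
    also have "\<dots> \<le> K' * (norm (y - \<phi> v))\<^sup>2"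
      using r' by (intro mult_right_mono) (auto simp: K'_def)
    finally show ?thesis using 1 by simp
  next
    case False
    have "inner (y - \<phi> v) u \<le> norm (y - \<phi> v) * norm u" by (rule norm_cauchy_schwarz)
    also have "\<dots> = norm u / r' * (r' * norm (y - \<phi> v))" using r' by simp
    also have "\<dots> \<le> norm u / r' * (norm (y - \<phi> v))\<^sup>2"
      unfolding power2_eq_square using False r' by (intro mult_left_mono mult_right_mono) auto
    also have "\<dots> \<le> K' * (norm (y - \<phi> v))\<^sup>2"
      using K m by (intro mult_right_mono) (auto simp: K'_def)
    finally show ?thesis .
  qed
  then show ?thesis by blast
qed

lemma tangent_set_chart_superset: "v \<in> V \<Longrightarrow> D1 v ` Rn d \<subseteq> tangent_set M (\<phi> v)"
proof (safe, unfold tangent_set_def mem_Collect_eq, intro allI impI)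
  fix a :: fsv and e :: real assume v: "v \<in> V" and a: "a \<in> Rn d" and e: "0 < e"
  have vW: "v \<in> W" "v \<in> Rn d" using v V_def by auto
  obtain r1 where r1: "0 < r1" "ball v r1 \<subseteq> W"
    using open_W vW open_contains_ball by blast
  obtain r2 where r2: "0 < r2" "\<And>w. w \<in> Rn d \<Longrightarrow> norm (w - v) < r2 \<Longrightarrow>
      norm (\<phi> w - \<phi> v - D1 v (w - v)) \<le> e / (norm a + 1) * norm (w - v)"
  proof -
    have "0 < e / (norm a + 1)" using e by (intro divide_pos_pos add_nonneg_pos) auto
    then show ?thesis using D1[OF v] that unfolding has_derivative_within_alt by blast
  qed
  define s\<^sub>0 where "s\<^sub>0 = min r1 r2 / (norm a + 1)"
  have "\<exists>y\<in>M. norm (y - \<phi> v - s *\<^sub>R D1 v a) \<le> e * s" if s: "0 < s" "s < s\<^sub>0" for s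
  proof
    have "s * (norm a + 1) < min r1 r2"
      using s(2) by (simp add: s\<^sub>0_def pos_less_divide_eq add_nonneg_pos)
    then have sa: "s * norm a < min r1 r2" using s(1) by (simp add: algebra_simps)
    then have "v + s *\<^sub>R a \<in> W" using r1 s by (auto simp: dist_norm)
    then have "v + s *\<^sub>R a \<in> V" using a vW V_def by auto
    then show "\<phi> (v + s *\<^sub>R a) \<in> M" using image_V by blast
    have "norm (\<phi> (v + s *\<^sub>R a) - \<phi> v - D1 v (s *\<^sub>R a)) \<le> e / (norm a + 1) * (s * norm a)"
      using r2(2)[of "v + s *\<^sub>R a"] a vW sa s by simp
    also have "\<dots> = e * s * (norm a / (norm a + 1))" by simp
    also have "\<dots> \<le> e * s * 1" using e s by (intro mult_left_mono) (auto simp: divide_le_eq add_nonneg_pos)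
    finally show "norm (\<phi> (v + s *\<^sub>R a) - \<phi> v - s *\<^sub>R D1 v a) \<le> e * s"
      by (simp add: blinfun.scaleR_right)
  qed
  moreover have "0 < s\<^sub>0" using r1 r2 by (simp add: s\<^sub>0_def add_nonneg_pos)
  ultimately show "\<exists>s\<^sub>0>0. \<forall>s. 0 < s \<and> s < s\<^sub>0 \<longrightarrow> (\<exists>y\<in>M. norm (y - \<phi> v - s *\<^sub>R D1 v a) \<le> e * s)"
    by blast
qed

text \<open>For the harder inclusion, the normal part \<open>?u\<close> of a tangent vector \<xi>
  must satisfy \<open>inner \<xi> ?u \<le> 0\<close> by the quadratic bound, yet this inner product
  is the squared length of \<open>?u\<close>.\<close>

lemma tangent_set_chart:
  assumes v: "v \<in> V"
  shows "tangent_set M (\<phi> v) = D1 v ` Rn d"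
proof
  obtain b where b: "orthonormal d b" "frame_span d b = D1 v ` Rn d"
    using gram_schmidt_image[OF _ inj_D1[OF v]] blinfun.bounded_linear_right bounded_linear.linear by blast
  show "tangent_set M (\<phi> v) \<subseteq> D1 v ` Rn d"
  proof
    fix \<xi> assume \<xi>: "\<xi> \<in> tangent_set M (\<phi> v)"
    let ?u = "\<xi> - frame_proj d b \<xi>"
    have "inner (D1 v a) ?u = 0" if "a \<in> Rn d" for a
      using frame_proj_orthogonal[OF b(1), of "D1 v a" \<xi>] that b(2) by (simp add: inner_commute)
    then obtain K where "\<And>y. y \<in> M \<Longrightarrow> inner (y - \<phi> v) ?u \<le> K * (norm (y - \<phi> v))\<^sup>2"
      using chart_normal_quadratic[OF v, of ?u] by auto
    then have "inner \<xi> ?u \<le> 0" by (rule tangent_normal_inner_nonpos[OF \<xi>])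
    moreover have "inner (frame_proj d b \<xi>) ?u = 0"
      using frame_proj_orthogonal[OF b(1), of "frame_proj d b \<xi>" \<xi>] by (simp add: inner_commute)
    ultimately have "inner ?u ?u \<le> 0" by (simp only: inner_diff_left)
    then have "?u = 0" by (metis inner_eq_zero_iff inner_ge_zero order_antisym)
    then have "\<xi> = frame_proj d b \<xi>" by simp
    then show "\<xi> \<in> D1 v ` Rn d" using b(2) frame_proj_in_span[of d b \<xi>] by simp
  qed
qed (rule tangent_set_chart_superset[OF v])

text \<open>Vectors with the same parameter \<open>a\<close> are matched: \<open>D1 v a\<close> and
  \<open>D1 w a\<close> differ by at most \<eta> |a|, and neither is shorter than m / 2 |a|, so the
  error is relative to either of them.\<close>

lemma tangent_set_chart_continuous:
  assumes v: "v \<in> V" and e: "0 < e"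
  obtains r where "0 < r" "\<And>y. y \<in> M \<Longrightarrow> norm (y - \<phi> v) < r \<Longrightarrow> gap_le (tangent_set M (\<phi> v)) (tangent_set M y) e"
proof -
  have vW: "v \<in> W" "v \<in> Rn d" using v V_def by auto
  obtain K r where K: "0 < r" "0 \<le> K"
    "\<And>w. w \<in> Rn d \<Longrightarrow> norm (w - v) < r \<Longrightarrow> norm (D1 w - D1 v) \<le> K * norm (w - v)"
    using second_order_remainder[OF open_W vW, of \<phi> D1 "blinfun_apply (D2 v)"] D1 D2[OF v] V_def
    by metis
  obtain m where m: "0 < m" "\<And>a. a \<in> Rn d \<Longrightarrow> m * norm a \<le> norm (D1 v a)"
    using injective_on_Rn_bounded_below[OF blinfun.bounded_linear_right inj_D1[OF v]] by blast
  define \<eta> where "\<eta> = min (m / 2) (e * m / 2)"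
  have \<eta>: "0 < \<eta>" "\<eta> \<le> m / 2" "\<eta> \<le> e * m / 2" using m e by (auto simp: \<eta>_def)
  define e' where "e' = min r (\<eta> / (K + 1))"
  have e': "0 < e'" using K \<eta> by (simp add: e'_def)
  obtain r' where r': "0 < r'" "\<And>y. y \<in> M \<Longrightarrow> norm (y - \<phi> v) < r' \<Longrightarrow> \<exists>w\<in>V. y = \<phi> w \<and> norm (w - v) < e'"
    using chart_inverse_near[OF v e'] by blast
  have "gap_le (tangent_set M (\<phi> v)) (tangent_set M y) e" if y: "y \<in> M" "norm (y - \<phi> v) < r'" for y
  proof -
    obtain w where w: "w \<in> V" "y = \<phi> w" "norm (w - v) < e'" using r'(2) y by blast
    have "norm (D1 w - D1 v) \<le> K * norm (w - v)" using w V_def by (intro K) (auto simp: e'_def)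
    also have "\<dots> \<le> (K + 1) * (\<eta> / (K + 1))" using w K by (intro mult_mono) (auto simp: e'_def)
    also have "\<dots> = \<eta>" using K by simp
    finally have D: "norm (D1 w - D1 v) \<le> \<eta>" .
    have diff: "norm (D1 v a - D1 w a) \<le> \<eta> * norm a" for a
      using norm_blinfun[of "D1 w - D1 v" a] mult_right_mono[OF D, of "norm a"]
      by (simp add: blinfun.diff_left norm_minus_commute)
    have 1: "norm (D1 v a - D1 w a) \<le> e * norm (D1 v a)" "norm (D1 v a - D1 w a) \<le> e * norm (D1 w a)"
      if "a \<in> Rn d" for a
    proof -
      have "m * norm a \<le> norm (D1 w a) + norm (D1 v a - D1 w a)"
        using m(2)[OF that] norm_triangle_ineq[of "D1 w a" "D1 v a - D1 w a"] by simp
      also have "norm (D1 v a - D1 w a) \<le> m / 2 * norm a"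
        using diff[of a] mult_right_mono[OF \<eta>(2), of "norm a"] by simp
      finally have low: "m / 2 * norm a \<le> norm (D1 w a)" by simp
      have low': "m / 2 * norm a \<le> norm (D1 v a)"
        by (rule order_trans[OF _ m(2)[OF that]]) (use m in \<open>auto intro!: mult_right_mono\<close>)
      have "norm (D1 v a - D1 w a) \<le> e * (m / 2 * norm a)"
        using diff[of a] mult_right_mono[OF \<eta>(3), of "norm a"] by simp
      then show "norm (D1 v a - D1 w a) \<le> e * norm (D1 v a)" "norm (D1 v a - D1 w a) \<le> e * norm (D1 w a)"
        using mult_left_mono[OF low, of e] mult_left_mono[OF low', of e] e by linarith+
    qed
    show ?thesis
      unfolding w(2) tangent_set_chart[OF v] tangent_set_chart[OF w(1)] gap_le_def
      using 1 by blast
  qed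
  with r' show ?thesis using that by blast
qed

end

locale reach_manifold = positive_reach +
  fixes d :: nat
  assumes C2: "C2_submanifold n d M"
begin

abbreviation Tan :: "fsv \<Rightarrow> fsv set" where "Tan \<equiv> tangent_set M"

lemma obtain_chart:
  assumes "p \<in> M"
  obtains U W \<phi> D1 D2 v where "tangent_chart n d M U W \<phi> D1 D2 (W \<inter> Rn d)" "v \<in> W \<inter> Rn d" "\<phi> v = p"
proof -
  obtain U W and \<phi> :: "fsv \<Rightarrow> fsv" and D1 :: "fsv \<Rightarrow> (fsv \<Rightarrow>\<^sub>L fsv)"
      and D2 :: "fsv \<Rightarrow> (fsv \<Rightarrow>\<^sub>L (fsv \<Rightarrow>\<^sub>L fsv))"
    where c: "open U" "p \<in> U" "open W" "\<phi> ` (W \<inter> Rn d) = M \<inter> U" "inj_on \<phi> (W \<inter> Rn d)"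
      "continuous_on (M \<inter> U) (inv_into (W \<inter> Rn d) \<phi>)"
      "\<forall>v\<in>W \<inter> Rn d. (\<phi> has_derivative blinfun_apply (D1 v)) (at v within Rn d)"
      "\<forall>v\<in>W \<inter> Rn d. (D1 has_derivative blinfun_apply (D2 v)) (at v within Rn d)"
      "\<forall>v\<in>W \<inter> Rn d. inj_on (blinfun_apply (D1 v)) (Rn d)"
    using C2 assms unfolding C2_submanifold_def Let_def by metis
  have "p \<in> \<phi> ` (W \<inter> Rn d)" using c assms by auto
  then obtain v where "v \<in> W \<inter> Rn d" "\<phi> v = p" by blast
  moreover have "tangent_chart n d M U W \<phi> D1 D2 (W \<inter> Rn d)"
    using c M_subset by unfold_locales auto
  ultimately show ?thesis using that by blast
qed

lemma tangent_set_subset_Rn: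
  assumes "x \<in> M"
  shows "Tan x \<subseteq> Rn n"
proof
  fix \<xi> assume \<xi>: "\<xi> \<in> Tan x"
  show "\<xi> \<in> Rn n"
  proof (rule RnI)
    fix i assume i: "n \<le> i"
    have "\<bar>coord \<xi> i\<bar> \<le> 0 + e" if e: "0 < e" for e
    proof -
      obtain s\<^sub>0 where s\<^sub>0: "0 < s\<^sub>0" "\<And>s. 0 < s \<Longrightarrow> s < s\<^sub>0 \<Longrightarrow> \<exists>y\<in>M. norm (y - x - s *\<^sub>R \<xi>) \<le> e * s"
        using \<xi> e unfolding tangent_set_def by blast
      obtain y where y: "y \<in> M" "norm (y - x - (s\<^sub>0 / 2) *\<^sub>R \<xi>) \<le> e * (s\<^sub>0 / 2)"
        using s\<^sub>0(2)[of "s\<^sub>0 / 2"] s\<^sub>0(1) by auto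
      have "coord y i = 0" "coord x i = 0" using y(1) assms i M_in_Rn Rn_coord by blast+
      then have "(s\<^sub>0 / 2) * \<bar>coord \<xi> i\<bar> = \<bar>coord (y - x - (s\<^sub>0 / 2) *\<^sub>R \<xi>) i\<bar>"
        using s\<^sub>0(1) by (simp add: abs_mult)
      also have "\<dots> \<le> (s\<^sub>0 / 2) * e"
        using abs_coord_le_norm[of "y - x - (s\<^sub>0 / 2) *\<^sub>R \<xi>" i] y(2) by (simp add: mult.commute)
      finally show ?thesis using s\<^sub>0(1) by (simp add: mult_le_cancel_left_pos)
    qed
    then have "\<bar>coord \<xi> i\<bar> \<le> 0" by (rule field_le_epsilon)
    then show "coord \<xi> i = 0" by simp
  qed
qed

lemma tangent_frame_exists:
  assumes "x \<in> M"
  shows "\<exists>b. orthonormal d b \<and> frame_span d b = Tan x"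
proof -
  obtain U W \<phi> D1 D2 v where c: "tangent_chart n d M U W \<phi> D1 D2 (W \<inter> Rn d)" "v \<in> W \<inter> Rn d" "\<phi> v = x"
    using obtain_chart[OF assms] .
  interpret tangent_chart n d M U W \<phi> D1 D2 "W \<inter> Rn d" by fact
  show ?thesis
    using gram_schmidt_image[OF _ inj_D1[OF c(2)]] blinfun.bounded_linear_right bounded_linear.linear
      tangent_set_chart[OF c(2)] c(3) by metis
qed

lemma tangent_normal_quadratic:
  assumes "x \<in> M" and u: "\<And>\<xi>. \<xi> \<in> Tan x \<Longrightarrow> inner \<xi> u = 0"
  shows "\<exists>K. \<forall>y\<in>M. inner (y - x) u \<le> K * (norm (y - x))\<^sup>2"
proof -
  obtain U W \<phi> D1 D2 v where c: "tangent_chart n d M U W \<phi> D1 D2 (W \<inter> Rn d)" "v \<in> W \<inter> Rn d" "\<phi> v = x"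
    using obtain_chart[OF assms(1)] .
  interpret tangent_chart n d M U W \<phi> D1 D2 "W \<inter> Rn d" by fact
  show ?thesis
    using chart_normal_quadratic[OF c(2)] u tangent_set_chart[OF c(2)] c(3) by blast
qed

lemma tangent_set_continuous:
  assumes "x \<in> M" "0 < e"
  shows "\<exists>r>0. \<forall>y\<in>M. norm (y - x) < r \<longrightarrow> gap_le (Tan x) (Tan y) e"
proof -
  obtain U W \<phi> D1 D2 v where c: "tangent_chart n d M U W \<phi> D1 D2 (W \<inter> Rn d)" "v \<in> W \<inter> Rn d" "\<phi> v = x"
    using obtain_chart[OF assms(1)] .
  interpret tangent_chart n d M U W \<phi> D1 D2 "W \<inter> Rn d" by fact
  show ?thesis
    using tangent_set_chart_continuous[OF c(2) assms(2)] c(3) by metis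
qed

text \<open>A Lebesgue number for the balls of pointwise continuity puts both points near a common
  centre; the two gaps e / 3 then compose to at most e.\<close>

lemma tangent_gap_uniform:
  assumes "0 < e" "e \<le> 1"
  shows "\<exists>r>0. \<forall>x\<in>M. \<forall>y\<in>M. norm (x - y) \<le> r \<longrightarrow> gap_le (Tan x) (Tan y) e"
proof -
  obtain r where r: "\<And>x. x \<in> M \<Longrightarrow> 0 < r x"
    "\<And>x y. x \<in> M \<Longrightarrow> y \<in> M \<Longrightarrow> norm (y - x) < r x \<Longrightarrow> gap_le (Tan x) (Tan y) (e / 3)"
    using tangent_set_continuous[where e="e / 3"] assms(1) by (metis divide_pos_pos zero_less_numeral)
  have sub: "M \<subseteq> \<Union> ((\<lambda>x. ball x (r x)) ` M)" using r by fastforce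
  have ne: "(\<lambda>x. ball x (r x)) ` M \<noteq> {}" using nonempty_M by blast
  obtain e' where e': "0 < e'" "\<And>T. T \<subseteq> M \<Longrightarrow> diameter T < e' \<Longrightarrow> \<exists>B\<in>(\<lambda>x. ball x (r x)) ` M. T \<subseteq> B"
    by (rule Lebesgue_number_lemma[OF compact_M ne sub]) blast+
  have "gap_le (Tan x) (Tan y) e" if xy: "x \<in> M" "y \<in> M" "norm (x - y) \<le> e' / 2" for x y
  proof -
    have "diameter {x, y} \<le> e' / 2"
      by (rule diameter_le) (use xy e' in \<open>auto simp: norm_minus_commute\<close>)
    then obtain z where z: "z \<in> M" "x \<in> ball z (r z)" "y \<in> ball z (r z)"
      using e'(2)[of "{x, y}"] xy e'(1) by auto
    have "gap_le (Tan z) (Tan x) (e / 3)" "gap_le (Tan z) (Tan y) (e / 3)"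
      using z xy by (auto intro!: r(2) simp: dist_norm norm_minus_commute)
    then have "gap_le (Tan x) (Tan y) (e / 3 + e / 3 + e / 3 * (e / 3))"
      using assms by (intro gap_le_trans[OF gap_le_commute]) auto
    moreover have "e / 3 * (e / 3) \<le> e / 3"
      using assms by (simp add: mult_left_le)
    ultimately show ?thesis by (elim gap_le_mono) linarith
  qed
  then show ?thesis using e'(1) by (intro exI[of _ "e' / 2"]) auto
qed

end

section \<open>Local graph structure at the scale of the reach\<close>

context reach_manifold
begin

definition tframe :: "fsv \<Rightarrow> nat \<Rightarrow> fsv" where
  "tframe x = (SOME b. orthonormal d b \<and> frame_span d b = Tan x)"

abbreviation P :: "fsv \<Rightarrow> fsv \<Rightarrow> fsv" where
  "P x \<equiv> frame_proj d (tframe x)"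

lemma tframe: 
  assumes "x \<in> M"
  shows orthonormal_tframe: "orthonormal d (tframe x)" and span_tframe: "frame_span d (tframe x) = Tan x"
  using someI_ex[OF tangent_frame_exists[OF assms]] by (auto simp: tframe_def)

lemma P_in_Tan: "x \<in> M \<Longrightarrow> P x y \<in> Tan x"
  using frame_proj_in_span span_tframe by metis

lemma subspace_Tan: "x \<in> M \<Longrightarrow> subspace (Tan x)"
  using subspace_frame_span span_tframe by metis

lemma P_id: "x \<in> M \<Longrightarrow> \<xi> \<in> Tan x \<Longrightarrow> P x \<xi> = \<xi>"
  using frame_proj_id[OF orthonormal_tframe] span_tframe by blast

lemma norm_P_le: "x \<in> M \<Longrightarrow> norm (P x y) \<le> norm y"
  by (rule norm_frame_proj_le[OF orthonormal_tframe])

lemma norm_coP_le: "x \<in> M \<Longrightarrow> norm (y - P x y) \<le> norm y"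
  by (rule norm_frame_coproj_le[OF orthonormal_tframe])

lemma P_in_Rn: "x \<in> M \<Longrightarrow> P x y \<in> Rn n"
  using P_in_Tan tangent_set_subset_Rn by blast

text \<open>In the direction of the normal component of y - x the chart yields some quadratic bound,
  and \<open>proximal_normal\<close> turns its constant into 1 / \<rho>. In this form the reach
  bounds the curvature of \<open>M\<close>.\<close>

lemma tangent_deviation:
  assumes x: "x \<in> M" and y: "y \<in> M"
  shows "\<rho> * norm ((y - x) - P x (y - x)) \<le> (norm (y - x))\<^sup>2"
proof (cases "(y - x) - P x (y - x) = 0")
  case False
  let ?w = "(y - x) - P x (y - x)"
  let ?u = "?w /\<^sub>R norm ?w"
  have orth: "inner \<xi> ?w = 0" if "\<xi> \<in> Tan x" for \<xi>
    using frame_proj_orthogonal[OF orthonormal_tframe[OF x], of \<xi> "y - x"] that span_tframe[OF x]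
    by (simp add: inner_commute)
  then have "inner \<xi> ?u = 0" if "\<xi> \<in> Tan x" for \<xi> using that by simp
  then obtain K where "\<And>y. y \<in> M \<Longrightarrow> inner (y - x) ?u \<le> K * (norm (y - x))\<^sup>2"
    using tangent_normal_quadratic[OF x] by blast
  moreover have "?u \<in> Rn n" using P_in_Rn[OF x] M_in_Rn x y by (intro Rn_intros) auto
  ultimately have "\<rho> * inner (y - x) ?u \<le> (norm (y - x))\<^sup>2"
    using False x y by (intro proximal_normal) auto
  moreover have "inner (y - x) ?w = inner ?w ?w"
    using orth[OF P_in_Tan[OF x]] by (simp add: inner_diff_left)
  then have "inner (y - x) ?u = norm ?w"
    using False by (simp only: inner_scaleR_right) (simp add: power2_norm_eq_inner[symmetric] power2_eq_square)
  ultimately show ?thesis by simp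
qed simp

lemma gap_coproj:
  assumes "gap_le (Tan x) (Tan y) e" "y \<in> M" "\<xi> \<in> Tan x"
  shows "norm (\<xi> - P y \<xi>) \<le> e * norm \<xi>"
proof -
  obtain \<eta> where "\<eta> \<in> Tan y" "norm (\<xi> - \<eta>) \<le> e * norm \<xi>"
    using assms(1,3) unfolding gap_le_def by blast
  then show ?thesis
    using frame_coproj_minimal[OF orthonormal_tframe[OF assms(2)], of \<eta> \<xi>] span_tframe[OF assms(2)]
    by simp
qed

text \<open>A minimiser of \<open>|w - P p (y - p)| + |y - p| / 2\<close> over \<open>y \<in> M\<close> must satisfy
  \<open>P p (y - p) = w\<close>: otherwise moving along a tangent vector at \<open>y\<close> that is close to the direction of
  \<open>w - P p (y - p)\<close> decreases the functional.\<close>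

lemma tangent_projection_onto:
  assumes p: "p \<in> M" and w: "w \<in> Tan p"
    and gap: "\<And>z. z \<in> M \<Longrightarrow> norm (z - p) \<le> 2 * norm w \<Longrightarrow> gap_le (Tan p) (Tan z) (1/8)"
  shows "\<exists>z\<in>M. P p (z - p) = w \<and> norm (z - p) \<le> 2 * norm w"
proof -
  let ?G = "\<lambda>y. norm (w - P p (y - p)) + norm (y - p) / 2"
  have "continuous_on M ?G"
    by (intro continuous_intros continuous_on_frame_proj[OF orthonormal_tframe[OF p]]) auto
  then obtain z where z: "z \<in> M" "\<And>y. y \<in> M \<Longrightarrow> ?G z \<le> ?G y"
    using continuous_attains_inf[OF compact_M nonempty_M, of ?G] by blast
  have "?G z \<le> norm w" using z(2)[OF p] linear_0[OF linear_frame_proj] by simp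
  then have zp: "norm (z - p) \<le> 2 * norm w" using norm_ge_zero[of "w - P p (z - p)"] by linarith
  have "P p (z - p) = w"
  proof (rule ccontr)
    assume ne: "P p (z - p) \<noteq> w"
    define w' where "w' = w - P p (z - p)"
    define e where "e = w' /\<^sub>R norm w'"
    have w': "w' \<noteq> 0" using ne by (simp add: w'_def)
    then have ne1: "norm e = 1" by (simp add: e_def)
    have "e \<in> Tan p"
      unfolding e_def w'_def using w P_in_Tan[OF p] subspace_Tan[OF p]
      by (auto intro!: subspace_scale subspace_diff)
    then obtain \<xi> where \<xi>: "\<xi> \<in> Tan z" "norm (e - \<xi>) \<le> 1/8"
      using gap[OF z(1) zp] ne1 unfolding gap_le_def by fastforce
    obtain s\<^sub>0 where s\<^sub>0: "0 < s\<^sub>0" "\<And>s. 0 < s \<Longrightarrow> s < s\<^sub>0 \<Longrightarrow> \<exists>y\<in>M. norm (y - z - s *\<^sub>R \<xi>) \<le> 1/8 * s"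
    proof -
      have "(0::real) < 1/8" by simp
      then show ?thesis using \<xi>(1) that unfolding tangent_set_def mem_Collect_eq by blast
    qed
    define s where "s = min (s\<^sub>0 / 2) (norm w')"
    have s: "0 < s" "s < s\<^sub>0" "s \<le> norm w'" using s\<^sub>0 w' by (auto simp: s_def)
    obtain y where y: "y \<in> M" "norm (y - z - s *\<^sub>R \<xi>) \<le> 1/8 * s" using s\<^sub>0(2) s by blast
    have "norm (y - z - s *\<^sub>R e) \<le> norm (y - z - s *\<^sub>R \<xi>) + norm (s *\<^sub>R (\<xi> - e))"
      using norm_triangle_ineq[of "y - z - s *\<^sub>R \<xi>" "s *\<^sub>R (\<xi> - e)"] by (simp add: algebra_simps)
    also have "norm (s *\<^sub>R (\<xi> - e)) \<le> s * (1/8)"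
      using \<xi>(2) s by (simp add: norm_minus_commute mult_left_mono)
    finally have yz: "norm (y - z - s *\<^sub>R e) \<le> s / 4" using y(2) by simp
    have "P p (y - p) - P p (z - p) - s *\<^sub>R e = P p (y - z - s *\<^sub>R e)"
      using P_id[OF p \<open>e \<in> Tan p\<close>] by (simp add: frame_proj_diff frame_proj_scale)
    then have "norm (P p (y - p) - P p (z - p) - s *\<^sub>R e) \<le> s / 4"
      using norm_P_le[OF p, of "y - z - s *\<^sub>R e"] yz by simp
    moreover have "norm (w - P p (y - p)) \<le> norm (w' - s *\<^sub>R e) + norm (P p (y - p) - P p (z - p) - s *\<^sub>R e)"
      using norm_triangle_ineq4[of "w' - s *\<^sub>R e" "P p (y - p) - P p (z - p) - s *\<^sub>R e"]
      by (simp add: w'_def)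
    moreover have "norm (w' - s *\<^sub>R e) = norm w' - s"
    proof -
      have "w' - s *\<^sub>R e = (norm w' - s) *\<^sub>R e"
        using w' by (simp add: e_def algebra_simps)
      then show ?thesis using s ne1 by simp
    qed
    ultimately have 1: "norm (w - P p (y - p)) \<le> norm w' - s + s / 4" by linarith
    have "norm (y - p) \<le> norm (z - p) + norm (y - z - s *\<^sub>R e) + norm (s *\<^sub>R e)"
      using norm_triangle_ineq[of "z - p" "y - z - s *\<^sub>R e + s *\<^sub>R e"]
        norm_triangle_ineq[of "y - z - s *\<^sub>R e" "s *\<^sub>R e"] by simp
    then have 2: "norm (y - p) \<le> norm (z - p) + s / 4 + s" using yz s ne1 by simp
    \<comment> \<open>The net change is at most - s + s / 4 + (s / 4 + s) / 2 = - s / 8. The weight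
      1/2 on |y - p| leaves this room and is also what bounds |z - p| by 2 |w|.\<close>
    have "?G y < ?G z" using 1 2 s by (simp add: w'_def[symmetric])
    with z(2)[OF y(1)] show False by simp
  qed
  with z zp show ?thesis by blast
qed

text \<open>Rescale \<xi> to length s = |x - p| and realise it as the tangential displacement from
  \<open>x\<close> to some \<open>y\<close> in \<open>M\<close>. The deviations of \<open>y\<close>
  and \<open>x\<close> from the tangent plane at \<open>p\<close> and of \<open>y\<close> from the
  one at \<open>x\<close> are at most 9 s^2, s^2 and 4 s^2, each over \<rho>; their sum is 14 s^2 /
  \<rho>.\<close>

lemma tangent_angle:
  assumes x: "x \<in> M" and p: "p \<in> M" and \<xi>: "\<xi> \<in> Tan x"
    and gap: "\<And>z. z \<in> M \<Longrightarrow> norm (z - x) \<le> 2 * norm (x - p) \<Longrightarrow> gap_le (Tan x) (Tan z) (1/8)"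
  shows "\<rho> * norm (\<xi> - P p \<xi>) \<le> 14 * norm (x - p) * norm \<xi>"
proof (cases "x = p \<or> \<xi> = 0")
  case True
  then show ?thesis using P_id[OF p] \<xi> linear_0[OF linear_frame_proj] by auto
next
  case False
  let ?s = "norm (x - p)"
  have s: "0 < ?s" "0 < norm \<xi>" using False by auto
  define w where "w = (?s / norm \<xi>) *\<^sub>R \<xi>"
  have w: "w \<in> Tan x" "norm w = ?s"
    using \<xi> subspace_Tan[OF x] s by (auto simp: w_def intro: subspace_scale)
  obtain y where y: "y \<in> M" "P x (y - x) = w" "norm (y - x) \<le> 2 * ?s"
    using tangent_projection_onto[OF x w(1)] gap w(2) by auto
  have yp: "norm (y - p) \<le> 3 * ?s" using norm_triangle_ineq[of "y - x" "x - p"] y(3) by simp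
  have "\<rho> * norm (y - x - w) \<le> (2 * ?s)\<^sup>2"
    using tangent_deviation[OF x y(1)] y(2,3) power_mono[OF y(3), of 2] by simp
  moreover have "\<rho> * norm (y - p - P p (y - p)) \<le> (3 * ?s)\<^sup>2"
    using tangent_deviation[OF p y(1)] power_mono[OF yp, of 2] by simp
  moreover have "\<rho> * norm (x - p - P p (x - p)) \<le> ?s\<^sup>2"
    using tangent_deviation[OF p x] by simp
  moreover have "norm (w - P p w) \<le> norm (y - p - P p (y - p)) + norm (x - p - P p (x - p)) + norm (y - x - w)"
  proof -
    have "w - P p w = ((y - p - P p (y - p)) - (x - p - P p (x - p))) - ((y - x - w) - P p (y - x - w))"
      by (simp add: frame_proj_diff)
    then have "norm (w - P p w) \<le> norm ((y - p - P p (y - p)) - (x - p - P p (x - p))) + norm ((y - x - w) - P p (y - x - w))"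
      by (metis norm_triangle_ineq4)
    also have "\<dots> \<le> norm (y - p - P p (y - p)) + norm (x - p - P p (x - p)) + norm (y - x - w)"
      by (intro add_mono norm_triangle_ineq4 norm_coP_le[OF p])
    finally show ?thesis .
  qed
  then have "\<rho> * norm (w - P p w) \<le> \<rho> * (norm (y - p - P p (y - p)) + norm (x - p - P p (x - p)) + norm (y - x - w))"
    using rho_pos by (intro mult_left_mono) auto
  ultimately have "\<rho> * norm (w - P p w) \<le> 14 * ?s\<^sup>2"
    by (simp add: distrib_left power2_eq_square)
  moreover have "norm (w - P p w) = ?s / norm \<xi> * norm (\<xi> - P p \<xi>)"
    using s by (simp add: w_def frame_proj_scale flip: scaleR_diff_right)
  ultimately have "?s * (\<rho> * norm (\<xi> - P p \<xi>)) \<le> ?s * (14 * ?s * norm \<xi>)"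
    using s by (simp add: field_simps power2_eq_square)
  then show ?thesis by (rule mult_left_le_imp_le) (rule s)
qed

section \<open>Bootstrapping the angle bound up to the scale of the reach\<close>

definition gap_at_scale :: "real \<Rightarrow> real \<Rightarrow> bool" where
  "gap_at_scale r e \<longleftrightarrow> (\<forall>x\<in>M. \<forall>y\<in>M. norm (x - y) \<le> r \<longrightarrow> gap_le (Tan x) (Tan y) e)"

text \<open>A gap of 1/8 at scale r is all that \<open>tangent_angle\<close> asks for at distances
  up to r / 2, since it looks twice as far. The crude bound thus improves to a linear one at half
  the scale.\<close>

lemma gap_at_scale_linear:
  assumes G: "gap_at_scale r (1/8)" and xy: "x \<in> M" "y \<in> M" "norm (x - y) \<le> r / 2"
  shows "gap_le (Tan x) (Tan y) (14 * norm (x - y) / \<rho>)"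
proof -
  have half: "\<exists>\<eta>\<in>Tan q. norm (\<xi> - \<eta>) \<le> 14 * norm (x - y) / \<rho> * norm \<xi>"
    if "p \<in> M" "q \<in> M" "norm (p - q) = norm (x - y)" "\<xi> \<in> Tan p" for p q \<xi>
  proof -
    have "\<rho> * norm (\<xi> - P q \<xi>) \<le> 14 * norm (x - y) * norm \<xi>"
      unfolding that(3)[symmetric]
      by (rule tangent_angle) (use that G xy in \<open>auto simp: gap_at_scale_def norm_minus_commute\<close>)
    then have "norm (\<xi> - P q \<xi>) \<le> 14 * norm (x - y) / \<rho> * norm \<xi>"
      using rho_pos by (simp add: field_simps)
    then show ?thesis using P_in_Tan[OF that(2)] by blast
  qed
  show ?thesis unfolding gap_le_def
    using half[of x y] half[of y x] xy by (auto simp: norm_minus_commute)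
qed

text \<open>Chaining through the approximate midpoint enlarges the scale by 32/17 and roughly
  doubles the gap. The cap on s keeps |x - y| within the \<rho> / 16 of
  \<open>midpoint_near\<close>.\<close>

lemma gap_at_scale_midpoint:
  assumes "gap_at_scale s g" "0 \<le> g" "s \<le> \<rho> / 32"
  shows "gap_at_scale (32 / 17 * s) (g + g + g * g)"
  unfolding gap_at_scale_def
proof (intro ballI impI)
  fix x y assume xy: "x \<in> M" "y \<in> M" "norm (x - y) \<le> 32 / 17 * s"
  have "norm (x - y) \<le> \<rho> / 16" using xy assms(3) rho_pos by linarith
  then obtain z where z: "z \<in> M" "norm (x - z) \<le> 17 / 32 * norm (x - y)" "norm (y - z) \<le> 17 / 32 * norm (x - y)"
    using midpoint_near[OF xy(1,2)] by blast
  then have "gap_le (Tan x) (Tan z) g" "gap_le (Tan z) (Tan y) g"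
    using assms(1) xy unfolding gap_at_scale_def by (auto simp: norm_minus_commute)
  then show "gap_le (Tan x) (Tan y) (g + g + g * g)"
    using gap_le_trans assms(2) by blast
qed

lemma gap_at_scale_mono:
  "gap_at_scale r e \<Longrightarrow> r' \<le> r \<Longrightarrow> e \<le> e' \<Longrightarrow> gap_at_scale r' e'"
  unfolding gap_at_scale_def by (meson gap_le_mono order_trans)

text \<open>For r \<le> \<rho> / 280 the linear bound at scale r / 2 is 14 / 560 = 1/40. Two
  midpoint steps multiply the scale by (32/17)^2 > 3 and bring the gap to 81/1600 and then to about
  0.104 < 1/8: the scale has grown by at least 3/2 and the gap is no worse.\<close>

lemma gap_at_scale_step:
  assumes G: "gap_at_scale r (1/8)" and r: "0 < r" "r \<le> \<rho> / 280"
  shows "gap_at_scale (3 / 2 * r) (1/8)"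
proof -
  have "gap_at_scale (r / 2) (1/40)"
    unfolding gap_at_scale_def
  proof (intro ballI impI)
    fix x y assume xy: "x \<in> M" "y \<in> M" "norm (x - y) \<le> r / 2"
    then have "14 * norm (x - y) / \<rho> \<le> 1/40" using r rho_pos by (simp add: field_simps)
    then show "gap_le (Tan x) (Tan y) (1/40)"
      using gap_at_scale_linear[OF G xy] gap_le_mono by blast
  qed
  then have "gap_at_scale (32 / 17 * (r / 2)) (1/40 + 1/40 + 1/40 * (1/40))"
    using r rho_pos by (intro gap_at_scale_midpoint) auto
  then have "gap_at_scale (32 / 17 * (32 / 17 * (r / 2))) (81/1600 + 81/1600 + 81/1600 * (81/1600))"
    using r rho_pos by (intro gap_at_scale_midpoint) auto
  then show ?thesis by (rule gap_at_scale_mono) (use r in auto)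
qed

text \<open>Compactness provides some positive starting scale r about which nothing is known;
  finitely many enlargements by 3/2 reach \<rho> / 280, so r leaves no trace in the result.\<close>

lemma gap_at_reach_scale: "gap_at_scale (\<rho> / 280) (1/8)"
proof -
  obtain r where r: "0 < r" "gap_at_scale r (1/8)"
    using tangent_gap_uniform[of "1/8"] unfolding gap_at_scale_def by auto
  have "gap_at_scale (min (\<rho> / 280) (r * (3/2) ^ k)) (1/8)" for k
  proof (induction k)
    case 0
    show ?case using r by (auto intro: gap_at_scale_mono)
  next
    case (Suc k)
    have "0 < min (\<rho> / 280) (r * (3/2) ^ k)" using r rho_pos by simp
    from gap_at_scale_step[OF Suc this] have "gap_at_scale (3 / 2 * min (\<rho> / 280) (r * (3/2) ^ k)) (1/8)"
      by simp
    then show ?case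
      by (rule gap_at_scale_mono) (use r rho_pos in \<open>auto simp: min_def mult_ac\<close>)
  qed
  moreover obtain k where "\<rho> / 280 / r < (3/2) ^ k"
    using real_arch_pow[of "3/2" "\<rho> / 280 / r"] by auto
  then have "min (\<rho> / 280) (r * (3/2) ^ k) = \<rho> / 280" using r by (simp add: min_def field_simps)
  ultimately show ?thesis by metis
qed

text \<open>The part of y - x normal to the tangent space at \<open>p\<close> is at most e |y - x|
  with e = 16 r / \<rho>: 14 from the angle between the tangent spaces at \<open>x\<close> and
  \<open>p\<close>, 2 from the deviation at \<open>x\<close>, as |y - x| \<le> 2 r. Finally 1 / (1 -
  e) \<le> 1 + 2 e.\<close>

lemma graph_bilipschitz:
  assumes p: "p \<in> M" and x: "x \<in> M" "norm (x - p) \<le> r" and y: "y \<in> M" "norm (y - p) \<le> r"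
    and r: "r \<le> \<rho> / 1120"
  shows "norm (y - x) \<le> (1 + 32 * r / \<rho>) * norm (P p (y - x))"
proof -
  define e where "e = 16 * r / \<rho>"
  have r0: "0 \<le> r" using norm_ge_zero[of "x - p"] x by linarith
  have e: "0 \<le> e" "e \<le> 1/70" using r r0 rho_pos by (auto simp: e_def field_simps)
  have yx: "norm (y - x) \<le> 2 * r" using norm_triangle_ineq4[of "y - p" "x - p"] x y by simp
  let ?\<xi> = "P x (y - x)"
  have "gap_le (Tan x) (Tan p) (14 * norm (x - p) / \<rho>)"
    by (rule gap_at_scale_linear[OF gap_at_reach_scale x(1) p]) (use x r rho_pos in linarith)
  then have "norm (?\<xi> - P p ?\<xi>) \<le> 14 * norm (x - p) / \<rho> * norm ?\<xi>"
    by (rule gap_coproj[OF _ p P_in_Tan[OF x(1)]])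
  also have "\<dots> \<le> 14 * r / \<rho> * norm (y - x)"
    using x r0 rho_pos norm_P_le[OF x(1)] by (intro mult_mono divide_right_mono) auto
  finally have 1: "norm (?\<xi> - P p ?\<xi>) \<le> 14 * r / \<rho> * norm (y - x)" .
  have "\<rho> * norm (y - x - ?\<xi>) \<le> 2 * r * norm (y - x)"
    using tangent_deviation[OF x(1) y(1)] mult_right_mono[OF yx, of "norm (y - x)"]
    by (simp add: power2_eq_square)
  then have 2: "norm (y - x - ?\<xi>) \<le> 2 * r / \<rho> * norm (y - x)" using rho_pos by (simp add: field_simps)
  have "(y - x) - P p (y - x) = (?\<xi> - P p ?\<xi>) + ((y - x - ?\<xi>) - P p (y - x - ?\<xi>))"
    by (simp add: frame_proj_diff)
  then have "norm ((y - x) - P p (y - x)) \<le> norm (?\<xi> - P p ?\<xi>) + norm ((y - x - ?\<xi>) - P p (y - x - ?\<xi>))"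
    by (metis norm_triangle_ineq)
  then have "norm ((y - x) - P p (y - x)) \<le> norm (?\<xi> - P p ?\<xi>) + norm (y - x - ?\<xi>)"
    using norm_coP_le[OF p, of "y - x - ?\<xi>"] by linarith
  moreover have "e * norm (y - x) = 14 * r / \<rho> * norm (y - x) + 2 * r / \<rho> * norm (y - x)"
    using rho_pos by (simp add: e_def field_simps)
  ultimately have 3: "norm ((y - x) - P p (y - x)) \<le> e * norm (y - x)"
    using 1 2 by linarith
  have "norm (y - x) \<le> norm (P p (y - x)) + norm ((y - x) - P p (y - x))"
    using norm_triangle_ineq[of "P p (y - x)" "(y - x) - P p (y - x)"] by simp
  with 3 have "(1 - e) * norm (y - x) \<le> norm (P p (y - x))" by (simp add: algebra_simps)
  then have "(1 + 2 * e) * ((1 - e) * norm (y - x)) \<le> (1 + 2 * e) * norm (P p (y - x))"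
    using e by (intro mult_left_mono) auto
  moreover have "1 * norm (y - x) \<le> ((1 + 2 * e) * (1 - e)) * norm (y - x)"
  proof (rule mult_right_mono)
    have "2 * (e * e) \<le> e" using e mult_right_mono[of e "1/2" e] by simp
    then show "1 \<le> (1 + 2 * e) * (1 - e)" by (simp add: algebra_simps)
  qed simp
  ultimately show ?thesis by (simp add: e_def mult.assoc)
qed

lemma graph_onto:
  assumes "p \<in> M" "w \<in> Tan p" "norm w \<le> \<rho> / 560"
  shows "\<exists>z\<in>M. P p (z - p) = w \<and> norm (z - p) \<le> 2 * norm w"
proof (rule tangent_projection_onto[OF assms(1,2)])
  fix z assume z: "z \<in> M" "norm (z - p) \<le> 2 * norm w"
  then have "norm (p - z) \<le> \<rho> / 280" using assms(3) by (simp add: norm_minus_commute)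
  then show "gap_le (Tan p) (Tan z) (1/8)"
    using gap_at_reach_scale assms(1) z(1) unfolding gap_at_scale_def by blast
qed

text \<open>Comparing distances to \<open>x0\<close> gives the quadratic bound with constant 1/2.
  The tangent space contains both \<xi> and its negative, so the one-sided conclusion applies
  twice.\<close>

lemma nearest_point_normal:
  assumes p: "p \<in> M" and near: "\<And>y. y \<in> M \<Longrightarrow> norm (x\<^sub>0 - p) \<le> norm (x\<^sub>0 - y)" and \<xi>: "\<xi> \<in> Tan p"
  shows "inner \<xi> (x\<^sub>0 - p) = 0"
proof -
  have K: "inner (y - p) (x\<^sub>0 - p) \<le> 1/2 * (norm (y - p))\<^sup>2" if "y \<in> M" for y
  proof -
    have "(norm (x\<^sub>0 - p))\<^sup>2 \<le> (norm ((x\<^sub>0 - p) - (y - p)))\<^sup>2"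
      using near[OF that] by (intro power_mono) auto
    then show ?thesis
      unfolding power2_norm_eq_inner[of "(x\<^sub>0 - p) - (y - p)"]
      by (simp only: inner_diff_left[of "x\<^sub>0 - p" "y - p"] inner_diff_right[of _ "x\<^sub>0 - p" "y - p"])
         (simp add: power2_norm_eq_inner inner_commute)
  qed
  have "- \<xi> \<in> Tan p" using subspace_neg[OF subspace_Tan[OF p] \<xi>] .
  from tangent_normal_inner_nonpos[OF this K] tangent_normal_inner_nonpos[OF \<xi> K]
  show ?thesis by simp
qed

end

section \<open>Hausdorff measure\<close>

text \<open>The sets of a cover are intersected with \<open>A\<close> before being mapped, since
  \<open>f\<close> is Lipschitz only there; each diameter then grows by at most the factor
  c.\<close>

lemma hausdorff_pre_lipschitz_image:
  assumes lip: "\<And>x y. x \<in> A \<Longrightarrow> y \<in> A \<Longrightarrow> norm (f x - f y) \<le> c * norm (x - y)" and c: "0 < c"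
  shows "hausdorff_pre d (c * \<delta>) (f ` A) \<le> ennreal (c ^ d) * hausdorff_pre d \<delta> A"
proof -
  let ?S = "\<lambda>C. \<Sum>i. if C i = {} then 0 else ennreal (omega d * (diameter (C i) / 2) ^ d)"
  have cancel: "ennreal (1 / c ^ d) * (ennreal (c ^ d) * X) = X"
    "ennreal (c ^ d) * (ennreal (1 / c ^ d) * X) = X" for X
    using c by (simp_all flip: mult.assoc ennreal_mult)
  \<comment> \<open>With the factor on the left-hand side, the infimum on the right can be bounded
    cover by cover.\<close>
  have "ennreal (1 / c ^ d) * hausdorff_pre d (c * \<delta>) (f ` A) \<le> hausdorff_pre d \<delta> A"
    unfolding hausdorff_pre_def[of d \<delta> A]
  proof (rule INF_greatest, clarify)
    fix C :: "nat \<Rightarrow> fsv set"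
    assume C: "A \<subseteq> (\<Union>i. C i)" "\<forall>i. bounded (C i) \<and> diameter (C i) < \<delta>"
    define C' where "C' i = f ` (C i \<inter> A)" for i
    have diam: "dist y z \<le> c * diameter (C i)" if "y \<in> C' i" "z \<in> C' i" for y z i
    proof -
      obtain x x' where x: "x \<in> C i" "x \<in> A" "y = f x" "x' \<in> C i" "x' \<in> A" "z = f x'"
        using \<open>y \<in> C' i\<close> \<open>z \<in> C' i\<close> by (auto simp: C'_def)
      have "norm (f x - f x') \<le> c * norm (x - x')" by (rule lip) fact+
      also have "\<dots> \<le> c * diameter (C i)"
        using diameter_bounded_bound[of "C i" x x'] C(2) x c by (simp add: dist_norm)
      finally show ?thesis by (simp add: x dist_norm)
    qed
    have nn: "0 \<le> diameter (C i)" for i using C(2) by (simp add: diameter_ge_0)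
    have diam': "diameter (C' i) \<le> c * diameter (C i)" for i
      by (rule diameter_le) (use diam nn c in \<open>auto simp: dist_norm\<close>)
    have bdd: "bounded (C' i)" for i
      unfolding bounded_two_points using diam by blast
    have "hausdorff_pre d (c * \<delta>) (f ` A) \<le> ?S C'"
      unfolding hausdorff_pre_def
    proof (rule INF_lower, clarify, intro conjI allI)
      show "f ` A \<subseteq> (\<Union>i. C' i)" using C(1) unfolding C'_def by blast
      fix i
      have "c * diameter (C i) < c * \<delta>" using C(2) c by simp
      then show "diameter (C' i) < c * \<delta>" using diam'[of i] by simp
    qed (rule bdd)
    also have "\<dots> \<le> (\<Sum>i. ennreal (c ^ d) * (if C i = {} then 0 else ennreal (omega d * (diameter (C i) / 2) ^ d)))"
    proof (intro suminf_le summableI)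
      fix i
      have "omega d * (diameter (C' i) / 2) ^ d \<le> omega d * ((c * diameter (C i)) / 2) ^ d"
        using diam'[of i] diameter_ge_0[OF bdd[of i]]
        by (intro mult_left_mono power_mono divide_right_mono) (auto simp: omega_def)
      also have "\<dots> = c ^ d * (omega d * (diameter (C i) / 2) ^ d)"
        by (simp add: power_mult_distrib power_divide)
      finally have "ennreal (omega d * (diameter (C' i) / 2) ^ d) \<le> ennreal (c ^ d) * ennreal (omega d * (diameter (C i) / 2) ^ d)"
        using c nn[of i] by (subst ennreal_mult[symmetric]) (auto simp: omega_def intro!: ennreal_leI mult_nonneg_nonneg)
      \<comment> \<open>A nonempty image comes from a nonempty \<open>C i\<close>. The convention
        for empty sets matters when d = 0, where the zeroth power of the diameter 0 is 1.\<close>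
      then show "(if C' i = {} then 0 else ennreal (omega d * (diameter (C' i) / 2) ^ d)) \<le>
          ennreal (c ^ d) * (if C i = {} then 0 else ennreal (omega d * (diameter (C i) / 2) ^ d))"
        by (auto simp: C'_def)
    qed
    also have "\<dots> = ennreal (c ^ d) * ?S C" by (rule ennreal_suminf_cmult)
    finally have "ennreal (1 / c ^ d) * hausdorff_pre d (c * \<delta>) (f ` A) \<le> ennreal (1 / c ^ d) * (ennreal (c ^ d) * ?S C)"
      by (rule mult_left_mono) simp
    then show "ennreal (1 / c ^ d) * hausdorff_pre d (c * \<delta>) (f ` A) \<le> ?S C"
      unfolding cancel .
  qed
  then have "ennreal (c ^ d) * (ennreal (1 / c ^ d) * hausdorff_pre d (c * \<delta>) (f ` A)) \<le> ennreal (c ^ d) * hausdorff_pre d \<delta> A"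
    by (rule mult_left_mono) simp
  then show ?thesis unfolding cancel .
qed

lemma hausdorff_outer_lipschitz_image:
  assumes "\<And>x y. x \<in> A \<Longrightarrow> y \<in> A \<Longrightarrow> norm (f x - f y) \<le> c * norm (x - y)" and c: "0 < c"
  shows "hausdorff_outer d (f ` A) \<le> ennreal (c ^ d) * hausdorff_outer d A"
  unfolding hausdorff_outer_def[of d "f ` A"]
proof (rule SUP_least)
  fix \<delta> :: real assume "\<delta> \<in> {0<..}"
  then have "0 < \<delta> / c" using c by simp
  have "hausdorff_pre d \<delta> (f ` A) = hausdorff_pre d (c * (\<delta> / c)) (f ` A)" using c by simp
  also have "\<dots> \<le> ennreal (c ^ d) * hausdorff_pre d (\<delta> / c) A"
    by (rule hausdorff_pre_lipschitz_image) fact+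
  also have "\<dots> \<le> ennreal (c ^ d) * hausdorff_outer d A"
    unfolding hausdorff_outer_def using \<open>0 < \<delta> / c\<close> by (intro mult_left_mono SUP_upper) auto
  finally show "hausdorff_pre d \<delta> (f ` A) \<le> ennreal (c ^ d) * hausdorff_outer d A" .
qed

lemma hausdorff_outer_mono: "A \<subseteq> B \<Longrightarrow> hausdorff_outer d A \<le> hausdorff_outer d B"
  unfolding hausdorff_outer_def hausdorff_pre_def
  by (intro SUP_mono' INF_superset_mono) auto

lemma hausdorff_outer_lipschitz_subset:
  assumes "\<And>x y. x \<in> A \<Longrightarrow> y \<in> A \<Longrightarrow> norm (f x - f y) \<le> c * norm (x - y)" "0 < c" "B \<subseteq> f ` A"
  shows "hausdorff_outer d B \<le> ennreal (c ^ d) * hausdorff_outer d A"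
  by (rule order_trans[OF hausdorff_outer_mono[OF assms(3)] hausdorff_outer_lipschitz_image[OF assms(1,2)]])

subsection \<open>Comparison with Lebesgue measure on coordinate space\<close>

text \<open>Boxes determine the product measure, and translation preserves their volume factor by
  factor. This moves the ball volume to arbitrary centres.\<close>

lemma PiM_lborel_translate:
  assumes "finite I"
  shows "distr (\<Pi>\<^sub>M i\<in>I. lborel) (\<Pi>\<^sub>M i\<in>I. lborel) (\<lambda>f. \<lambda>i\<in>I. f i + a i) = (\<Pi>\<^sub>M i\<in>I. (lborel :: real measure))"
proof -
  interpret product_sigma_finite "\<lambda>_. lborel :: real measure" ..
  show ?thesis
  proof (rule PiM_eqI[OF assms])
    fix A assume A: "\<And>i. i \<in> I \<Longrightarrow> A i \<in> sets (lborel :: real measure)"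
    have meas: "(\<lambda>f. \<lambda>i\<in>I. f i + a i) \<in> (\<Pi>\<^sub>M i\<in>I. lborel) \<rightarrow>\<^sub>M (\<Pi>\<^sub>M i\<in>I. (lborel :: real measure))"
      by (intro measurable_restrict) auto
    have "emeasure (distr (\<Pi>\<^sub>M i\<in>I. lborel) (\<Pi>\<^sub>M i\<in>I. lborel) (\<lambda>f. \<lambda>i\<in>I. f i + a i)) (Pi\<^sub>E I A)
        = emeasure (\<Pi>\<^sub>M i\<in>I. lborel) ((\<lambda>f. \<lambda>i\<in>I. f i + a i) -` Pi\<^sub>E I A \<inter> space (\<Pi>\<^sub>M i\<in>I. lborel))"
      using A assms by (intro emeasure_distr meas) auto
    also have "(\<lambda>f. \<lambda>i\<in>I. f i + a i) -` Pi\<^sub>E I A \<inter> space (\<Pi>\<^sub>M i\<in>I. lborel) = Pi\<^sub>E I (\<lambda>i. (+) (a i) -` A i)"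
      by (auto simp: space_PiM PiE_iff add.commute)
    also have "emeasure (\<Pi>\<^sub>M i\<in>I. lborel) \<dots> = (\<Prod>i\<in>I. emeasure lborel ((+) (a i) -` A i))"
      using A assms by (intro emeasure_PiM) (auto intro!: measurable_sets_borel[where M=borel])
    also have "\<dots> = (\<Prod>i\<in>I. emeasure lborel (A i))"
    proof (intro prod.cong refl)
      fix i assume "i \<in> I"
      have "emeasure lborel (A i) = emeasure (distr lborel borel ((+) (a i))) (A i)"
        by (simp only: lborel_distr_plus)
      also have "\<dots> = emeasure lborel ((+) (a i) -` A i)"
        using A[OF \<open>i \<in> I\<close>] by (subst emeasure_distr) auto
      finally show "emeasure lborel ((+) (a i) -` A i) = emeasure lborel (A i)" by simp
    qed
    finally show "emeasure (distr (\<Pi>\<^sub>M i\<in>I. lborel) (\<Pi>\<^sub>M i\<in>I. lborel) (\<lambda>f. \<lambda>i\<in>I. f i + a i)) (Pi\<^sub>E I A)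
        = (\<Prod>i\<in>I. emeasure lborel (A i))" .
  qed simp
qed

lemma PiM_lborel_ball_measure:
  assumes "0 < r"
  shows "emeasure (\<Pi>\<^sub>M i\<in>{..<d}. lborel) {f \<in> space (\<Pi>\<^sub>M i\<in>{..<d}. lborel). sqrt (\<Sum>i<d. (f i - a i)\<^sup>2) \<le> r}
    = ennreal (omega d * r ^ d)"
proof -
  let ?L = "\<Pi>\<^sub>M i\<in>{..<d}. (lborel :: real measure)"
  let ?T = "\<lambda>f. \<lambda>i\<in>{..<d}. f i + a i"
  let ?B = "{f \<in> space ?L. sqrt (\<Sum>i<d. (f i - a i)\<^sup>2) \<le> r}"
  have meas: "?T \<in> ?L \<rightarrow>\<^sub>M ?L" by (intro measurable_restrict) auto
  have B: "?B \<in> sets ?L" by measurable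
  have "emeasure ?L ?B = emeasure (distr ?L ?L ?T) ?B"
    by (subst PiM_lborel_translate) auto
  also have "\<dots> = emeasure ?L (?T -` ?B \<inter> space ?L)"
    by (rule emeasure_distr[OF meas B])
  also have "?T -` ?B \<inter> space ?L = {f. sqrt (\<Sum>i\<in>{..<d}. (f i)\<^sup>2) \<le> r} \<inter> space ?L"
    by (auto simp: space_PiM)
  also have "emeasure ?L \<dots> = ennreal (omega d * r ^ d)"
    using emeasure_cball_aux[of "{..<d}" r] assms by (simp add: omega_def)
  finally show ?thesis .
qed

lemma PiM_lborel_ball_measure_le:
  assumes "0 \<le> r" "1 \<le> d"
  shows "emeasure (\<Pi>\<^sub>M i\<in>{..<d}. lborel) {f \<in> space (\<Pi>\<^sub>M i\<in>{..<d}. lborel). sqrt (\<Sum>i<d. (f i - a i)\<^sup>2) \<le> r}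
    \<le> ennreal (omega d * r ^ d)"
proof (cases "r = 0")
  case False
  then show ?thesis using assms by (simp add: PiM_lborel_ball_measure)
next
  case True
  let ?L = "\<Pi>\<^sub>M i\<in>{..<d}. (lborel :: real measure)"
  let ?B = "\<lambda>r. {f \<in> space ?L. sqrt (\<Sum>i<d. (f i - a i)\<^sup>2) \<le> r}"
  have om: "0 < omega d" by (simp add: omega_def)
  have "emeasure ?L (?B r) \<le> 0 + ennreal e" if "0 < e" for e
  proof -
    define q where "q = min 1 (e / omega d)"
    have q: "0 < q" "q \<le> 1" "omega d * q \<le> e" using that om by (auto simp: q_def min_def field_simps)
    have "r \<le> q" using True q by simp
    then have "emeasure ?L (?B r) \<le> emeasure ?L (?B q)"
      by (intro emeasure_mono) (auto intro: order_trans)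
    also have "\<dots> = ennreal (omega d * q ^ d)" by (rule PiM_lborel_ball_measure[OF q(1)])
    also have "\<dots> \<le> ennreal e"
    proof (rule ennreal_leI)
      have "q ^ d \<le> q ^ 1" using q assms by (intro power_decreasing) auto
      then have "omega d * q ^ d \<le> omega d * q" using om by (intro mult_left_mono) auto
      then show "omega d * q ^ d \<le> e" using q by simp
    qed
    finally show ?thesis by simp
  qed
  then have "emeasure ?L (?B r) \<le> 0" by (rule ennreal_le_epsilon)
  then show ?thesis by simp
qed

text \<open>Every covering set that meets the unit ball lies in a ball centred at one of its points
  with radius its diameter. Against the diametral volume this loses 2 ^ d, which constants of the
  form C ^ d can absorb.\<close>

lemma hausdorff_outer_unit_ball_ge:
  assumes d: "1 \<le> d"
  shows "ennreal (omega d / 2 ^ d) \<le> hausdorff_outer d {x \<in> Rn d. norm x \<le> 1}"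
proof -
  let ?L = "\<Pi>\<^sub>M i\<in>{..<d}. (lborel :: real measure)"
  let ?A = "{x \<in> Rn d. norm x \<le> 1}"
  let ?B = "\<lambda>a r. {f \<in> space ?L. sqrt (\<Sum>i<d. (f i - coord a i)\<^sup>2) \<le> r}"
  \<comment> \<open>One scale suffices for a lower bound on the supremum over all scales.\<close>
  have "ennreal (omega d / 2 ^ d) \<le> hausdorff_pre d 1 ?A"
    unfolding hausdorff_pre_def
  proof (rule INF_greatest, clarify)
    fix C :: "nat \<Rightarrow> fsv set"
    assume C: "?A \<subseteq> (\<Union>i. C i)" "\<forall>i. bounded (C i) \<and> diameter (C i) < 1"
    let ?t = "\<lambda>i. if C i = {} then 0 else ennreal (omega d * (diameter (C i) / 2) ^ d)"
    define a where "a i = (SOME x. x \<in> C i \<inter> ?A)" for i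
    have a: "a i \<in> C i" "a i \<in> Rn d" if "C i \<inter> ?A \<noteq> {}" for i
      using someI_ex[of "\<lambda>x. x \<in> C i \<inter> ?A"] that unfolding a_def by blast+
    define S where "S i = (if C i \<inter> ?A = {} then {} else ?B (a i) (diameter (C i)))" for i
    have Sm: "range S \<subseteq> sets ?L"
      unfolding S_def by auto
    have "?B 0 1 \<subseteq> (\<Union>i. S i)"
    proof
      fix f assume f: "f \<in> ?B 0 1"
      define x where "x = (\<Sum>i<d. f i *\<^sub>R unit_fsv i)"
      have xR: "x \<in> Rn d" by (auto simp: x_def unit_fsv_in_Rn)
      have xc: "coord x i = f i" if "i < d" for i
        using that by (simp add: x_def if_distrib cong: if_cong)
      have "(norm x)\<^sup>2 \<le> 1" using f by (simp add: norm_Rn[OF xR] xc)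
      then have "norm x \<le> 1" by (simp add: abs_square_le_1)
      then obtain i where i: "x \<in> C i" using C(1) xR by blast
      then have ne: "C i \<inter> ?A \<noteq> {}" using \<open>norm x \<le> 1\<close> xR by blast
      have "(norm (x - a i))\<^sup>2 = (\<Sum>k<d. (f k - coord (a i) k)\<^sup>2)"
        using xR a(2)[OF ne] by (subst norm_Rn[of _ d]) (auto simp: xc)
      then have "sqrt (\<Sum>k<d. (f k - coord (a i) k)\<^sup>2) = norm (x - a i)"
        by (metis norm_ge_zero real_sqrt_unique)
      also have "\<dots> \<le> diameter (C i)"
        using diameter_bounded_bound[of "C i" x "a i"] C(2) i a(1)[OF ne] by (simp add: dist_norm)
      finally have "f \<in> S i" using f ne by (simp add: S_def)
      then show "f \<in> (\<Union>i. S i)" by blast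
    qed
    then have "emeasure ?L (?B 0 1) \<le> emeasure ?L (\<Union>i. S i)"
      using Sm by (intro emeasure_mono) auto
    also have "\<dots> \<le> (\<Sum>i. emeasure ?L (S i))" by (rule emeasure_subadditive_countably[OF Sm])
    also have "\<dots> \<le> (\<Sum>i. ennreal (2 ^ d) * ?t i)"
    proof (intro suminf_le summableI)
      fix i
      show "emeasure ?L (S i) \<le> ennreal (2 ^ d) * ?t i"
      proof (cases "C i \<inter> ?A = {}")
        case False
        have "emeasure ?L (S i) \<le> ennreal (omega d * diameter (C i) ^ d)"
          using False PiM_lborel_ball_measure_le[OF diameter_ge_0 d, of "C i" "coord (a i)"] C(2)
          by (simp add: S_def)
        also have "\<dots> = ennreal (2 ^ d * (omega d * (diameter (C i) / 2) ^ d))"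
          by (simp add: power_divide)
        also have "\<dots> = ennreal (2 ^ d) * ?t i"
          using False C(2) by (subst ennreal_mult) (auto simp: omega_def diameter_ge_0)
        finally show ?thesis .
      qed (simp add: S_def)
    qed
    also have "\<dots> = ennreal (2 ^ d) * (\<Sum>i. ?t i)" by (rule ennreal_suminf_cmult)
    finally have "ennreal (omega d) \<le> ennreal (2 ^ d) * (\<Sum>i. ?t i)"
      using PiM_lborel_ball_measure[of 1 d "coord 0"] by simp
    then have "ennreal (1 / 2 ^ d) * ennreal (omega d) \<le> ennreal (1 / 2 ^ d) * (ennreal (2 ^ d) * (\<Sum>i. ?t i))"
      by (rule mult_left_mono) simp
    also have "\<dots> = (\<Sum>i. ?t i)" by (simp flip: mult.assoc ennreal_mult)
    also have "ennreal (1 / 2 ^ d) * ennreal (omega d) = ennreal (omega d / 2 ^ d)"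
      by (simp add: omega_def flip: ennreal_mult)
    finally show "ennreal (omega d / 2 ^ d) \<le> (\<Sum>i. ?t i)" .
  qed
  also have "\<dots> \<le> hausdorff_outer d ?A"
    unfolding hausdorff_outer_def by (intro SUP_upper) auto
  finally show ?thesis .
qed

section \<open>Discs in tangent spaces\<close>

definition disc :: "nat \<Rightarrow> (nat \<Rightarrow> fsv) \<Rightarrow> real \<Rightarrow> fsv set" where
  "disc d b R = {w \<in> frame_span d b. norm w \<le> R}"

lemma hausdorff_outer_disc_le:
  assumes "0 < R" "0 < R'"
  shows "hausdorff_outer d (disc d b R') \<le> ennreal ((R' / R) ^ d) * hausdorff_outer d (disc d b R)"
proof (rule hausdorff_outer_lipschitz_subset[where f="\<lambda>x. (R' / R) *\<^sub>R x"])
  show "disc d b R' \<subseteq> (\<lambda>x. (R' / R) *\<^sub>R x) ` disc d b R"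
  proof
    fix x assume "x \<in> disc d b R'"
    then show "x \<in> (\<lambda>x. (R' / R) *\<^sub>R x) ` disc d b R"
      using assms by (intro image_eqI[of _ _ "(R / R') *\<^sub>R x"])
        (auto simp: disc_def field_simps intro!: subspace_scale[OF subspace_frame_span])
  qed
qed (use assms in \<open>auto simp flip: scaleR_diff_right\<close>)

lemma hausdorff_outer_disc:
  assumes "0 < R"
  shows "hausdorff_outer d (disc d b R) = ennreal (R ^ d) * hausdorff_outer d (disc d b 1)"
proof (rule antisym)
  show "hausdorff_outer d (disc d b R) \<le> ennreal (R ^ d) * hausdorff_outer d (disc d b 1)"
    using hausdorff_outer_disc_le[of 1 R d b] assms by simp
  have "ennreal (R ^ d) * hausdorff_outer d (disc d b 1) \<le>
      ennreal (R ^ d) * (ennreal ((1 / R) ^ d) * hausdorff_outer d (disc d b R))"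
    using hausdorff_outer_disc_le[of R 1 d b] assms by (intro mult_left_mono) auto
  also have "\<dots> = hausdorff_outer d (disc d b R)"
    using assms by (simp add: power_divide flip: mult.assoc ennreal_mult)
  finally show "ennreal (R ^ d) * hausdorff_outer d (disc d b 1) \<le> hausdorff_outer d (disc d b R)" .
qed

text \<open>Taking coordinates with respect to the frame maps the disc onto the unit ball of
  \<open>Rn d\<close> without increasing distances.\<close>

lemma hausdorff_outer_unit_disc_ge:
  assumes b: "orthonormal d b" and d: "1 \<le> d"
  shows "ennreal (omega d / 2 ^ d) \<le> hausdorff_outer d (disc d b 1)"
proof -
  let ?f = "\<lambda>x. \<Sum>i<d. inner x (b i) *\<^sub>R unit_fsv i"
  have fR: "?f x \<in> Rn d" for x by (auto simp: unit_fsv_in_Rn)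
  have fc: "coord (?f x) i = inner x (b i)" if "i < d" for x i
    using that by (simp add: if_distrib cong: if_cong)
  have "hausdorff_outer d {x \<in> Rn d. norm x \<le> 1} \<le> ennreal (1 ^ d) * hausdorff_outer d (disc d b 1)"
  proof (rule hausdorff_outer_lipschitz_subset[where f="?f"])
    fix x y
    have "(norm (?f x - ?f y))\<^sup>2 = (\<Sum>i<d. (coord (?f x - ?f y) i)\<^sup>2)"
      by (rule norm_Rn) (intro Rn_intros fR)
    also have "\<dots> = (\<Sum>i<d. (inner (x - y) (b i))\<^sup>2)"
      by (intro sum.cong) (simp_all only: coord_simps fc lessThan_iff inner_diff_left)
    also have "\<dots> = (norm (frame_proj d b (x - y)))\<^sup>2"
      unfolding frame_proj_def by (rule norm_frame_comb[OF b, symmetric])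
    also have "\<dots> \<le> (norm (x - y))\<^sup>2" using norm_frame_proj_le[OF b] by (intro power_mono) auto
    finally have "norm (?f x - ?f y) \<le> norm (x - y)" by (rule power2_le_imp_le) simp
    then show "norm (?f x - ?f y) \<le> 1 * norm (x - y)" by simp
  next
    show "{x \<in> Rn d. norm x \<le> 1} \<subseteq> ?f ` disc d b 1"
    proof clarify
      fix x assume x: "x \<in> Rn d" "norm x \<le> 1"
      let ?y = "\<Sum>i<d. coord x i *\<^sub>R b i"
      have "(norm ?y)\<^sup>2 = (norm x)\<^sup>2" by (simp add: norm_frame_comb[OF b] norm_Rn[OF x(1)])
      then have "norm ?y \<le> 1" using x(2) by simp
      moreover have "?f ?y = x"
        by (subst (2) Rn_expand[OF x(1)]) (intro sum.cong, auto simp: inner_frame_comb[OF b])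
      ultimately show "x \<in> ?f ` disc d b 1"
        by (intro image_eqI[of _ _ ?y]) (auto simp: disc_def frame_span_def)
    qed
  qed simp
  then show ?thesis using hausdorff_outer_unit_ball_ge[OF d] by simp
qed

lemma closed_disc: assumes "orthonormal d b" shows "closed (disc d b R)"
proof -
  have "disc d b R = frame_span d b \<inter> cball 0 R" by (auto simp: disc_def)
  then show ?thesis using closed_frame_span[OF assms] by (simp add: closed_Int)
qed

lemma space_hausdorff_measure [simp]: "space (hausdorff_measure d) = UNIV"
  by (simp add: hausdorff_measure_def space_measure_of_conv)

lemma sets_hausdorff_measure [simp, measurable_cong]: "sets (hausdorff_measure d) = sets borel"
  unfolding hausdorff_measure_def sets_measure_of_conv
  using sets.sigma_sets_eq[of borel] by auto

text \<open>The constructor \<open>measure_of\<close> yields the zero measure if its argument is not countably additive;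
  so a single set of nonzero measure shows that no such degeneration takes place.\<close>

lemma emeasure_hausdorff_measure:
  assumes "emeasure (hausdorff_measure d) B \<noteq> 0" and "A \<in> sets borel"
  shows "emeasure (hausdorff_measure d) A = hausdorff_outer d A"
proof -
  have "measure_space UNIV (sigma_sets UNIV (sets borel)) (hausdorff_outer d)"
    using assms(1) unfolding hausdorff_measure_def emeasure_measure_of_conv by (auto split: if_splits)
  then show ?thesis
    using assms(2) unfolding hausdorff_measure_def emeasure_measure_of_conv by auto
qed

section \<open>Kashin representations\<close>

subsection \<open>Moments of Rademacher sums\<close>

definition signs :: "nat \<Rightarrow> (nat \<Rightarrow> real) set" where
  "signs n = (\<Pi>\<^sub>E i\<in>{..<n}. {-1, 1})"

definition rad :: "nat \<Rightarrow> (nat \<Rightarrow> real) \<Rightarrow> (nat \<Rightarrow> real) \<Rightarrow> real" where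
  "rad n y \<epsilon> = (\<Sum>i<n. \<epsilon> i * y i)"

lemma finite_signs [simp]: "finite (signs n)"
  by (simp add: signs_def finite_PiE)

lemma card_signs: "card (signs n) = 2 ^ n"
proof -
  have "card {-1, 1 :: real} = 2" by (simp add: card_insert_if)
  then show ?thesis by (simp add: signs_def card_PiE numeral_2_eq_2)
qed

lemma sum_signs_Suc:
  fixes G :: "real \<Rightarrow> real"
  shows "(\<Sum>\<epsilon>\<in>signs (Suc n). G (rad (Suc n) y \<epsilon>)) = (\<Sum>\<epsilon>\<in>signs n. G (rad n y \<epsilon> + y n) + G (rad n y \<epsilon> - y n))"
proof -
  have eq: "signs (Suc n) = (\<lambda>(v, g). g(n := v)) ` ({-1, 1} \<times> signs n)"
    unfolding signs_def lessThan_Suc by (subst PiE_insert_eq) simp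
  have inj: "inj_on (\<lambda>(v, g). g(n := v)) ({-1, 1} \<times> signs n)"
    unfolding signs_def by (rule inj_combinator) simp
  have rad: "rad (Suc n) y (g(n := v)) = rad n y g + v * y n" for g v
    unfolding rad_def by simp
  have "(\<Sum>\<epsilon>\<in>signs (Suc n). G (rad (Suc n) y \<epsilon>)) = (\<Sum>(v, g)\<in>{-1, 1} \<times> signs n. G (rad n y g + v * y n))"
    unfolding eq by (subst sum.reindex[OF inj]) (simp add: case_prod_beta rad)
  also have "\<dots> = (\<Sum>v\<in>{-1, 1}. \<Sum>g\<in>signs n. G (rad n y g + v * y n))"
    by (simp add: sum.cartesian_product)
  also have "\<dots> = (\<Sum>\<epsilon>\<in>signs n. G (rad n y \<epsilon> + y n) + G (rad n y \<epsilon> - y n))"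
    by (simp add: sum.distrib add.commute)
  finally show ?thesis .
qed

lemma sum_signs_0: "(\<Sum>\<epsilon>\<in>signs 0. G (rad 0 y \<epsilon>)) = G 0"
  by (simp add: signs_def rad_def)

lemma rademacher_second_moment: "(\<Sum>\<epsilon>\<in>signs n. (rad n y \<epsilon>)\<^sup>2) = 2 ^ n * (\<Sum>i<n. (y i)\<^sup>2)"
proof (induction n)
  case 0
  show ?case using sum_signs_0[of "\<lambda>t. t\<^sup>2"] by simp
next
  case (Suc n)
  have "(\<Sum>\<epsilon>\<in>signs (Suc n). (rad (Suc n) y \<epsilon>)\<^sup>2) = (\<Sum>\<epsilon>\<in>signs n. (rad n y \<epsilon> + y n)\<^sup>2 + (rad n y \<epsilon> - y n)\<^sup>2)"
    by (rule sum_signs_Suc)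
  also have "\<dots> = (\<Sum>\<epsilon>\<in>signs n. 2 * (rad n y \<epsilon>)\<^sup>2 + 2 * (y n)\<^sup>2)"
    by (intro sum.cong) (auto simp: power2_eq_square algebra_simps)
  also have "\<dots> = 2 * (\<Sum>\<epsilon>\<in>signs n. (rad n y \<epsilon>)\<^sup>2) + 2 ^ n * (2 * (y n)\<^sup>2)"
    by (simp add: sum.distrib card_signs sum_distrib_left)
  finally show ?case by (simp add: Suc.IH algebra_simps)
qed

text \<open>Khinchine's inequality for the fourth moment, with the Gaussian constant 3.\<close>

lemma rademacher_fourth_moment: "(\<Sum>\<epsilon>\<in>signs n. (rad n y \<epsilon>) ^ 4) \<le> 3 * 2 ^ n * (\<Sum>i<n. (y i)\<^sup>2)\<^sup>2"
proof (induction n)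
  case 0
  show ?case using sum_signs_0[of "\<lambda>t. t ^ 4"] by simp
next
  case (Suc n)
  let ?Q = "\<Sum>i<n. (y i)\<^sup>2"
  have "(\<Sum>\<epsilon>\<in>signs (Suc n). (rad (Suc n) y \<epsilon>) ^ 4) = (\<Sum>\<epsilon>\<in>signs n. (rad n y \<epsilon> + y n) ^ 4 + (rad n y \<epsilon> - y n) ^ 4)"
    by (rule sum_signs_Suc)
  also have "\<dots> = (\<Sum>\<epsilon>\<in>signs n. 2 * (rad n y \<epsilon>) ^ 4 + 12 * (y n)\<^sup>2 * (rad n y \<epsilon>)\<^sup>2 + 2 * (y n) ^ 4)"
    by (intro sum.cong) (auto simp: power2_eq_square power4_eq_xxxx algebra_simps)
  also have "\<dots> = 2 * (\<Sum>\<epsilon>\<in>signs n. (rad n y \<epsilon>) ^ 4) + 12 * (y n)\<^sup>2 * (\<Sum>\<epsilon>\<in>signs n. (rad n y \<epsilon>)\<^sup>2) + 2 ^ n * (2 * (y n) ^ 4)"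
    by (simp add: sum.distrib card_signs sum_distrib_left)
  \<comment> \<open>Enlarging 2 y^4 to 6 y^4 completes the square.\<close>
  also have "\<dots> \<le> 2 * (3 * 2 ^ n * ?Q\<^sup>2) + 12 * (y n)\<^sup>2 * (2 ^ n * ?Q) + 2 ^ n * (6 * (y n) ^ 4)"
    unfolding rademacher_second_moment by (intro add_mono mult_left_mono Suc.IH order_refl) auto
  also have "\<dots> = 3 * 2 ^ Suc n * (?Q + (y n)\<^sup>2)\<^sup>2"
    by (simp add: power2_eq_square power4_eq_xxxx algebra_simps)
  finally show ?case by simp
qed

text \<open>The product of 1 + t + t^2 / 2 and 1 - t + t^2 / 2 is 1 + t^4 / 4 \<ge> 1, and the first
  factor is below exp t.\<close>

lemma exp_minus_le_quadratic: "0 \<le> t \<Longrightarrow> exp (- t) \<le> 1 - t + t\<^sup>2 / 2" for t :: real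
proof -
  assume t: "0 \<le> t"
  have pos: "0 < 1 - t + t\<^sup>2 / 2"
  proof -
    have "1 - t + t\<^sup>2 / 2 = ((t - 1)\<^sup>2 + 1) / 2" by (simp add: power2_eq_square field_simps)
    moreover have "0 < (t - 1)\<^sup>2 + 1" by (simp add: add_nonneg_pos)
    ultimately show ?thesis by simp
  qed
  have "1 \<le> 1 + t ^ 4 / 4" by simp
  also have "\<dots> = (1 + t + t\<^sup>2 / 2) * (1 - t + t\<^sup>2 / 2)"
    by (simp add: power2_eq_square power4_eq_xxxx field_simps)
  also have "\<dots> \<le> exp t * (1 - t + t\<^sup>2 / 2)"
    using exp_lower_Taylor_quadratic[OF t] pos by (intro mult_right_mono) auto
  finally show ?thesis by (simp add: exp_minus field_simps)
qed

lemma exp_add_exp_minus_le: "exp a + exp (- a) \<le> 2 * exp (a\<^sup>2)" for a :: real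
proof -
  have main: "exp a + exp (- a) \<le> 2 * exp (a\<^sup>2)" if a: "0 \<le> a" for a :: real
  proof (cases "a \<le> 1")
    case True
    have "exp a + exp (- a) \<le> (1 + a + a\<^sup>2) + (1 - a + a\<^sup>2 / 2)"
      using exp_bound[OF a True] exp_minus_le_quadratic[OF a] by simp
    also have "\<dots> \<le> 2 * (1 + a\<^sup>2)" by simp
    also have "\<dots> \<le> 2 * exp (a\<^sup>2)" by (intro mult_left_mono exp_ge_add_one_self) auto
    finally show ?thesis .
  next
    case False
    then have "a \<le> a\<^sup>2" by (simp add: power2_eq_square)
    then have "exp a \<le> exp (a\<^sup>2)" "exp (- a) \<le> exp (a\<^sup>2)" using a by auto
    then show ?thesis unfolding mult_2 by (rule add_mono)
  qed
  show ?thesis using main[of a] main[of "- a"] by (cases "0 \<le> a") (auto simp: add.commute)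
qed

lemma rademacher_exp_moment: "(\<Sum>\<epsilon>\<in>signs n. exp (rad n y \<epsilon>)) \<le> 2 ^ n * exp (\<Sum>i<n. (y i)\<^sup>2)"
proof (induction n)
  case 0
  show ?case using sum_signs_0[of exp] by simp
next
  case (Suc n)
  have "(\<Sum>\<epsilon>\<in>signs (Suc n). exp (rad (Suc n) y \<epsilon>)) = (\<Sum>\<epsilon>\<in>signs n. exp (rad n y \<epsilon> + y n) + exp (rad n y \<epsilon> - y n))"
    by (rule sum_signs_Suc)
  also have "\<dots> = (\<Sum>\<epsilon>\<in>signs n. exp (rad n y \<epsilon>)) * (exp (y n) + exp (- y n))"
    unfolding sum_distrib_right
    by (intro sum.cong) (auto simp: exp_add exp_diff exp_minus divide_inverse distrib_left)
  also have "\<dots> \<le> (2 ^ n * exp (\<Sum>i<n. (y i)\<^sup>2)) * (2 * exp ((y n)\<^sup>2))"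
    by (intro mult_mono Suc.IH exp_add_exp_minus_le) (auto intro: add_nonneg_nonneg)
  finally show ?case by (simp add: exp_add)
qed

lemma rademacher_abs_exp_moment:
  "(\<Sum>\<epsilon>\<in>signs n. exp \<bar>rad n y \<epsilon>\<bar>) \<le> 2 * 2 ^ n * exp (\<Sum>i<n. (y i)\<^sup>2)"
proof -
  have "rad n (\<lambda>i. - y i) \<epsilon> = - rad n y \<epsilon>" for \<epsilon> by (simp add: rad_def sum_negf)
  then have neg: "(\<Sum>\<epsilon>\<in>signs n. exp (- rad n y \<epsilon>)) \<le> 2 ^ n * exp (\<Sum>i<n. (y i)\<^sup>2)"
    using rademacher_exp_moment[of n "\<lambda>i. - y i"] by simp
  have "(\<Sum>\<epsilon>\<in>signs n. exp \<bar>rad n y \<epsilon>\<bar>) \<le> (\<Sum>\<epsilon>\<in>signs n. exp (rad n y \<epsilon>) + exp (- rad n y \<epsilon>))"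
    by (intro sum_mono) (auto simp: abs_if)
  then show ?thesis using neg rademacher_exp_moment[of n y] by (simp add: sum.distrib)
qed

text \<open>A sum with enough second moment and a controlled fourth moment is not concentrated at 0.
  With variance v the pointwise bound averages to at most 1 - v + 3 v^2 / 2, which is smallest at v
  = 1/3, with value 5/6.\<close>

lemma rademacher_neg_exp_moment:
  assumes Q: "(\<Sum>i<n. (y i)\<^sup>2) = 1/3"
  shows "(\<Sum>\<epsilon>\<in>signs n. exp (- \<bar>rad n y \<epsilon>\<bar>)) \<le> 5/6 * 2 ^ n"
proof -
  have pt: "exp (- \<bar>s\<bar>) \<le> 1 - s\<^sup>2 + s ^ 4 / 2" for s :: real
  proof -
    \<comment> \<open>This polynomial equals |s| - (3 s^2 - s^4) / 2: a lower bound for |s| by even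
      powers, touching at |s| = 1.\<close>
    have "0 \<le> \<bar>s\<bar> / 2 * (\<bar>s\<bar> - 1)\<^sup>2 * (\<bar>s\<bar> + 2)" by simp
    also have "\<dots> = \<bar>s\<bar> - (3 * \<bar>s\<bar>\<^sup>2 - \<bar>s\<bar> ^ 4) / 2"
      by (simp add: power2_eq_square power4_eq_xxxx field_simps)
    finally have "(3 * s\<^sup>2 - s ^ 4) / 2 \<le> \<bar>s\<bar>" by simp
    moreover have "exp (- \<bar>s\<bar>) \<le> 1 - \<bar>s\<bar> + s\<^sup>2 / 2" using exp_minus_le_quadratic[of "\<bar>s\<bar>"] by simp
    ultimately show ?thesis by (simp add: field_simps)
  qed
  have "(\<Sum>\<epsilon>\<in>signs n. exp (- \<bar>rad n y \<epsilon>\<bar>)) \<le> (\<Sum>\<epsilon>\<in>signs n. 1 - (rad n y \<epsilon>)\<^sup>2 + (rad n y \<epsilon>) ^ 4 / 2)"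
    by (intro sum_mono pt)
  also have "\<dots> = 2 ^ n - (\<Sum>\<epsilon>\<in>signs n. (rad n y \<epsilon>)\<^sup>2) + (\<Sum>\<epsilon>\<in>signs n. (rad n y \<epsilon>) ^ 4) / 2"
    by (simp add: sum.distrib sum_subtractf card_signs sum_divide_distrib)
  also have "\<dots> \<le> 2 ^ n - 2 ^ n * (1/3) + (3 * 2 ^ n * (1/3)\<^sup>2) / 2"
    using rademacher_fourth_moment[of n y] unfolding rademacher_second_moment Q by simp
  finally show ?thesis by (simp add: power2_eq_square)
qed

subsection \<open>Nets of integer points\<close>

lemma sum_int_power_abs:
  fixes z :: real
  assumes z: "0 < z" "z < 1"
  shows "(\<Sum>k\<in>{- int m..int m}. z ^ nat \<bar>k\<bar>) \<le> (1 + z) / (1 - z)"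
proof -
  have "(\<Sum>k\<in>{- int m..int m}. z ^ nat \<bar>k\<bar>) = (1 + z - 2 * z ^ Suc m) / (1 - z)"
  proof (induction m)
    case 0
    show ?case using z by simp
  next
    case (Suc m)
    have eq: "{- int (Suc m)..int (Suc m)} = insert (int (Suc m)) (insert (- int (Suc m)) {- int m..int m})"
      by auto
    have "(\<Sum>k\<in>{- int (Suc m)..int (Suc m)}. z ^ nat \<bar>k\<bar>) = 2 * z ^ Suc m + (\<Sum>k\<in>{- int m..int m}. z ^ nat \<bar>k\<bar>)"
      unfolding eq by (simp add: nat_add_distrib)
    then show ?case using z unfolding Suc.IH by (simp add: field_simps)
  qed
  also have "\<dots> \<le> (1 + z) / (1 - z)" using z by (intro divide_right_mono) auto
  finally show ?thesis .
qed

text \<open>Counting by generating functions: each point of \<open>N\<close> has weight at least 1,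
  and the total weight of the box is a product over coordinates of two-sided geometric sums.\<close>

lemma card_int_points_le:
  fixes z t :: real and N :: "(nat \<Rightarrow> int) set"
  assumes z: "0 < z" "z < 1" and N: "N \<subseteq> (\<Pi>\<^sub>E i\<in>{..<n}. {- int m..int m})"
    and t: "\<And>k. k \<in> N \<Longrightarrow> 1 \<le> t ^ n * z ^ nat (\<Sum>i<n. \<bar>k i\<bar>)" and "0 \<le> t"
  shows "real (card N) \<le> (t * ((1 + z) / (1 - z))) ^ n"
proof -
  let ?B = "\<Pi>\<^sub>E i\<in>{..<n}. {- int m..int m}"
  have fin: "finite ?B" by (auto intro: finite_PiE)
  have pw: "z ^ nat (\<Sum>i<n. \<bar>k i\<bar>) = (\<Prod>i<n. z ^ nat \<bar>k i\<bar>)" for k :: "nat \<Rightarrow> int"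
    by (induction n) (auto simp: nat_add_distrib power_add sum_nonneg)
  have "real (card N) = (\<Sum>k\<in>N. 1)" by simp
  also have "\<dots> \<le> (\<Sum>k\<in>N. t ^ n * z ^ nat (\<Sum>i<n. \<bar>k i\<bar>))" by (intro sum_mono t)
  also have "\<dots> \<le> (\<Sum>k\<in>?B. t ^ n * z ^ nat (\<Sum>i<n. \<bar>k i\<bar>))"
    using fin N z \<open>0 \<le> t\<close> by (intro sum_mono2) auto
  also have "\<dots> = t ^ n * (\<Prod>i<n. \<Sum>k\<in>{- int m..int m}. z ^ nat \<bar>k\<bar>)"
    unfolding pw sum_distrib_left[symmetric] by (subst prod_sum_PiE) auto
  also have "\<dots> \<le> t ^ n * (\<Prod>i<n. (1 + z) / (1 - z))"
    using z \<open>0 \<le> t\<close> sum_int_power_abs[OF z] by (intro mult_left_mono prod_mono) (auto intro: sum_nonneg)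
  finally show ?thesis by (simp only: power_mult_distrib prod_constant card_lessThan)
qed

text \<open>Rounding towards zero never increases absolute values, so bounds on sums of absolute
  values or squares pass to the rounded vector without loss.\<close>

lemma round_toward_zero:
  fixes x G :: real
  assumes "0 < G"
  obtains k :: int where "\<bar>real_of_int k\<bar> \<le> G * \<bar>x\<bar>" "\<bar>x - real_of_int k / G\<bar> \<le> 1 / G"
proof -
  define k where "k = (if 0 \<le> x then \<lfloor>G * x\<rfloor> else \<lceil>G * x\<rceil>)"
  have 1: "\<bar>real_of_int k\<bar> \<le> G * \<bar>x\<bar> \<and> \<bar>G * x - real_of_int k\<bar> \<le> 1"
  proof (cases "0 \<le> x")
    case True
    then have "0 \<le> G * x" using assms by simp
    then show ?thesis using True unfolding k_def by (simp add: abs_if) linarith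
  next
    case False
    then have "G * x < 0" using assms by (simp add: mult_pos_neg)
    then have "real_of_int \<lceil>G * x\<rceil> \<le> 0" by simp
    moreover have c: "G * x \<le> real_of_int \<lceil>G * x\<rceil>" "real_of_int \<lceil>G * x\<rceil> < G * x + 1"
      using ceiling_correct[of "G * x"] by linarith+
    ultimately have "\<bar>real_of_int \<lceil>G * x\<rceil>\<bar> = - real_of_int \<lceil>G * x\<rceil>"
      "\<bar>G * x - real_of_int \<lceil>G * x\<rceil>\<bar> = real_of_int \<lceil>G * x\<rceil> - G * x" "G * \<bar>x\<bar> = - (G * x)"
      using False by auto
    then show ?thesis using False c unfolding k_def by simp
  qed
  have "\<bar>x - real_of_int k / G\<bar> = \<bar>G * x - real_of_int k\<bar> / G"
    using assms by (simp add: abs_if field_simps)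
  also have "\<dots> \<le> 1 / G" using 1 assms by (intro divide_right_mono) auto
  finally show ?thesis using that 1 by blast
qed

lemma round_vector:
  assumes G: "0 < G" and x: "x \<in> Rn n"
  obtains k y where "k \<in> (\<Pi>\<^sub>E i\<in>{..<n}. UNIV :: int set)" "y = (\<Sum>i<n. (real_of_int (k i) / G) *\<^sub>R unit_fsv i)"
    "\<And>i. i < n \<Longrightarrow> \<bar>real_of_int (k i)\<bar> \<le> G * \<bar>coord x i\<bar>" "(norm (x - y))\<^sup>2 \<le> real n / G\<^sup>2"
proof -
  have "\<exists>k :: int. \<bar>real_of_int k\<bar> \<le> G * \<bar>coord x i\<bar> \<and> \<bar>coord x i - real_of_int k / G\<bar> \<le> 1 / G" for i
    using round_toward_zero[OF G] by metis
  then obtain k' :: "nat \<Rightarrow> int" where k': "\<And>i. \<bar>real_of_int (k' i)\<bar> \<le> G * \<bar>coord x i\<bar>"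
      "\<And>i. \<bar>coord x i - real_of_int (k' i) / G\<bar> \<le> 1 / G"
    by metis
  define k where "k = restrict k' {..<n}"
  define y where "y = (\<Sum>i<n. (real_of_int (k i) / G) *\<^sub>R unit_fsv i)"
  have yc: "coord y i = real_of_int (k' i) / G" if "i < n" for i
    using that by (simp add: y_def k_def if_distrib cong: if_cong)
  have yR: "y \<in> Rn n" by (auto simp: y_def unit_fsv_in_Rn)
  have "(norm (x - y))\<^sup>2 = (\<Sum>i<n. (coord x i - real_of_int (k' i) / G)\<^sup>2)"
    using x yR by (subst norm_Rn[of _ n]) (auto simp: yc)
  also have "\<dots> \<le> (\<Sum>i<n. (1 / G)\<^sup>2)"
    using k'(2) G by (intro sum_mono) (metis abs_ge_zero power2_abs power_mono)
  finally have "(norm (x - y))\<^sup>2 \<le> real n / G\<^sup>2" by (simp add: power_divide)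
  then show ?thesis
    by (intro that[of k y]) (use k'(1) in \<open>auto simp: k_def y_def\<close>)
qed

subsection \<open>A sign matrix with good \<open>\<ell>\<^sub>1\<close> behaviour\<close>

text \<open>Contains the roundings of 2 sqrt n x for x in the unit ball, where the sum of the |x_i|
  is at most sqrt n.\<close>

definition net_ball :: "nat \<Rightarrow> (nat \<Rightarrow> int) set" where
  "net_ball n = {k \<in> (\<Pi>\<^sub>E i\<in>{..<n}. {- int (2 * n)..int (2 * n)}).
     (\<Sum>i<n. \<bar>k i\<bar>) \<le> int (2 * n) \<and> (\<Sum>i<n. (k i)\<^sup>2) \<le> int (4 * n)}"

text \<open>Contains the roundings of 600 sqrt n x for unit vectors x with coordinate sum of |x_i|
  at most sqrt n / 600000. Zero is left out because the points get normalised.\<close>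

definition net_compressible :: "nat \<Rightarrow> (nat \<Rightarrow> int) set" where
  "net_compressible n = {k \<in> (\<Pi>\<^sub>E i\<in>{..<n}. {- int n..int n}).
     1000 * (\<Sum>i<n. \<bar>k i\<bar>) \<le> int n \<and> 0 < (\<Sum>i<n. (k i)\<^sup>2)}"

lemma finite_net_ball: "finite (net_ball n)"
  unfolding net_ball_def
  by (rule finite_subset[of _ "\<Pi>\<^sub>E i\<in>{..<n}. {- int (2 * n)..int (2 * n)}"]) (auto intro: finite_PiE)

lemma finite_net_compressible: "finite (net_compressible n)"
  unfolding net_compressible_def
  by (rule finite_subset[of _ "\<Pi>\<^sub>E i\<in>{..<n}. {- int n..int n}"]) (auto intro: finite_PiE)

lemma card_net_ball: "real (card (net_ball n)) \<le> 12 ^ n"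
proof -
  have "real (card (net_ball n)) \<le> (4 * ((1 + 1/2) / (1 - 1/2))) ^ n"
  proof (rule card_int_points_le[where m="2 * n"])
    fix k assume "k \<in> net_ball n"
    then have "nat (\<Sum>i<n. \<bar>k i\<bar>) \<le> 2 * n" by (simp add: net_ball_def nat_le_iff)
    then have "(1/2 :: real) ^ (2 * n) \<le> (1/2) ^ nat (\<Sum>i<n. \<bar>k i\<bar>)" by (intro power_decreasing) auto
    then have "4 ^ n * (1/2 :: real) ^ (2 * n) \<le> 4 ^ n * (1/2) ^ nat (\<Sum>i<n. \<bar>k i\<bar>)" by simp
    moreover have "4 ^ n * (1/2 :: real) ^ (2 * n) = 1"
      by (simp add: power_mult power2_eq_square flip: power_mult_distrib)
    ultimately show "1 \<le> 4 ^ n * (1/2 :: real) ^ nat (\<Sum>i<n. \<bar>k i\<bar>)" by simp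
  qed (auto simp: net_ball_def)
  then show ?thesis by simp
qed

text \<open>With z = t^(-1000) the constraint on the sum of the |k_i| allows a base t close to 1, so
  the growth rate is only slightly above 1. It has to lose against the factor 421/480 per row in
  \<open>sign_matrix_exists\<close>.\<close>

lemma card_net_compressible: "real (card (net_compressible n)) \<le> (127/125) ^ n"
proof -
  define t :: real where "t = 101/100"
  define z where "z = 1 / t ^ 1000"
  \<comment> \<open>Bernoulli gives t^100 \<ge> 2, hence t^1000 \<ge> 1024, and z is
    negligible.\<close>
  have "2 \<le> t ^ 100" using Bernoulli_inequality[of "1/100" 100] by (simp add: t_def)
  then have "2 ^ 10 \<le> (t ^ 100) ^ 10" by (intro power_mono) auto
  then have "1024 \<le> t ^ 1000" by (simp flip: power_mult)
  moreover have "0 < t" by (simp add: t_def)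
  ultimately have z: "0 < z" "z \<le> 1/1024" unfolding z_def by (auto intro!: divide_left_mono)
  have "real (card (net_compressible n)) \<le> (t * ((1 + z) / (1 - z))) ^ n"
  proof (rule card_int_points_le[where m=n])
    fix k assume "k \<in> net_compressible n"
    then have "1000 * (\<Sum>i<n. \<bar>k i\<bar>) \<le> int n" by (simp add: net_compressible_def)
    moreover have "0 \<le> (\<Sum>i<n. \<bar>k i\<bar>)" by (simp add: sum_nonneg)
    ultimately have "1000 * nat (\<Sum>i<n. \<bar>k i\<bar>) \<le> n" by linarith
    then have "t ^ (1000 * nat (\<Sum>i<n. \<bar>k i\<bar>)) \<le> t ^ n" by (intro power_increasing) (auto simp: t_def)
    moreover have "z ^ nat (\<Sum>i<n. \<bar>k i\<bar>) = 1 / t ^ (1000 * nat (\<Sum>i<n. \<bar>k i\<bar>))"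
      by (simp add: z_def power_mult power_divide)
    moreover have "0 < t ^ (1000 * nat (\<Sum>i<n. \<bar>k i\<bar>))" by (rule zero_less_power) (simp add: t_def)
    ultimately show "1 \<le> t ^ n * z ^ nat (\<Sum>i<n. \<bar>k i\<bar>)" by simp
  qed (use z in \<open>auto simp: net_compressible_def t_def\<close>)
  also have "\<dots> \<le> (127/125) ^ n"
  proof (intro power_mono)
    have "(1 + z) / (1 - z) \<le> 1025/1023" using z by (simp add: divide_simps)
    then have "t * ((1 + z) / (1 - z)) \<le> t * (1025/1023)" by (intro mult_left_mono) (auto simp: t_def)
    also have "t * (1025/1023) \<le> 127/125" by (simp add: t_def)
    finally show "t * ((1 + z) / (1 - z)) \<le> 127/125" .
  qed (use z in \<open>auto simp: t_def\<close>)
  finally show ?thesis .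
qed

lemma sum_sign_matrices:
  fixes F :: "(nat \<Rightarrow> real) \<Rightarrow> real"
  shows "(\<Sum>B\<in>(\<Pi>\<^sub>E j\<in>{..<n}. signs n). \<Prod>j<n. F (B j)) = (\<Sum>\<epsilon>\<in>signs n. F \<epsilon>) ^ n"
  using prod_sum_PiE[of "{..<n}" "\<lambda>_. signs n" "\<lambda>_. F"] by simp

lemma sum_sum_sign_matrices:
  fixes F :: "'k \<Rightarrow> (nat \<Rightarrow> real) \<Rightarrow> real"
  shows "(\<Sum>B\<in>(\<Pi>\<^sub>E j\<in>{..<n}. signs n). \<Sum>k\<in>N. \<Prod>j<n. F k (B j)) = (\<Sum>k\<in>N. (\<Sum>\<epsilon>\<in>signs n. F k \<epsilon>) ^ n)"
  by (subst sum.swap) (simp only: sum_sign_matrices)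

lemma exp_ge_4096: "4096 \<le> exp (12 :: real)"
proof -
  have "2 ^ 12 \<le> exp (1::real) ^ 12" using exp_ge_add_one_self[of 1] by (intro power_mono) auto
  then show ?thesis by (simp flip: exp_of_nat_mult)
qed

text \<open>Probabilistic method with exponential moments: \<Phi> adds up, over both nets, products
  over the rows that are at least 1 whenever the wanted inequality fails. Its average over all sign
  matrices is below 1, so some matrix has \<Phi> < 1, and taking logarithms of the single products
  gives all inequalities at once. The threshold 13 is 1 for the exponential moment plus 12 to make 2
  exp (- 12) beat the net size 12 ^ n.\<close>

lemma sign_matrix_exists:
  assumes n: "1 \<le> n"
  shows "\<exists>B. (\<forall>j<n. B j \<in> signs n) \<and>
    (\<forall>k\<in>net_ball n. (\<Sum>j<n. \<bar>rad n (\<lambda>i. real_of_int (k i) / (2 * sqrt n)) (B j)\<bar>) \<le> 13 * real n) \<and>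
    (\<forall>k\<in>net_compressible n. real n / 20 \<le>
       (\<Sum>j<n. \<bar>rad n (\<lambda>i. real_of_int (k i) / (sqrt 3 * sqrt (\<Sum>i<n. (real_of_int (k i))\<^sup>2))) (B j)\<bar>))"
proof -
  let ?y1 = "\<lambda>k i. real_of_int (k i) / (2 * sqrt n)"
  let ?y2 = "\<lambda>k i. real_of_int (k i) / (sqrt 3 * sqrt (\<Sum>i<n. (real_of_int (k i))\<^sup>2))"
  let ?F1 = "\<lambda>k \<epsilon>. exp (\<bar>rad n (?y1 k) \<epsilon>\<bar> - 13)"
  let ?F2 = "\<lambda>k \<epsilon>. exp (1/20 - \<bar>rad n (?y2 k) \<epsilon>\<bar>)"
  let ?\<B> = "\<Pi>\<^sub>E j\<in>{..<n}. signs n"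
  define \<Phi> where "\<Phi> B = (\<Sum>k\<in>net_ball n. \<Prod>j<n. ?F1 k (B j)) + (\<Sum>k\<in>net_compressible n. \<Prod>j<n. ?F2 k (B j))" for B
  have fin: "finite ?\<B>" by (auto intro: finite_PiE)
  have card: "real (card ?\<B>) = (2 ^ n) ^ n" by (simp add: card_PiE card_signs)
  have F1: "(\<Sum>\<epsilon>\<in>signs n. ?F1 k \<epsilon>) \<le> 2 ^ n * (2/4096)" if k: "k \<in> net_ball n" for k
  proof -
    have "(\<Sum>i<n. (?y1 k i)\<^sup>2) = real_of_int (\<Sum>i<n. (k i)\<^sup>2) / (4 * n)"
      by (simp add: power_divide power_mult_distrib sum_divide_distrib)
    also have "\<dots> \<le> real_of_int (int (4 * n)) / (4 * n)"
      using k by (intro divide_right_mono) (auto simp: net_ball_def simp del: of_int_sum of_nat_mult)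
    also have "\<dots> = 1" using n by simp
    finally have Q: "exp (\<Sum>i<n. (?y1 k i)\<^sup>2) \<le> exp 1" by simp
    have "(\<Sum>\<epsilon>\<in>signs n. ?F1 k \<epsilon>) = (\<Sum>\<epsilon>\<in>signs n. exp \<bar>rad n (?y1 k) \<epsilon>\<bar>) * exp (- 13)"
      by (simp add: sum_distrib_right flip: exp_add)
    also have "\<dots> \<le> (2 * 2 ^ n * exp 1) * exp (- 13)"
      by (intro mult_right_mono order_trans[OF rademacher_abs_exp_moment] mult_left_mono Q) auto
    also have "\<dots> = 2 * 2 ^ n * exp (- 12)" by (simp flip: exp_add)
    also have "\<dots> \<le> 2 * 2 ^ n * (1/4096)"
      using exp_ge_4096 by (intro mult_left_mono) (auto simp: exp_minus divide_simps)
    finally show ?thesis by simp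
  qed
  have F2: "(\<Sum>\<epsilon>\<in>signs n. ?F2 k \<epsilon>) \<le> 2 ^ n * (421/480)" if k: "k \<in> net_compressible n" for k
  proof -
    let ?s = "\<Sum>i<n. (real_of_int (k i))\<^sup>2"
    have "?s = real_of_int (\<Sum>i<n. (k i)\<^sup>2)" by simp
    also have "\<dots> > 0" using k by (simp only: net_compressible_def of_int_0_less_iff mem_Collect_eq)
    finally have s: "0 < ?s" .
    have "(\<Sum>i<n. (?y2 k i)\<^sup>2) = ?s / (3 * ?s)"
      using s by (simp add: power_divide power_mult_distrib sum_divide_distrib)
    then have Q: "(\<Sum>i<n. (?y2 k i)\<^sup>2) = 1/3" using s by simp
    have "(\<Sum>\<epsilon>\<in>signs n. ?F2 k \<epsilon>) = exp (1/20) * (\<Sum>\<epsilon>\<in>signs n. exp (- \<bar>rad n (?y2 k) \<epsilon>\<bar>))"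
      by (simp add: sum_distrib_left flip: exp_add)
    \<comment> \<open>421/400 = 1 + 1/20 + (1/20)^2 bounds exp (1/20), and 421/400 times 5/6 is
      421/480.\<close>
    also have "\<dots> \<le> (421/400) * (5/6 * 2 ^ n)"
      using exp_bound[of "1/20"] rademacher_neg_exp_moment[OF Q]
      by (intro mult_mono) (auto simp: power2_eq_square intro: sum_nonneg)
    finally show ?thesis by simp
  qed
  have "(\<Sum>B\<in>?\<B>. \<Phi> B) = (\<Sum>k\<in>net_ball n. (\<Sum>\<epsilon>\<in>signs n. ?F1 k \<epsilon>) ^ n) + (\<Sum>k\<in>net_compressible n. (\<Sum>\<epsilon>\<in>signs n. ?F2 k \<epsilon>) ^ n)"
    unfolding \<Phi>_def sum.distrib
    by (intro arg_cong2[where f="(+)"] sum_sum_sign_matrices[where F="?F1"] sum_sum_sign_matrices[where F="?F2"])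
  also have "\<dots> \<le> real (card (net_ball n)) * (2 ^ n * (2/4096)) ^ n + real (card (net_compressible n)) * (2 ^ n * (421/480)) ^ n"
    by (intro add_mono sum_bounded_above power_mono F1 F2) (auto intro: sum_nonneg)
  also have "\<dots> \<le> 12 ^ n * (2 ^ n * (2/4096)) ^ n + (127/125) ^ n * (2 ^ n * (421/480)) ^ n"
    by (intro add_mono mult_right_mono card_net_ball card_net_compressible) auto
  also have "\<dots> = (2 ^ n) ^ n * ((12 * (2/4096)) ^ n + ((127/125) * (421/480)) ^ n)"
    by (simp only: power_mult_distrib distrib_left mult_ac)
  \<comment> \<open>Both bases are below 1, so n = 1 is the worst case: about 0.006 + 0.891.\<close>
  also have "\<dots> < (2 ^ n) ^ n * 1"
  proof (rule mult_strict_left_mono)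
    have "(12 * (2/4096) :: real) ^ n \<le> (12 * (2/4096)) ^ 1"
      using n by (intro power_decreasing) auto
    moreover have "((127/125) * (421/480) :: real) ^ n \<le> ((127/125) * (421/480)) ^ 1"
      using n by (intro power_decreasing) auto
    ultimately show "(12 * (2/4096)) ^ n + ((127/125) * (421/480)) ^ n < (1 :: real)" by simp
  qed simp
  finally have lt: "(\<Sum>B\<in>?\<B>. \<Phi> B) < real (card ?\<B>)" by (simp add: card)
  have "\<exists>B\<in>?\<B>. \<Phi> B < 1"
  proof (rule ccontr)
    assume "\<not> (\<exists>B\<in>?\<B>. \<Phi> B < 1)"
    then have "(\<Sum>B\<in>?\<B>. 1) \<le> (\<Sum>B\<in>?\<B>. \<Phi> B)" by (intro sum_mono) auto
    then show False using lt by simp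
  qed
  then obtain B where B: "B \<in> ?\<B>" "\<Phi> B < 1" by blast
  have nn: "0 \<le> (\<Sum>k\<in>net_ball n. \<Prod>j<n. ?F1 k (B j))" "0 \<le> (\<Sum>k\<in>net_compressible n. \<Prod>j<n. ?F2 k (B j))"
    by (intro sum_nonneg prod_nonneg; simp)+
  have "(\<Sum>j<n. \<bar>rad n (?y1 k) (B j)\<bar>) \<le> 13 * real n" if k: "k \<in> net_ball n" for k
  proof -
    have "(\<Prod>j<n. ?F1 k (B j)) \<le> (\<Sum>k\<in>net_ball n. \<Prod>j<n. ?F1 k (B j))"
      by (rule member_le_sum[OF k _ finite_net_ball]) (auto intro: prod_nonneg)
    then have "exp (\<Sum>j<n. \<bar>rad n (?y1 k) (B j)\<bar> - 13) < exp 0"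
      using B(2) nn by (simp add: \<Phi>_def exp_sum)
    then show ?thesis by (simp only: exp_less_cancel_iff) (simp add: sum_subtractf)
  qed
  moreover have "real n / 20 \<le> (\<Sum>j<n. \<bar>rad n (?y2 k) (B j)\<bar>)" if k: "k \<in> net_compressible n" for k
  proof -
    have "(\<Prod>j<n. ?F2 k (B j)) \<le> (\<Sum>k\<in>net_compressible n. \<Prod>j<n. ?F2 k (B j))"
      by (rule member_le_sum[OF k _ finite_net_compressible]) (auto intro: prod_nonneg)
    then have "exp (\<Sum>j<n. 1/20 - \<bar>rad n (?y2 k) (B j)\<bar>) < exp 0"
      using B(2) nn by (simp add: \<Phi>_def exp_sum)
    then show ?thesis by (simp only: exp_less_cancel_iff) (simp add: sum_subtractf)
  qed
  moreover have "B j \<in> signs n" if "j < n" for j using B(1) that by auto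
  ultimately show ?thesis by (intro exI[of _ B]) blast
qed

section \<open>Norm estimates for the sign matrix\<close>

definition sign_vec :: "nat \<Rightarrow> (nat \<Rightarrow> real) \<Rightarrow> fsv" where
  "sign_vec n \<epsilon> = (\<Sum>i<n. \<epsilon> i *\<^sub>R unit_fsv i)"

lemma sign_vec_in_Rn: "sign_vec n \<epsilon> \<in> Rn n"
  by (auto simp: sign_vec_def unit_fsv_in_Rn)

lemma inner_sign_vec: "inner (sign_vec n \<epsilon>) x = rad n (coord x) \<epsilon>"
  by (simp add: sign_vec_def rad_def inner_sum_left)

lemma inner_sign_vec_comb: "inner (sign_vec n \<epsilon>) (\<Sum>i<n. c i *\<^sub>R unit_fsv i) = rad n c \<epsilon>"
  unfolding inner_sign_vec rad_def
  by (intro sum.cong) (auto simp: if_distrib cong: if_cong)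

lemma sum_abs_coord_le: "x \<in> Rn n \<Longrightarrow> (\<Sum>i<n. \<bar>coord x i\<bar>) \<le> sqrt n * norm x"
proof -
  assume x: "x \<in> Rn n"
  have "(\<Sum>i<n. \<bar>coord x i\<bar>)\<^sup>2 \<le> (\<Sum>i<n. \<bar>coord x i\<bar>\<^sup>2) * card {..<n}"
    by (rule sum_squared_le_sum_of_squares)
  also have "\<dots> = (sqrt n * norm x)\<^sup>2" by (simp add: norm_Rn[OF x] power_mult_distrib)
  finally show ?thesis by (rule power2_le_imp_le) simp
qed

locale sign_matrix =
  fixes n :: nat and B :: "nat \<Rightarrow> nat \<Rightarrow> real"
  assumes n_pos: "1 \<le> n"
    and upper: "k \<in> net_ball n \<Longrightarrow> (\<Sum>j<n. \<bar>rad n (\<lambda>i. real_of_int (k i) / (2 * sqrt n)) (B j)\<bar>) \<le> 13 * real n"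
    and lower: "k \<in> net_compressible n \<Longrightarrow> real n / 20 \<le>
       (\<Sum>j<n. \<bar>rad n (\<lambda>i. real_of_int (k i) / (sqrt 3 * sqrt (\<Sum>i<n. (real_of_int (k i))\<^sup>2))) (B j)\<bar>)"
begin

definition l1 :: "fsv \<Rightarrow> real" where
  "l1 x = (\<Sum>j<n. \<bar>inner (sign_vec n (B j)) x\<bar>)"

lemma l1_add_le: "l1 (x + y) \<le> l1 x + l1 y"
  unfolding l1_def sum.distrib[symmetric] by (intro sum_mono) (simp add: inner_add_right)

lemma l1_scale: "l1 (c *\<^sub>R x) = \<bar>c\<bar> * l1 x"
  by (simp add: l1_def sum_distrib_left abs_mult)

lemma continuous_on_l1: "continuous_on S l1"
  unfolding l1_def by (intro continuous_intros)

lemma l1_le_ball: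
  assumes x: "x \<in> Rn n" "norm x \<le> 1"
  shows "\<exists>y\<in>Rn n. l1 y \<le> 13 * real n \<and> norm (x - y) \<le> 1/2"
proof -
  have sq: "0 < 2 * sqrt n" using n_pos by simp
  obtain k y where k: "k \<in> (\<Pi>\<^sub>E i\<in>{..<n}. UNIV :: int set)"
      and y: "y = (\<Sum>i<n. (real_of_int (k i) / (2 * sqrt n)) *\<^sub>R unit_fsv i)"
      and kb: "\<And>i. i < n \<Longrightarrow> \<bar>real_of_int (k i)\<bar> \<le> 2 * sqrt n * \<bar>coord x i\<bar>"
      and ny: "(norm (x - y))\<^sup>2 \<le> real n / (2 * sqrt n)\<^sup>2"
    using round_vector[OF sq x(1)] by blast
  have "real_of_int (\<Sum>i<n. \<bar>k i\<bar>) \<le> (\<Sum>i<n. 2 * sqrt n * \<bar>coord x i\<bar>)"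
    unfolding of_int_sum using kb by (intro sum_mono) simp
  also have "\<dots> = 2 * sqrt n * (\<Sum>i<n. \<bar>coord x i\<bar>)" by (simp add: sum_distrib_left)
  also have "\<dots> \<le> 2 * sqrt n * (sqrt n * 1)"
    using x by (intro mult_left_mono order_trans[OF sum_abs_coord_le[OF x(1)]]) auto
  also have "\<dots> = real_of_int (int (2 * n))" by simp
  finally have k1: "(\<Sum>i<n. \<bar>k i\<bar>) \<le> int (2 * n)" by (simp only: of_int_le_iff)
  have "real_of_int (\<Sum>i<n. (k i)\<^sup>2) = (\<Sum>i<n. \<bar>real_of_int (k i)\<bar>\<^sup>2)" by simp
  also have "\<dots> \<le> (\<Sum>i<n. (2 * sqrt n * \<bar>coord x i\<bar>)\<^sup>2)"
    using kb by (intro sum_mono power_mono) auto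
  also have "\<dots> = 4 * real n * (norm x)\<^sup>2"
    by (simp add: norm_Rn[OF x(1)] power_mult_distrib sum_distrib_left)
  also have "\<dots> \<le> 4 * real n * 1" using x(2) by (intro mult_left_mono) (auto simp: abs_square_le_1)
  also have "\<dots> = real_of_int (int (4 * n))" by simp
  finally have k2: "(\<Sum>i<n. (k i)\<^sup>2) \<le> int (4 * n)" by (simp only: of_int_le_iff)
  have "\<bar>k i\<bar> \<le> int (2 * n)" if "i < n" for i
    using member_le_sum[of i "{..<n}" "\<lambda>i. \<bar>k i\<bar>"] that k1 by simp
  then have "k i \<in> {- int (2 * n)..int (2 * n)}" if "i < n" for i
    using that by (simp add: abs_le_iff minus_le_iff)
  then have "k \<in> (\<Pi>\<^sub>E i\<in>{..<n}. {- int (2 * n)..int (2 * n)})"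
    using k unfolding PiE_iff by blast
  then have "k \<in> net_ball n" unfolding net_ball_def using k1 k2 by blast
  then have "l1 y \<le> 13 * real n"
    using upper by (simp add: l1_def y inner_sign_vec_comb)
  moreover have "(norm (x - y))\<^sup>2 \<le> (1/2)\<^sup>2" using ny n_pos by (simp add: power_mult_distrib power2_eq_square)
  then have "norm (x - y) \<le> 1/2" by (rule power2_le_imp_le) simp
  moreover have "y \<in> Rn n" unfolding y by (auto simp: unit_fsv_in_Rn)
  ultimately show ?thesis by blast
qed

text \<open>Net argument at a maximiser m over the unit ball: m is a net point plus a remainder of
  norm at most 1/2, so l1 m \<le> 13 n + l1 m / 2.\<close>

lemma l1_upper:
  assumes "x \<in> Rn n"
  shows "l1 x \<le> 26 * real n * norm x"
proof -
  let ?S = "cball 0 1 \<inter> Rn n"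
  have "compact ?S" by (rule compact_cball_Rn)
  moreover have "0 \<in> ?S" by simp
  ultimately obtain m where m: "m \<in> ?S" "\<And>y. y \<in> ?S \<Longrightarrow> l1 y \<le> l1 m"
    using continuous_attains_sup[of ?S l1] continuous_on_l1 by blast
  obtain y where y: "y \<in> Rn n" "l1 y \<le> 13 * real n" "norm (m - y) \<le> 1/2"
    using l1_le_ball[of m] m(1) by auto
  have "l1 m \<le> l1 y + l1 (m - y)" using l1_add_le[of y "m - y"] by simp
  moreover have "l1 (2 *\<^sub>R (m - y)) \<le> l1 m"
    by (rule m(2)) (use y m(1) in \<open>auto simp del: scaleR_right_diff_distrib\<close>)
  then have "2 * l1 (m - y) \<le> l1 m" unfolding l1_scale by simp
  ultimately have max: "l1 m \<le> 26 * real n" using y(2) by simp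
  show ?thesis
  proof (cases "x = 0")
    case False
    have "l1 ((1 / norm x) *\<^sub>R x) \<le> l1 m" by (rule m(2)) (use False assms in auto)
    then have "l1 x / norm x \<le> 26 * real n" using max unfolding l1_scale by simp
    then show ?thesis using False by (simp add: field_simps)
  qed (simp add: l1_def)
qed

text \<open>A vector with small coordinate sum rounds to a point y of the compressible net, with
  error at most 1/600. The net bound costs the change from y to x, at most 26 n / 600 by
  \<open>l1_upper\<close>; what is left of n / 20 exceeds n / 250.\<close>

lemma l1_lower:
  assumes x: "x \<in> Rn n" "norm x = 1" and comp: "600000 * (\<Sum>i<n. \<bar>coord x i\<bar>) \<le> sqrt n"
  shows "real n / 250 \<le> l1 x"
proof -
  have sq: "0 < 600 * sqrt n" using n_pos by simp
  obtain k y where k: "k \<in> (\<Pi>\<^sub>E i\<in>{..<n}. UNIV :: int set)"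
      and y: "y = (\<Sum>i<n. (real_of_int (k i) / (600 * sqrt n)) *\<^sub>R unit_fsv i)"
      and kb: "\<And>i. i < n \<Longrightarrow> \<bar>real_of_int (k i)\<bar> \<le> 600 * sqrt n * \<bar>coord x i\<bar>"
      and ny: "(norm (x - y))\<^sup>2 \<le> real n / (600 * sqrt n)\<^sup>2"
    using round_vector[OF sq x(1)] by blast
  have yR: "y \<in> Rn n" unfolding y by (auto simp: unit_fsv_in_Rn)
  have "(norm (x - y))\<^sup>2 \<le> (1/600)\<^sup>2" using ny n_pos by (simp add: power_mult_distrib power2_eq_square)
  then have xy: "norm (x - y) \<le> 1/600" by (rule power2_le_imp_le) simp
  then have yn: "599/600 \<le> norm y" using x(2) norm_triangle_ineq2[of x y] by simp
  let ?s = "\<Sum>i<n. (real_of_int (k i))\<^sup>2"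
  have yc: "coord y i = real_of_int (k i) / (600 * sqrt n)" if "i < n" for i
    using that by (simp add: y if_distrib cong: if_cong)
  have "(norm y)\<^sup>2 = ?s / (600 * sqrt n)\<^sup>2"
    by (simp add: norm_Rn[OF yR] yc power_divide sum_divide_distrib)
  then have "sqrt ((norm y)\<^sup>2) = sqrt (?s / (600 * sqrt n)\<^sup>2)" by simp
  then have ns: "norm y = sqrt ?s / (600 * sqrt n)"
    using sq by (simp only: real_sqrt_abs real_sqrt_divide) simp
  have "?s \<noteq> 0"
  proof
    assume "?s = 0"
    then have "norm y = 0" unfolding ns by simp
    then show False using yn by simp
  qed
  moreover have "0 \<le> ?s" by (simp add: sum_nonneg)
  ultimately have s: "0 < ?s" by linarith
  have "1000 * real_of_int (\<Sum>i<n. \<bar>k i\<bar>) \<le> 1000 * (\<Sum>i<n. 600 * sqrt n * \<bar>coord x i\<bar>)"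
    unfolding of_int_sum using kb by (intro mult_left_mono sum_mono) simp_all
  also have "\<dots> = sqrt n * (600000 * (\<Sum>i<n. \<bar>coord x i\<bar>))" by (simp flip: sum_distrib_left)
  also have "\<dots> \<le> sqrt n * sqrt n" by (intro mult_left_mono comp) simp
  finally have "real_of_int (1000 * (\<Sum>i<n. \<bar>k i\<bar>)) \<le> real_of_int (int n)" by simp
  then have k1: "1000 * (\<Sum>i<n. \<bar>k i\<bar>) \<le> int n" by (simp only: of_int_le_iff)
  have "\<bar>k i\<bar> \<le> int n" if "i < n" for i
    using member_le_sum[of i "{..<n}" "\<lambda>i. \<bar>k i\<bar>"] that k1 by simp
  then have "k i \<in> {- int n..int n}" if "i < n" for i
    using that by (simp add: abs_le_iff minus_le_iff)
  then have "k \<in> (\<Pi>\<^sub>E i\<in>{..<n}. {- int n..int n})"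
    using k unfolding PiE_iff by blast
  moreover have "real_of_int (\<Sum>i<n. (k i)\<^sup>2) > 0" using s by simp
  then have "0 < (\<Sum>i<n. (k i)\<^sup>2)" by (simp only: of_int_0_less_iff)
  ultimately have "k \<in> net_compressible n"
    unfolding net_compressible_def using k1 by blast
  then have "real n / 20 \<le> (\<Sum>j<n. \<bar>rad n (\<lambda>i. real_of_int (k i) / (sqrt 3 * sqrt ?s)) (B j)\<bar>)"
    by (rule lower)
  also have "\<dots> = l1 (\<Sum>i<n. (real_of_int (k i) / (sqrt 3 * sqrt ?s)) *\<^sub>R unit_fsv i)"
    by (simp add: l1_def inner_sign_vec_comb)
  also have "(\<Sum>i<n. (real_of_int (k i) / (sqrt 3 * sqrt ?s)) *\<^sub>R unit_fsv i) = (1 / (sqrt 3 * norm y)) *\<^sub>R y"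
    using n_pos s by (simp add: y scaleR_sum_right ns[unfolded y])
  also have "l1 \<dots> = l1 y / (sqrt 3 * norm y)" unfolding l1_scale by simp
  finally have "real n / 20 \<le> l1 y / (sqrt 3 * norm y)" .
  moreover have "0 < norm y" using yn by linarith
  then have "0 < sqrt 3 * norm y" by simp
  ultimately have "real n / 20 * (sqrt 3 * norm y) \<le> l1 y"
    by (simp only: pos_le_divide_eq)
  moreover have "real n / 20 * (1 * (599/600)) \<le> real n / 20 * (sqrt 3 * norm y)"
    using yn by (intro mult_left_mono mult_mono) auto
  moreover have "l1 y \<le> l1 x + l1 (y - x)" using l1_add_le[of x "y - x"] by simp
  moreover have "l1 (y - x) \<le> 26 * real n * norm (y - x)" using yR x by (intro l1_upper) auto
  moreover have "26 * real n * norm (y - x) \<le> 26 * real n * (1/600)"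
    using xy by (intro mult_left_mono) (auto simp: norm_minus_commute)
  ultimately show ?thesis by simp
qed

text \<open>Kashin's dichotomy: for a unit vector either the coordinate sum itself is of order sqrt
  n, or the vector is compressible and the sign matrix sees it.\<close>

lemma l1_norm_equivalence:
  assumes "x \<in> Rn n"
  shows "norm x \<le> 600000 * ((\<Sum>i<n. \<bar>coord x i\<bar>) / sqrt n + l1 x / n)"
proof (cases "x = 0")
  case False
  let ?y = "(1 / norm x) *\<^sub>R x"
  have y: "?y \<in> Rn n" "norm ?y = 1" using False assms by auto
  have cy: "(\<Sum>i<n. \<bar>coord ?y i\<bar>) = (\<Sum>i<n. \<bar>coord x i\<bar>) / norm x"
    by (simp add: abs_mult sum_divide_distrib)
  have ly: "l1 ?y = l1 x / norm x" unfolding l1_scale by simp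
  have nn: "0 \<le> l1 x" "0 \<le> (\<Sum>i<n. \<bar>coord x i\<bar>)" by (auto simp: l1_def intro: sum_nonneg)
  have "1 \<le> 600000 * ((\<Sum>i<n. \<bar>coord ?y i\<bar>) / sqrt n + l1 ?y / n)"
  proof (cases "600000 * (\<Sum>i<n. \<bar>coord ?y i\<bar>) \<le> sqrt n")
    case True
    have "real n / 250 \<le> l1 ?y" by (rule l1_lower[OF y True])
    then have "1 \<le> 600000 * (l1 ?y / n)" using n_pos by (simp add: field_simps)
    moreover have "0 \<le> (\<Sum>i<n. \<bar>coord ?y i\<bar>) / sqrt n" by (simp add: sum_nonneg)
    ultimately show ?thesis by simp
  next
    case False
    then have "1 \<le> 600000 * ((\<Sum>i<n. \<bar>coord ?y i\<bar>) / sqrt n)" using n_pos by (simp add: field_simps)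
    moreover have "0 \<le> l1 ?y / n" unfolding ly using nn by simp
    ultimately show ?thesis by simp
  qed
  also have "\<dots> = 600000 * ((\<Sum>i<n. \<bar>coord x i\<bar>) / sqrt n + l1 x / n) / norm x"
    unfolding cy ly by (simp add: add_divide_distrib mult.commute)
  finally show ?thesis using False by (simp add: field_simps)
qed (simp add: l1_def)

end

text \<open>Duality turns the \<open>\<ell>\<^sub>1\<close> lower bound into bounded representations: a point outside the compact
  convex set of all \<open>\<Sum>j. a\<^sub>j u\<^sub>j\<close> with \<open>|a\<^sub>j| \<le> 1\<close> is separated from it by a hyperplane.\<close>

lemma bounded_representation:
  fixes u :: "nat \<Rightarrow> fsv" and N :: nat
  assumes u: "\<And>j. j < N \<Longrightarrow> u j \<in> Rn n"
    and norming: "\<And>\<theta>. \<theta> \<in> Rn n \<Longrightarrow> norm \<theta> \<le> (\<Sum>j<N. \<bar>inner (u j) \<theta>\<bar>)"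
    and x: "x \<in> Rn n" "norm x \<le> 1"
  shows "\<exists>a. (\<forall>j. \<bar>a j\<bar> \<le> 1) \<and> x = (\<Sum>j<N. a j *\<^sub>R u j)"
proof -
  define Q where "Q = {a \<in> Rn N. \<forall>i<N. \<bar>coord a i\<bar> \<le> 1}"
  define F where "F a = (\<Sum>j<N. coord a j *\<^sub>R u j)" for a
  have linF: "linear F"
    by (intro linearI) (auto simp: F_def scaleR_add_left sum.distrib scaleR_sum_right)
  have comp: "compact (F ` Q)"
    unfolding F_def Q_def by (intro compact_continuous_image compact_Rn_box continuous_intros)
  have "convex Q"
  proof (rule convexI)
    fix a b :: fsv and s t :: real assume *: "a \<in> Q" "b \<in> Q" "0 \<le> s" "0 \<le> t" "s + t = 1"
    have "\<bar>s * coord a i + t * coord b i\<bar> \<le> 1" if "i < N" for i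
    proof -
      have "\<bar>s * coord a i + t * coord b i\<bar> \<le> s * \<bar>coord a i\<bar> + t * \<bar>coord b i\<bar>"
        using * by (metis abs_mult abs_of_nonneg abs_triangle_ineq)
      also have "\<dots> \<le> s * 1 + t * 1" using * that by (intro add_mono mult_left_mono) (auto simp: Q_def)
      finally show ?thesis using * by simp
    qed
    then show "s *\<^sub>R a + t *\<^sub>R b \<in> Q" using * by (auto simp: Q_def)
  qed
  then have conv: "convex (F ` Q)" by (rule convex_linear_image[OF linF])
  have FR: "F a \<in> Rn n" for a using u by (auto simp: F_def)
  have "x \<in> F ` Q"
  proof (rule ccontr)
    assume notin: "x \<notin> F ` Q"
    have "0 \<in> Q" by (simp add: Q_def)
    then have "F ` Q \<noteq> {}" by blast
    then obtain p where p: "p \<in> F ` Q" "\<And>y. y \<in> F ` Q \<Longrightarrow> dist x p \<le> dist x y"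
      using continuous_attains_inf[OF comp, of "dist x"]
        continuous_on_dist[OF continuous_on_const continuous_on_id] by blast
    define \<theta> where "\<theta> = x - p"
    have \<theta>: "\<theta> \<in> Rn n" "\<theta> \<noteq> 0" using p(1) FR x notin by (auto simp: \<theta>_def)
    define a where "a = (\<Sum>j<N. sgn (inner (u j) \<theta>) *\<^sub>R unit_fsv j)"
    have ac: "coord a j = sgn (inner (u j) \<theta>)" if "j < N" for j
      using that by (simp add: a_def if_distrib cong: if_cong)
    have "a \<in> Q" unfolding Q_def using ac by (auto simp: a_def unit_fsv_in_Rn abs_sgn_eq)
    then have "inner (x - p) (F a - p) \<le> 0"
      using p conv comp by (intro any_closest_point_dot) (auto intro: compact_imp_closed)
    then have 1: "inner (F a) \<theta> \<le> inner p \<theta>" by (simp add: \<theta>_def inner_diff_right inner_commute)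
    have "inner (F a) \<theta> = (\<Sum>j<N. \<bar>inner (u j) \<theta>\<bar>)"
      unfolding F_def inner_sum_left by (intro sum.cong) (auto simp: ac sgn_if abs_if)
    then have 2: "norm \<theta> \<le> inner (F a) \<theta>" using norming[OF \<theta>(1)] by simp
    have "inner p \<theta> = inner x \<theta> - (norm \<theta>)\<^sup>2"
      by (simp add: \<theta>_def power2_norm_eq_inner inner_diff_left inner_diff_right inner_commute)
    moreover have "inner x \<theta> \<le> 1 * norm \<theta>"
      using norm_cauchy_schwarz[of x \<theta>] mult_right_mono[OF x(2), of "norm \<theta>"] by simp
    moreover have "0 < (norm \<theta>)\<^sup>2" using \<theta>(2) by simp
    ultimately show False using 1 2 by simp
  qed
  then obtain a where a: "a \<in> Q" "x = F a" by blast
  have "\<bar>coord a j\<bar> \<le> 1" for j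
    using a(1) Rn_coord[of a N j] by (cases "j < N") (auto simp: Q_def)
  then show ?thesis using a(2) by (intro exI[of _ "coord a"]) (auto simp: F_def)
qed

text \<open>The vectors are the scaled unit vectors and the scaled rows of the sign matrix,
  normalised so that \<open>l1_norm_equivalence\<close> becomes the norming condition. Perturbations
  are bounded by 600000 for the first half and 600000 times 26 for the second, together
  16200000.\<close>

theorem kashin:
  assumes "1 \<le> n"
  shows "\<exists>u :: nat \<Rightarrow> fsv. (\<forall>j<2 * n. u j \<in> Rn n) \<and>
    (\<forall>x\<in>Rn n. norm x \<le> 1 \<longrightarrow> (\<exists>a. (\<forall>j. \<bar>a j\<bar> \<le> 1) \<and> x = (\<Sum>j<2 * n. a j *\<^sub>R u j))) \<and>
    (\<forall>e. (\<forall>j<2 * n. \<bar>e j\<bar> \<le> 1) \<longrightarrow> norm (\<Sum>j<2 * n. e j *\<^sub>R u j) \<le> 16200000)"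
proof -
  obtain B where "sign_matrix n B"
    using sign_matrix_exists[OF assms] assms unfolding sign_matrix_def by blast
  then interpret sign_matrix n B .
  define u where "u j = (if j < n then (600000 / sqrt n) *\<^sub>R unit_fsv j else (600000 / n) *\<^sub>R sign_vec n (B (j - n)))" for j
  have split: "(\<Sum>j<2 * n. f j) = (\<Sum>j<n. f j) + (\<Sum>j<n. f (j + n))" for f :: "nat \<Rightarrow> 'a :: comm_monoid_add"
  proof -
    have "{..<2 * n} = {..<n} \<union> {n..<2 * n}" by auto
    then have "sum f {..<2 * n} = sum f {..<n} + sum f {n..<2 * n}"
      by (simp add: sum.union_disjoint ivl_disj_int)
    also have "sum f {n..<2 * n} = (\<Sum>j<n. f (j + n))"
      using sum.shift_bounds_nat_ivl[of f 0 n n] by (simp add: lessThan_atLeast0 mult_2)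
    finally show ?thesis .
  qed
  have uR: "u j \<in> Rn n" for j by (auto simp: u_def unit_fsv_in_Rn sign_vec_in_Rn)
  have norming: "norm \<theta> \<le> (\<Sum>j<2 * n. \<bar>inner (u j) \<theta>\<bar>)" if "\<theta> \<in> Rn n" for \<theta>
  proof -
    have "(\<Sum>j<2 * n. \<bar>inner (u j) \<theta>\<bar>) = 600000 * ((\<Sum>i<n. \<bar>coord \<theta> i\<bar>) / sqrt n + l1 \<theta> / n)"
      unfolding split by (simp add: u_def abs_mult l1_def distrib_left sum_distrib_left sum_divide_distrib)
    then show ?thesis using l1_norm_equivalence[OF that] by simp
  qed
  have "norm (\<Sum>j<2 * n. e j *\<^sub>R u j) \<le> 16200000" if e: "\<forall>j<2 * n. \<bar>e j\<bar> \<le> 1" for e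
  proof -
    let ?v = "\<Sum>j<n. e j *\<^sub>R unit_fsv j" and ?w = "\<Sum>j<n. e (j + n) *\<^sub>R sign_vec n (B j)"
    have eq: "(\<Sum>j<2 * n. e j *\<^sub>R u j) = (600000 / sqrt n) *\<^sub>R ?v + (600000 / n) *\<^sub>R ?w"
      unfolding split by (simp add: u_def scaleR_sum_right mult.commute)
    have vR: "?v \<in> Rn n" by (auto simp: unit_fsv_in_Rn)
    have "(norm ?v)\<^sup>2 = (\<Sum>i<n. (e i)\<^sup>2)"
      unfolding norm_Rn[OF vR] by (intro sum.cong) (auto simp: if_distrib cong: if_cong)
    also have "\<dots> \<le> (\<Sum>i<n. 1)" using e by (intro sum_mono) (auto simp: abs_square_le_1)
    finally have "norm ?v \<le> sqrt n" by (intro real_le_rsqrt) simp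
    then have 1: "norm ((600000 / sqrt n) *\<^sub>R ?v) \<le> 600000" using n_pos by (simp add: field_simps)
    have wR: "?w \<in> Rn n" by (auto simp: sign_vec_in_Rn)
    \<comment> \<open>Duality: pairing \<open>?w\<close> with itself turns the upper bound on
      \<open>l1\<close> into a bound on combinations of the rows.\<close>
    have "norm ?w * norm ?w = inner ?w ?w" by (simp flip: power2_eq_square power2_norm_eq_inner)
    also have "\<dots> = (\<Sum>j<n. e (j + n) * inner (sign_vec n (B j)) ?w)"
      by (subst inner_sum_left) simp
    also have "\<dots> \<le> l1 ?w"
      unfolding l1_def
    proof (intro sum_mono)
      fix j assume "j \<in> {..<n}"
      then have "\<bar>e (j + n)\<bar> \<le> 1" using e by simp
      then have "\<bar>e (j + n)\<bar> * \<bar>inner (sign_vec n (B j)) ?w\<bar> \<le> 1 * \<bar>inner (sign_vec n (B j)) ?w\<bar>"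
        by (intro mult_right_mono) auto
      then show "e (j + n) * inner (sign_vec n (B j)) ?w \<le> \<bar>inner (sign_vec n (B j)) ?w\<bar>"
        using abs_ge_self[of "e (j + n) * inner (sign_vec n (B j)) ?w"] by (simp add: abs_mult)
    qed
    also have "\<dots> \<le> 26 * real n * norm ?w" by (rule l1_upper[OF wR])
    finally have "norm ?w \<le> 26 * real n"
      by (cases "norm ?w = 0") (auto simp: mult_le_cancel_right)
    then have 2: "norm ((600000 / n) *\<^sub>R ?w) \<le> 15600000" using n_pos by (simp add: field_simps)
    show ?thesis unfolding eq by (rule norm_triangle_le) (use 1 2 in linarith)
  qed
  then show ?thesis
    using uR bounded_representation[of "2 * n" u n, OF uR norming] by (intro exI[of _ u]) blast
qed

section \<open>Local moments of the Hausdorff measure on the manifold\<close>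

text \<open>Points of \<open>M\<close> in the ball are within 2 h of \<open>p\<close>, and h \<le>
  \<rho> / 2240 puts 2 h into the range of \<open>graph_bilipschitz\<close>. The offset at most h /
  2 keeps the tangent section of the ball comparable to h.\<close>

locale local_graph = reach_manifold +
  fixes x0 p :: fsv and h :: real
  assumes d_pos: "1 \<le> d" and p: "p \<in> M" and near: "\<And>y. y \<in> M \<Longrightarrow> norm (x0 - p) \<le> norm (x0 - y)"
    and h_pos: "0 < h" and h_small: "h \<le> \<rho> / 2240" and offset: "norm (x0 - p) \<le> h / 2"
begin

definition t :: real where "t = h / \<rho>"
text \<open>The ball around \<open>x0\<close> cuts the tangent plane at \<open>p\<close> in a disc
  of this radius, because x0 - p is normal to it. \<open>Rp\<close> and \<open>Rm\<close> are the
  radii between which the projection of \<open>N\<close> is caught.\<close>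

definition R :: real where "R = sqrt (h\<^sup>2 - (norm (x0 - p))\<^sup>2)"
abbreviation "Rp \<equiv> R * (1 + 32 * t)"
abbreviation "Rm \<equiv> R * (1 - 32 * t)"
abbreviation "lam \<equiv> 1 + 64 * t"
abbreviation "N \<equiv> M \<inter> cball x0 h"
abbreviation "Dsc r \<equiv> disc d (tframe p) r"

definition Pr :: "fsv \<Rightarrow> fsv" where "Pr x = P p (x - p)"

lemma t_bounds: "0 < t" "t \<le> 1/2240"
  using h_pos h_small rho_pos by (auto simp: t_def field_simps)

lemma offset_sq: "(norm (x0 - p))\<^sup>2 \<le> h\<^sup>2 / 4"
  using power_mono[OF offset, of 2] by (simp add: power_divide)

lemma R_sq: "R\<^sup>2 = h\<^sup>2 - (norm (x0 - p))\<^sup>2" "3/4 * h\<^sup>2 \<le> R\<^sup>2"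
proof -
  have "0 \<le> h\<^sup>2 - (norm (x0 - p))\<^sup>2" using offset_sq zero_le_power2[of h] by linarith
  then show "R\<^sup>2 = h\<^sup>2 - (norm (x0 - p))\<^sup>2" by (simp add: R_def)
  then show "3/4 * h\<^sup>2 \<le> R\<^sup>2" using offset_sq by simp
qed

lemma R_bounds: "h / 2 \<le> R" "R \<le> h"
proof -
  have "h\<^sup>2 / 4 \<le> h\<^sup>2 - (norm (x0 - p))\<^sup>2" using offset_sq zero_le_power2[of h] by linarith
  then have "(h / 2)\<^sup>2 \<le> h\<^sup>2 - (norm (x0 - p))\<^sup>2" "h\<^sup>2 - (norm (x0 - p))\<^sup>2 \<le> h\<^sup>2"
    by (simp_all add: power_divide)
  note sq = this
  show "h / 2 \<le> R" unfolding R_def by (rule real_le_rsqrt[OF sq(1)])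
  show "R \<le> h" unfolding R_def using sq(2) h_pos by (simp add: real_le_lsqrt)
qed

lemma Rp_bounds: "0 < Rp" "Rp \<le> 2 * h"
proof -
  have "0 < R" using R_bounds h_pos by linarith
  then show "0 < Rp" using t_bounds by (intro mult_pos_pos) auto
  have "Rp \<le> h * 2" using R_bounds t_bounds h_pos by (intro mult_mono) auto
  then show "Rp \<le> 2 * h" by simp
qed

lemma Rm_bounds: "h / 4 \<le> Rm" "Rm \<le> h"
proof -
  have "h / 2 * (1 / 2) \<le> Rm" using R_bounds t_bounds h_pos by (intro mult_mono) auto
  then show "h / 4 \<le> Rm" by simp
  have "Rm \<le> h * 1" using R_bounds t_bounds h_pos by (intro mult_mono) auto
  then show "Rm \<le> h" by simp
qed

lemma Rm_pos: "0 < Rm" and Rm_le_Rp: "Rm \<le> Rp"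
proof -
  show "0 < Rm" using Rm_bounds h_pos by linarith
  have "0 \<le> R" using R_bounds h_pos by linarith
  then show "Rm \<le> Rp" using t_bounds by (intro mult_left_mono) auto
qed

text \<open>The margin of 32 t in the radius absorbs the error of \<open>dist_decomposition\<close>,
  since R^2 is at least 3/4 h^2; likewise for \<open>Rm\<close>.\<close>

lemma Rp_sq: "R\<^sup>2 + 4 * h\<^sup>2 * t \<le> Rp\<^sup>2"
proof -
  have "4 * h\<^sup>2 * t \<le> 64 * t * (3/4 * h\<^sup>2)" using t_bounds by simp
  also have "\<dots> \<le> 64 * t * R\<^sup>2" using t_bounds R_sq(2) by (intro mult_left_mono) auto
  finally have "R\<^sup>2 + 4 * h\<^sup>2 * t \<le> R\<^sup>2 * (1 + 64 * t)" by (simp add: algebra_simps)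
  also have "\<dots> \<le> R\<^sup>2 * (1 + 32 * t)\<^sup>2"
    by (intro mult_left_mono) (auto simp: power2_eq_square algebra_simps)
  finally show ?thesis by (simp add: power_mult_distrib)
qed

lemma Rm_sq: "Rm\<^sup>2 + 5 * h\<^sup>2 * t \<le> R\<^sup>2"
proof -
  have "1024 * (t * t) \<le> 32 * t" using t_bounds mult_right_mono[of t "1/32" t] by simp
  then have "(1 - 32 * t)\<^sup>2 \<le> 1 - 32 * t" by (simp add: power2_eq_square algebra_simps)
  then have "R\<^sup>2 * (1 - 32 * t)\<^sup>2 \<le> R\<^sup>2 * (1 - 32 * t)" by (intro mult_left_mono) auto
  moreover have "5 * h\<^sup>2 * t \<le> 32 * t * (3/4 * h\<^sup>2)" using t_bounds by simp
  moreover have "32 * t * (3/4 * h\<^sup>2) \<le> 32 * t * R\<^sup>2" using t_bounds R_sq(2) by (intro mult_left_mono) auto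
  moreover have "R\<^sup>2 * (1 - 32 * t) = R\<^sup>2 - 32 * t * R\<^sup>2" by (simp add: algebra_simps)
  ultimately show ?thesis unfolding power_mult_distrib by linarith
qed

text \<open>Pythagoras, up to the normal part \<open>?\<nu>\<close> of length at most 4 h t. The
  cross term contributes 4 h^2 t and the square of \<open>?\<nu>\<close> another h^2 t, which the
  one-sided version can drop because of its sign.\<close>

lemma dist_decomposition:
  assumes x: "x \<in> M" and xp: "norm (x - p) \<le> 2 * h"
  shows "\<bar>(norm (x - x0))\<^sup>2 - ((norm (Pr x))\<^sup>2 + (norm (x0 - p))\<^sup>2)\<bar> \<le> 5 * h\<^sup>2 * t"
    and "(norm (x - x0))\<^sup>2 \<ge> (norm (Pr x))\<^sup>2 + (norm (x0 - p))\<^sup>2 - 4 * h\<^sup>2 * t"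
proof -
  let ?v = "x0 - p" let ?\<nu> = "(x - p) - Pr x"
  have "\<rho> * norm ?\<nu> \<le> (2 * h)\<^sup>2"
    using tangent_deviation[OF p x] power_mono[OF xp, of 2] by (simp add: Pr_def)
  then have \<nu>: "norm ?\<nu> \<le> 4 * h * t" using rho_pos by (simp add: t_def field_simps power2_eq_square)
  have orth: "inner (Pr x) ?v = 0"
    unfolding Pr_def by (rule nearest_point_normal[OF p near P_in_Tan[OF p]])
  have pyth: "(norm (x - p))\<^sup>2 = (norm (Pr x))\<^sup>2 + (norm ?\<nu>)\<^sup>2"
    unfolding Pr_def by (rule frame_proj_pythagoras[OF orthonormal_tframe[OF p]])
  have "inner (x - p) ?v = inner ?\<nu> ?v" using orth by (simp add: inner_diff_left)
  moreover have "(norm ((x - p) - ?v))\<^sup>2 = (norm (x - p))\<^sup>2 - 2 * inner (x - p) ?v + (norm ?v)\<^sup>2"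
    unfolding power2_norm_eq_inner inner_diff_left[of "x - p" ?v] inner_diff_right[of _ "x - p" ?v]
    by (simp add: inner_commute)
  ultimately have eq: "(norm (x - x0))\<^sup>2 = (norm (Pr x))\<^sup>2 + (norm ?v)\<^sup>2 + ((norm ?\<nu>)\<^sup>2 - 2 * inner ?\<nu> ?v)"
    using pyth by simp
  have "\<bar>inner ?\<nu> ?v\<bar> \<le> norm ?\<nu> * norm ?v" by (rule Cauchy_Schwarz_ineq2)
  also have "\<dots> \<le> (4 * h * t) * (h / 2)" using \<nu> offset h_pos t_bounds by (intro mult_mono) auto
  finally have inn: "\<bar>2 * inner ?\<nu> ?v\<bar> \<le> 4 * h\<^sup>2 * t" by (simp add: power2_eq_square)
  have "(norm ?\<nu>)\<^sup>2 \<le> (4 * h * t)\<^sup>2" by (intro power_mono \<nu>) auto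
  also have "\<dots> = h\<^sup>2 * t * (16 * t)" by (simp add: power2_eq_square)
  also have "\<dots> \<le> h\<^sup>2 * t * 1" using t_bounds h_pos by (intro mult_left_mono) auto
  finally have "(norm ?\<nu>)\<^sup>2 \<le> h\<^sup>2 * t" by simp
  then show "\<bar>(norm (x - x0))\<^sup>2 - ((norm (Pr x))\<^sup>2 + (norm (x0 - p))\<^sup>2)\<bar> \<le> 5 * h\<^sup>2 * t"
    unfolding eq using inn zero_le_power2[of "norm ?\<nu>"] by linarith
  show "(norm (x - x0))\<^sup>2 \<ge> (norm (Pr x))\<^sup>2 + (norm (x0 - p))\<^sup>2 - 4 * h\<^sup>2 * t"
    unfolding eq using inn zero_le_power2[of "norm ?\<nu>"] by linarith
qed

lemma N_near: "x \<in> N \<Longrightarrow> norm (x - p) \<le> 2 * h"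
  using norm_triangle_ineq[of "x - x0" "x0 - p"] offset h_pos
  by (auto simp: dist_norm norm_minus_commute)

lemma Pr_in_span: "Pr x \<in> frame_span d (tframe p)"
  by (simp add: Pr_def)

lemma Pr_N_subset: "Pr ` N \<subseteq> Dsc Rp"
proof clarify
  fix x assume x: "x \<in> M" "x \<in> cball x0 h"
  have "(norm (x - x0))\<^sup>2 \<le> h\<^sup>2" using x(2) by (intro power_mono) (auto simp: dist_norm norm_minus_commute)
  then have "(norm (Pr x))\<^sup>2 \<le> R\<^sup>2 + 4 * h\<^sup>2 * t"
    using dist_decomposition(2)[OF x(1) N_near] x R_sq(1) by auto
  then have "(norm (Pr x))\<^sup>2 \<le> Rp\<^sup>2" using Rp_sq by linarith
  then have "norm (Pr x) \<le> Rp" by (rule power2_le_imp_le) (use Rp_bounds in linarith)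
  then show "Pr x \<in> Dsc Rp" using Pr_in_span by (simp add: disc_def)
qed

lemma disc_subset_Pr_N: "Dsc Rm \<subseteq> Pr ` N"
proof
  fix w assume "w \<in> Dsc Rm"
  then have w: "w \<in> Tan p" "norm w \<le> Rm" using span_tframe[OF p] by (auto simp: disc_def)
  have "norm w \<le> \<rho> / 560" using w(2) Rm_bounds h_small rho_pos by linarith
  then obtain z where z: "z \<in> M" "P p (z - p) = w" "norm (z - p) \<le> 2 * norm w"
    using graph_onto[OF p w(1)] by blast
  have "norm (z - p) \<le> 2 * h" using z(3) w(2) Rm_bounds by linarith
  from dist_decomposition(1)[OF z(1) this]
  have "(norm (z - x0))\<^sup>2 \<le> (norm w)\<^sup>2 + (norm (x0 - p))\<^sup>2 + 5 * h\<^sup>2 * t"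
    using z(2) by (simp add: Pr_def)
  also have "(norm w)\<^sup>2 \<le> Rm\<^sup>2" using w(2) by (intro power_mono) auto
  finally have "(norm (z - x0))\<^sup>2 \<le> h\<^sup>2" using Rm_sq R_sq(1) by simp
  then have "norm (z - x0) \<le> h" by (rule power2_le_imp_le) (use h_pos in simp)
  then have "z \<in> N" using z(1) by (simp add: dist_norm norm_minus_commute)
  then show "w \<in> Pr ` N" using z(2) by (auto simp: Pr_def)
qed

lemma Pr_diff: "Pr x - Pr y = P p (x - y)"
  by (simp add: Pr_def frame_proj_diff)

lemma Pr_lipschitz: "norm (Pr x - Pr y) \<le> 1 * norm (x - y)"
  unfolding Pr_diff using norm_P_le[OF p] by simp

lemma Pr_inverse_lipschitz:
  assumes "x \<in> N" "y \<in> N"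
  shows "norm (x - y) \<le> lam * norm (Pr x - Pr y)"
  unfolding Pr_diff
  using graph_bilipschitz[OF p, of y "2 * h" x] assms N_near[OF assms(1)] N_near[OF assms(2)] h_small
  by (simp add: t_def)

text \<open>The inverse of the projection is Lipschitz with constant \<open>lam\<close>. Restricting
  to an arbitrary \<open>A\<close> prepares an inequality between measures pushed forward to the
  tangent space.\<close>

lemma hausdorff_upper: "hausdorff_outer d (N \<inter> Pr -` A) \<le> ennreal (lam ^ d) * hausdorff_outer d (Dsc Rp \<inter> A)"
proof -
  let ?S = "Pr ` (N \<inter> Pr -` A)"
  have inj: "inj_on Pr N"
  proof (rule inj_onI)
    fix x y assume "x \<in> N" "y \<in> N" "Pr x = Pr y"
    then show "x = y" using Pr_inverse_lipschitz[of x y] by simp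
  qed
  have inv: "inv_into N Pr w \<in> N" "Pr (inv_into N Pr w) = w" if "w \<in> ?S" for w
    using that by (auto simp: inv_into_into f_inv_into_f inj)
  have "hausdorff_outer d (N \<inter> Pr -` A) \<le> ennreal (lam ^ d) * hausdorff_outer d ?S"
  proof (rule hausdorff_outer_lipschitz_subset[where f="inv_into N Pr"])
    show "norm (inv_into N Pr w - inv_into N Pr w') \<le> lam * norm (w - w')" if "w \<in> ?S" "w' \<in> ?S" for w w'
      using Pr_inverse_lipschitz[OF inv(1)[OF that(1)] inv(1)[OF that(2)]]
      unfolding inv(2)[OF that(1)] inv(2)[OF that(2)] .
    show "N \<inter> Pr -` A \<subseteq> inv_into N Pr ` ?S"
      using inj by (force simp: image_image)
  qed (use t_bounds in auto)
  also have "hausdorff_outer d ?S \<le> hausdorff_outer d (Dsc Rp \<inter> A)"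
    using Pr_N_subset by (intro hausdorff_outer_mono) auto
  finally show ?thesis by (simp add: mult_left_mono)
qed

lemma hausdorff_lower: "hausdorff_outer d (Dsc Rm \<inter> A) \<le> hausdorff_outer d (N \<inter> Pr -` A)"
proof -
  have "hausdorff_outer d (Dsc Rm \<inter> A) \<le> ennreal (1 ^ d) * hausdorff_outer d (N \<inter> Pr -` A)"
    by (rule hausdorff_outer_lipschitz_subset[OF Pr_lipschitz]) (use disc_subset_Pr_N in auto)
  then show ?thesis by simp
qed

end

section \<open>Integrals over the manifold against integrals over tangent discs\<close>

locale local_measure = local_graph +
  assumes nonzero: "emeasure (hausdorff_measure d) UNIV \<noteq> 0"
    and finite_M: "emeasure (hausdorff_measure d) M < \<infinity>"
begin

abbreviation "\<mu> \<equiv> hausdorff_measure d"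

lemma emeasure_mu: "A \<in> sets borel \<Longrightarrow> emeasure \<mu> A = hausdorff_outer d A"
  by (rule emeasure_hausdorff_measure[OF nonzero])

lemma borel_N [measurable]: "N \<in> sets borel"
  using compact_imp_closed[OF compact_M] by (intro borel_closed closed_Int) auto

lemma measurable_mu: "borel_measurable \<mu> = borel_measurable borel"
  by (rule measurable_cong_sets) simp_all

lemma borel_Dsc [measurable]: "Dsc r \<in> sets borel"
  by (intro borel_closed closed_disc orthonormal_tframe p)

lemma continuous_Pr: "continuous_on UNIV Pr"
  unfolding Pr_def by (intro continuous_on_frame_proj[OF orthonormal_tframe[OF p]] continuous_intros)

lemma borel_Pr [measurable]: "Pr \<in> borel_measurable borel"
  by (rule borel_measurable_continuous_onI[OF continuous_Pr])

lemma finite_N: "emeasure \<mu> N < \<infinity>"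
proof -
  have "emeasure \<mu> N \<le> emeasure \<mu> M"
    using compact_imp_closed[OF compact_M] by (intro emeasure_mono) (auto intro: borel_closed)
  then show ?thesis using finite_M by (rule le_less_trans)
qed

definition \<kappa> :: real where "\<kappa> = enn2real (hausdorff_outer d (Dsc 1))"

text \<open>Finiteness is inherited from \<open>M\<close>, since the disc of radius
  \<open>Rm\<close> is a contraction of part of \<open>N\<close>. Its positive lower bound is that
  of the unit disc.\<close>

lemma kappa: "hausdorff_outer d (Dsc 1) = ennreal \<kappa>" and kappa_ge: "omega d / 2 ^ d \<le> \<kappa>"
proof -
  have "ennreal (Rm ^ d) * hausdorff_outer d (Dsc 1) = hausdorff_outer d (Dsc Rm)"
    using hausdorff_outer_disc[OF Rm_pos] by simp
  also have "\<dots> \<le> emeasure \<mu> N"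
    using hausdorff_lower[of UNIV] by (simp add: emeasure_mu borel_N)
  finally have "ennreal (Rm ^ d) * hausdorff_outer d (Dsc 1) < \<infinity>"
    using finite_N by (rule le_less_trans)
  then have "hausdorff_outer d (Dsc 1) < \<infinity>"
    using zero_less_power[OF Rm_pos, of d] by (auto simp: ennreal_mult_less_top ennreal_eq_0_iff)
  then show eq: "hausdorff_outer d (Dsc 1) = ennreal \<kappa>" by (simp add: \<kappa>_def)
  have "ennreal (omega d / 2 ^ d) \<le> ennreal \<kappa>"
    using hausdorff_outer_unit_disc_ge[OF orthonormal_tframe[OF p] d_pos] eq by simp
  then show "omega d / 2 ^ d \<le> \<kappa>"
    by (subst (asm) ennreal_le_iff) (auto simp: \<kappa>_def)
qed

lemma kappa_pos: "0 < \<kappa>"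
proof -
  have "0 < omega d / 2 ^ d" by (simp add: omega_def)
  then show ?thesis using kappa_ge by linarith
qed

lemma emeasure_Dsc: "0 < r \<Longrightarrow> emeasure \<mu> (Dsc r) = ennreal (\<kappa> * r ^ d)"
  using kappa_pos unfolding emeasure_mu[OF borel_Dsc]
  by (subst hausdorff_outer_disc) (simp_all add: kappa ennreal_mult mult.commute)

lemma emeasure_N_bounds: "ennreal (\<kappa> * Rm ^ d) \<le> emeasure \<mu> N" "emeasure \<mu> N \<le> ennreal (lam ^ d * (\<kappa> * Rp ^ d))"
proof -
  show "ennreal (\<kappa> * Rm ^ d) \<le> emeasure \<mu> N"
    using hausdorff_lower[of UNIV] emeasure_Dsc[OF Rm_pos] by (simp add: emeasure_mu borel_N borel_Dsc)
  have "emeasure \<mu> N \<le> ennreal (lam ^ d) * emeasure \<mu> (Dsc Rp)"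
    using hausdorff_upper[of UNIV] by (simp add: emeasure_mu borel_N borel_Dsc)
  also have "\<dots> = ennreal (lam ^ d * (\<kappa> * Rp ^ d))"
    using emeasure_Dsc[OF Rp_bounds(1)] Rp_bounds t_bounds kappa_pos by (simp add: ennreal_mult)
  finally show "emeasure \<mu> N \<le> ennreal (lam ^ d * (\<kappa> * Rp ^ d))" .
qed

lemma emeasure_density_indicator:
  "A \<in> sets borel \<Longrightarrow> B \<in> sets borel \<Longrightarrow> emeasure (density \<mu> (indicator B)) A = emeasure \<mu> (B \<inter> A)"
proof -
  assume A: "A \<in> sets borel" and B: "B \<in> sets borel"
  have "emeasure (density \<mu> (indicator B)) A = (\<integral>\<^sup>+x. indicator B x * indicator A x \<partial>\<mu>)"
    using A B by (subst emeasure_density) auto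
  also have "\<dots> = (\<integral>\<^sup>+x. indicator (B \<inter> A) x \<partial>\<mu>)"
    by (intro nn_integral_cong) (auto simp: indicator_def)
  also have "\<dots> = emeasure \<mu> (B \<inter> A)" using A B by (intro nn_integral_indicator) auto
  finally show ?thesis .
qed

text \<open>In place of a change of variables: the setwise comparison says that the pushforward of
  the measure on \<open>N\<close> is below a multiple of the measure on the disc, and this order
  passes to integrals of nonnegative functions.\<close>

lemma nn_integral_N_upper:
  fixes \<phi> :: "fsv \<Rightarrow> ennreal"
  assumes [measurable]: "\<phi> \<in> borel_measurable borel"
  shows "(\<integral>\<^sup>+x. indicator N x * \<phi> (Pr x) \<partial>\<mu>) \<le> ennreal (lam ^ d) * (\<integral>\<^sup>+x. indicator (Dsc Rp) x * \<phi> x \<partial>\<mu>)"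
proof -
  let ?\<nu> = "distr (density \<mu> (indicator N)) borel Pr"
  let ?m = "scale_measure (ennreal (lam ^ d)) (density \<mu> (indicator (Dsc Rp)))"
  have le: "?\<nu> \<le> ?m"
  proof -
    have "emeasure ?\<nu> \<le> emeasure ?m"
    proof (rule le_funI)
      fix A
      show "emeasure ?\<nu> A \<le> emeasure ?m A"
      proof (cases "A \<in> sets borel")
        case True
        then have [measurable]: "A \<in> sets borel" .
        have PA: "Pr -` A \<in> sets borel" using measurable_sets_borel[OF borel_Pr True] .
        have "emeasure ?\<nu> A = emeasure \<mu> (N \<inter> Pr -` A)"
          using PA by (simp add: emeasure_distr emeasure_density_indicator borel_N)
        also have "\<dots> = hausdorff_outer d (N \<inter> Pr -` A)"
          using PA by (intro emeasure_mu sets.Int borel_N)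
        also have "\<dots> \<le> ennreal (lam ^ d) * hausdorff_outer d (Dsc Rp \<inter> A)" by (rule hausdorff_upper)
        also have "hausdorff_outer d (Dsc Rp \<inter> A) = emeasure \<mu> (Dsc Rp \<inter> A)"
          using True by (intro emeasure_mu[symmetric] sets.Int borel_Dsc)
        also have "ennreal (lam ^ d) * \<dots> = emeasure ?m A"
          using True by (simp add: emeasure_density_indicator borel_Dsc)
        finally show ?thesis .
      qed (simp add: emeasure_notin_sets)
    qed
    then show ?thesis by (simp add: le_measure_iff space_scale_measure)
  qed
  have "(\<integral>\<^sup>+x. indicator N x * \<phi> (Pr x) \<partial>\<mu>) = nn_integral ?\<nu> \<phi>"
    by (simp add: nn_integral_distr nn_integral_density)
  also have "\<dots> \<le> nn_integral ?m \<phi>" by (rule nn_integral_mono_measure[OF _ le]) simp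
  also have "\<dots> = ennreal (lam ^ d) * (\<integral>\<^sup>+x. indicator (Dsc Rp) x * \<phi> x \<partial>\<mu>)"
    by (simp add: nn_integral_scale_measure nn_integral_density)
  finally show ?thesis .
qed

lemma nn_integral_N_lower:
  fixes \<phi> :: "fsv \<Rightarrow> ennreal"
  assumes [measurable]: "\<phi> \<in> borel_measurable borel"
  shows "(\<integral>\<^sup>+x. indicator (Dsc Rm) x * \<phi> x \<partial>\<mu>) \<le> (\<integral>\<^sup>+x. indicator N x * \<phi> (Pr x) \<partial>\<mu>)"
proof -
  let ?\<nu> = "distr (density \<mu> (indicator N)) borel Pr"
  let ?m = "density \<mu> (indicator (Dsc Rm))"
  have le: "?m \<le> ?\<nu>"
  proof -
    have "emeasure ?m \<le> emeasure ?\<nu>"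
    proof (rule le_funI)
      fix A
      show "emeasure ?m A \<le> emeasure ?\<nu> A"
      proof (cases "A \<in> sets borel")
        case True
        then have [measurable]: "A \<in> sets borel" .
        have PA: "Pr -` A \<in> sets borel" using measurable_sets_borel[OF borel_Pr True] .
        have "emeasure ?m A = hausdorff_outer d (Dsc Rm \<inter> A)"
          using True by (simp add: emeasure_density_indicator borel_Dsc emeasure_mu sets.Int)
        also have "\<dots> \<le> hausdorff_outer d (N \<inter> Pr -` A)" by (rule hausdorff_lower)
        also have "\<dots> = emeasure \<mu> (N \<inter> Pr -` A)"
          using PA by (intro emeasure_mu[symmetric] sets.Int borel_N)
        also have "\<dots> = emeasure ?\<nu> A"
          using PA by (simp add: emeasure_distr emeasure_density_indicator borel_N)
        finally show ?thesis .
      qed (simp add: emeasure_notin_sets)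
    qed
    then show ?thesis by (simp add: le_measure_iff space_scale_measure)
  qed
  have "(\<integral>\<^sup>+x. indicator (Dsc Rm) x * \<phi> x \<partial>\<mu>) = nn_integral ?m \<phi>"
    by (simp add: nn_integral_density)
  also have "\<dots> \<le> nn_integral ?\<nu> \<phi>" by (rule nn_integral_mono_measure[OF _ le]) simp
  also have "\<dots> = (\<integral>\<^sup>+x. indicator N x * \<phi> (Pr x) \<partial>\<mu>)"
    by (simp add: nn_integral_distr nn_integral_density)
  finally show ?thesis .
qed

text \<open>Central reflection is an isometry preserving the disc, so Hausdorff measure on the disc
  is invariant under it.\<close>

lemma nn_integral_Dsc_reflect:
  fixes \<phi> :: "fsv \<Rightarrow> ennreal"
  assumes [measurable]: "\<phi> \<in> borel_measurable borel"
  shows "(\<integral>\<^sup>+x. indicator (Dsc r) x * \<phi> (- x) \<partial>\<mu>) = (\<integral>\<^sup>+x. indicator (Dsc r) x * \<phi> x \<partial>\<mu>)"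
proof -
  let ?m = "density \<mu> (indicator (Dsc r))"
  have um [measurable]: "(uminus :: fsv \<Rightarrow> fsv) \<in> borel_measurable borel"
    by (intro borel_measurable_continuous_onI continuous_intros)
  have sym: "- x \<in> Dsc r \<longleftrightarrow> x \<in> Dsc r" for x
    using subspace_neg[OF subspace_frame_span, of x d "tframe p"] subspace_neg[OF subspace_frame_span, of "- x" d "tframe p"]
    by (auto simp: disc_def)
  have refl_le: "hausdorff_outer d (uminus ` B) \<le> hausdorff_outer d B" for B
    using hausdorff_outer_lipschitz_image[of B uminus 1 d] by (simp add: norm_minus_commute)
  have refl: "hausdorff_outer d (uminus ` B) = hausdorff_outer d B" for B
    using refl_le[of B] refl_le[of "uminus ` B"] by (simp add: image_image)
  have "distr ?m borel uminus = ?m"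
  proof (rule measure_eqI)
    fix A assume "A \<in> sets (distr ?m borel uminus)"
    then have A [measurable]: "A \<in> sets borel" by simp
    have mA: "uminus -` A \<in> sets (borel :: fsv measure)" using measurable_sets_borel[OF um A] .
    have "emeasure (distr ?m borel uminus) A = hausdorff_outer d (Dsc r \<inter> uminus -` A)"
      using mA by (simp add: emeasure_distr emeasure_density_indicator borel_Dsc emeasure_mu sets.Int)
    also have "Dsc r \<inter> uminus -` A = uminus ` (Dsc r \<inter> A)"
      using sym by (auto intro: image_eqI[of _ _ "- _"])
    also have "hausdorff_outer d \<dots> = emeasure ?m A"
      unfolding refl using A by (simp add: emeasure_density_indicator borel_Dsc emeasure_mu sets.Int)
    finally show "emeasure (distr ?m borel uminus) A = emeasure ?m A" .
  qed simp
  then have "nn_integral (distr ?m borel uminus) \<phi> = nn_integral ?m \<phi>" by simp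
  then show ?thesis by (simp add: nn_integral_distr nn_integral_density)
qed

text \<open>By reflection, the positive and the negative part of the linear functional have the same
  integral J over a disc. Hence both parts over \<open>N\<close> lie between J Rm and lam ^ d * J
  Rp, and their difference is at most the length of this interval.\<close>

lemma integral_N_tangential:
  "\<bar>\<integral>x. indicator N x * inner (Pr x) \<theta> \<partial>\<mu>\<bar> \<le>
     Rp * norm \<theta> * \<kappa> * ((lam ^ d - 1) * Rp ^ d + (Rp ^ d - Rm ^ d))"
proof -
  \<comment> \<open>\<open>ennreal\<close> cuts off negative values, so \<phi> is the positive part
    of the functional, and composing with the reflection gives the negative part.\<close>
  define \<phi> :: "fsv \<Rightarrow> ennreal" where "\<phi> w = ennreal (inner w \<theta>)" for w
  have inner_m [measurable]: "(\<lambda>w. inner w \<theta>) \<in> borel_measurable borel"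
    by (intro borel_measurable_continuous_onI continuous_intros)
  have \<phi>m [measurable]: "\<phi> \<in> borel_measurable borel" unfolding \<phi>_def by measurable
  define J where "J r = (\<integral>\<^sup>+x. indicator (Dsc r) x * \<phi> x \<partial>\<mu>)" for r
  define I where "I = (\<integral>\<^sup>+x. indicator N x * \<phi> (Pr x) \<partial>\<mu>)"
  define I' where "I' = (\<integral>\<^sup>+x. indicator N x * \<phi> (- Pr x) \<partial>\<mu>)"
  have \<phi>'m: "(\<lambda>w. \<phi> (- w)) \<in> borel_measurable borel" unfolding \<phi>_def by simp
  have I1: "J Rm \<le> I" "I \<le> ennreal (lam ^ d) * J Rp"
    unfolding I_def J_def by (rule nn_integral_N_lower nn_integral_N_upper, rule \<phi>m)+
  have I2: "J Rm \<le> I'" "I' \<le> ennreal (lam ^ d) * J Rp"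
    using nn_integral_N_lower[OF \<phi>'m] nn_integral_N_upper[OF \<phi>'m]
    unfolding I'_def J_def nn_integral_Dsc_reflect[OF \<phi>m] by auto
  have \<phi>_bound: "\<phi> w \<le> ennreal (Rp * norm \<theta>)" if "w \<in> Dsc Rp" for w
  proof -
    have "inner w \<theta> \<le> norm w * norm \<theta>" by (rule norm_cauchy_schwarz)
    also have "\<dots> \<le> Rp * norm \<theta>" using that by (intro mult_right_mono) (auto simp: disc_def)
    finally show ?thesis unfolding \<phi>_def by (rule ennreal_leI)
  qed
  have nnc: "0 \<le> Rp * norm \<theta>" using Rp_bounds by simp
  have "J Rp \<le> (\<integral>\<^sup>+x. ennreal (Rp * norm \<theta>) * indicator (Dsc Rp) x \<partial>\<mu>)"
    unfolding J_def using \<phi>_bound by (intro nn_integral_mono) (auto simp: indicator_def)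
  also have "\<dots> = ennreal (Rp * norm \<theta> * (\<kappa> * Rp ^ d))"
    using nnc Rp_bounds(1) kappa_pos by (simp add: nn_integral_cmult_indicator emeasure_Dsc ennreal_mult)
  finally have Jp: "J Rp \<le> ennreal (Rp * norm \<theta> * (\<kappa> * Rp ^ d))" .
  then have Jp_fin: "J Rp < \<infinity>" by (rule le_less_trans) simp
  have DD: "Dsc Rp - Dsc Rm \<in> sets \<mu>" using sets.Diff[OF borel_Dsc borel_Dsc] by simp
  have sub: "Dsc Rm \<subseteq> Dsc Rp" using Rm_le_Rp by (auto simp: disc_def)
  have "J Rp = (\<integral>\<^sup>+x. indicator (Dsc Rm) x * \<phi> x + indicator (Dsc Rp - Dsc Rm) x * \<phi> x \<partial>\<mu>)"
    unfolding J_def using sub by (intro nn_integral_cong) (auto simp: indicator_def)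
  also have "\<dots> = J Rm + (\<integral>\<^sup>+x. indicator (Dsc Rp - Dsc Rm) x * \<phi> x \<partial>\<mu>)"
    unfolding J_def by (intro nn_integral_add) measurable
  finally have Jsplit: "J Rp = J Rm + (\<integral>\<^sup>+x. indicator (Dsc Rp - Dsc Rm) x * \<phi> x \<partial>\<mu>)" .
  have "(\<integral>\<^sup>+x. indicator (Dsc Rp - Dsc Rm) x * \<phi> x \<partial>\<mu>) \<le>
      (\<integral>\<^sup>+x. ennreal (Rp * norm \<theta>) * indicator (Dsc Rp - Dsc Rm) x \<partial>\<mu>)"
    using \<phi>_bound by (intro nn_integral_mono) (auto simp: indicator_def)
  also have "\<dots> = ennreal (Rp * norm \<theta>) * emeasure \<mu> (Dsc Rp - Dsc Rm)"
    by (rule nn_integral_cmult_indicator[OF DD])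
  also have "emeasure \<mu> (Dsc Rp - Dsc Rm) = ennreal (\<kappa> * Rp ^ d) - ennreal (\<kappa> * Rm ^ d)"
    using sub by (subst emeasure_Diff) (auto simp: borel_Dsc emeasure_Dsc Rm_pos Rp_bounds)
  also have "\<dots> = ennreal (\<kappa> * Rp ^ d - \<kappa> * Rm ^ d)"
    using kappa_pos Rm_pos by (intro ennreal_minus) (auto intro: mult_nonneg_nonneg)
  finally have Jdiff: "J Rp \<le> J Rm + ennreal (Rp * norm \<theta> * (\<kappa> * Rp ^ d - \<kappa> * Rm ^ d))"
    unfolding Jsplit using nnc by (simp add: ennreal_mult' add_left_mono)
  have mono: "\<kappa> * Rm ^ d \<le> \<kappa> * Rp ^ d"
    using kappa_pos Rm_pos by (intro mult_left_mono power_mono[OF Rm_le_Rp]) auto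
  define j where "j r = enn2real (J r)" for r
  have Jm_fin: "J Rm < \<infinity>"
  proof (rule le_less_trans)
    show "J Rm \<le> J Rp" unfolding Jsplit by simp
  qed (rule Jp_fin)
  have J_eq: "J Rp = ennreal (j Rp)" "J Rm = ennreal (j Rm)" using Jp_fin Jm_fin by (auto simp: j_def)
  have I_fin: "I < \<infinity>" "I' < \<infinity>"
    using I1(2) I2(2) Jp_fin by (auto intro: le_less_trans simp: ennreal_mult_less_top)
  then have I_eq: "I = ennreal (enn2real I)" "I' = ennreal (enn2real I')" by auto
  have lam0: "0 \<le> lam ^ d" using t_bounds by simp
  have jn: "0 \<le> j r" for r by (simp add: j_def)
  have r1: "j Rm \<le> enn2real I" "j Rm \<le> enn2real I'"
    using I1(1) I2(1) I_fin unfolding j_def by (auto intro!: enn2real_mono)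
  have r2: "enn2real I \<le> lam ^ d * j Rp" "enn2real I' \<le> lam ^ d * j Rp"
    using enn2real_mono[OF I1(2)] enn2real_mono[OF I2(2)] Jp_fin lam0
    by (auto simp: ennreal_mult_less_top enn2real_mult j_def)
  have r3: "j Rp \<le> Rp * norm \<theta> * (\<kappa> * Rp ^ d)"
    unfolding j_def using Jp nnc kappa_pos Rp_bounds by (intro enn2real_leI) auto
  have r4: "j Rp \<le> j Rm + Rp * norm \<theta> * (\<kappa> * Rp ^ d - \<kappa> * Rm ^ d)"
    using Jdiff jn nnc mono unfolding J_eq
    by (subst (asm) ennreal_plus[symmetric], simp, simp, subst (asm) ennreal_le_iff) auto
  have int: "integrable \<mu> (\<lambda>x. indicator N x * inner (Pr x) \<theta>)"
  proof (rule integrableI_bounded)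
    show "(\<integral>\<^sup>+x. ennreal (norm (indicator N x * inner (Pr x) \<theta>)) \<partial>\<mu>) < \<infinity>"
    proof -
      have "(\<integral>\<^sup>+x. ennreal (norm (indicator N x * inner (Pr x) \<theta>)) \<partial>\<mu>) \<le> (\<integral>\<^sup>+x. indicator N x * \<phi> (Pr x) + indicator N x * \<phi> (- Pr x) \<partial>\<mu>)"
        by (intro nn_integral_mono) (auto simp: indicator_def \<phi>_def abs_if ennreal_neg)
      also have "\<dots> = I + I'"
        unfolding I_def I'_def
        by (intro nn_integral_add; unfold measurable_mu;
            intro borel_measurable_times_ennreal borel_measurable_indicator borel_N
              measurable_compose[OF borel_Pr \<phi>m] measurable_compose[OF borel_Pr \<phi>'m])
      finally show ?thesis using I_fin by (auto intro: le_less_trans)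
    qed
    show "(\<lambda>x. indicator N x * inner (Pr x) \<theta>) \<in> borel_measurable \<mu>"
      unfolding measurable_mu
      by (intro borel_measurable_times borel_measurable_indicator borel_N measurable_compose[OF borel_Pr inner_m])
  qed
  have "(\<integral>x. indicator N x * inner (Pr x) \<theta> \<partial>\<mu>) = enn2real I - enn2real I'"
    unfolding real_lebesgue_integral_def[OF int] I_def I'_def \<phi>_def
    by (intro arg_cong2[where f="(-)"] arg_cong[where f=enn2real] nn_integral_cong)
       (auto simp: indicator_def)
  then have "\<bar>\<integral>x. indicator N x * inner (Pr x) \<theta> \<partial>\<mu>\<bar> \<le> lam ^ d * j Rp - j Rm"
    using r1 r2 by (auto simp: abs_le_iff)
  \<comment> \<open>The interval splits into the Lipschitz distortion and the contribution of the
    annulus between the two discs.\<close>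
  also have "\<dots> = (lam ^ d - 1) * j Rp + (j Rp - j Rm)" by (simp add: algebra_simps)
  also have "\<dots> \<le> (lam ^ d - 1) * (Rp * norm \<theta> * (\<kappa> * Rp ^ d)) + Rp * norm \<theta> * (\<kappa> * Rp ^ d - \<kappa> * Rm ^ d)"
    using r3 r4 t_bounds by (intro add_mono mult_left_mono) (auto simp: one_le_power)
  also have "\<dots> = Rp * norm \<theta> * \<kappa> * ((lam ^ d - 1) * Rp ^ d + (Rp ^ d - Rm ^ d))"
    by (simp add: algebra_simps)
  finally show ?thesis .
qed

end

text \<open>The chord over [0, 1] of a convex function lies above its graph.\<close>

lemma power_one_plus_le:
  fixes x :: real
  assumes "0 \<le> x" "x \<le> 1"
  shows "(1 + x) ^ k \<le> 1 + (2 ^ k - 1) * x"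
proof (induction k)
  case (Suc k)
  have "(1 + x) ^ Suc k \<le> (1 + (2 ^ k - 1) * x) * (1 + x)"
    using Suc assms by (simp add: mult.commute mult_left_mono)
  also have "\<dots> = 1 + 2 ^ k * x + (2 ^ k - 1) * (x * x)" by (simp add: algebra_simps)
  also have "(2 ^ k - 1) * (x * x) \<le> (2 ^ k - 1) * (x * 1)"
    using assms by (intro mult_left_mono) auto
  finally show ?case by (simp add: algebra_simps)
qed simp

context local_measure
begin

text \<open>Factors exponential in d are affordable, but one factor t = h / \<rho> has to survive,
  since it turns h into h^2 / \<rho>. Distortion and annulus are both linearised in t; 256 is 2 from
  \<open>Rp\<close> times 4 times 32.\<close>

lemma tangential_bound:
  "\<bar>\<integral>x. indicator N x * inner (Pr x) \<theta> \<partial>\<mu>\<bar> \<le> 256 * 4 ^ d * norm \<theta> * (h\<^sup>2 / \<rho>) * (\<kappa> * h ^ d)"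
proof -
  let ?a = "32 * t"
  have a: "0 \<le> ?a" "2 * ?a \<le> 1" using t_bounds by auto
  have R: "0 \<le> R" "R \<le> h" using R_bounds h_pos by auto
  have two: "(1 + ?a) ^ d \<le> 2 ^ d" using a by (intro power_mono) auto
  have lam: "lam ^ d - 1 \<le> 2 ^ d * (2 * ?a)"
  proof -
    have "(1 + 2 * ?a) ^ d \<le> 1 + (2 ^ d - 1) * (2 * ?a)" using a by (intro power_one_plus_le) auto
    also have "\<dots> \<le> 1 + 2 ^ d * (2 * ?a)" using a by (simp add: algebra_simps)
    finally show ?thesis by simp
  qed
  have lam1: "0 \<le> lam ^ d - 1" using t_bounds by (simp add: one_le_power)
  have up: "(1 + ?a) ^ d \<le> 1 + 2 ^ d * ?a"
    using power_one_plus_le[of ?a d] a by (simp add: algebra_simps)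
  have "1 - real d * ?a \<le> (1 - ?a) ^ d"
    using Bernoulli_inequality[of "- ?a" d] a by simp
  moreover have "real d \<le> 2 ^ d" by (metis less_exp less_imp_le of_nat_le_iff of_nat_numeral of_nat_power)
  then have "real d * ?a \<le> 2 ^ d * ?a" using a by (intro mult_right_mono) auto
  ultimately have low: "1 - 2 ^ d * ?a \<le> (1 - ?a) ^ d" by linarith
  have "(lam ^ d - 1) * Rp ^ d + (Rp ^ d - Rm ^ d) = R ^ d * ((lam ^ d - 1) * (1 + ?a) ^ d + ((1 + ?a) ^ d - (1 - ?a) ^ d))"
    unfolding power_mult_distrib by (simp add: algebra_simps)
  also have "\<dots> \<le> R ^ d * ((2 ^ d * (2 * ?a)) * 2 ^ d + 2 ^ d * (2 * ?a))"
    using lam lam1 two up low a R by (intro mult_left_mono add_mono mult_mono) auto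
  also have "\<dots> \<le> R ^ d * (4 ^ d * (4 * ?a))"
  proof (intro mult_left_mono)
    have e: "(2 ^ d * 2 ^ d :: real) = 4 ^ d" by (simp flip: power_mult_distrib)
    have "(2 ^ d * (2 * ?a)) * 2 ^ d + 2 ^ d * (2 * ?a) = (2 ^ d * 2 ^ d) * (2 * ?a) + 2 ^ d * (2 * ?a)"
      by (simp only: mult_ac)
    also have "\<dots> \<le> (2 ^ d * 2 ^ d) * (2 * ?a) + (2 ^ d * 2 ^ d) * (2 * ?a)"
      using a by (intro add_left_mono mult_right_mono) auto
    also have "\<dots> = 4 ^ d * (4 * ?a)" unfolding e by simp
    finally show "(2 ^ d * (2 * ?a)) * 2 ^ d + 2 ^ d * (2 * ?a) \<le> 4 ^ d * (4 * ?a)" .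
  qed (use R in auto)
  also have "\<dots> \<le> h ^ d * (4 ^ d * (4 * ?a))" using R a by (intro mult_right_mono power_mono) auto
  finally have br: "(lam ^ d - 1) * Rp ^ d + (Rp ^ d - Rm ^ d) \<le> h ^ d * (4 ^ d * (4 * ?a))" .
  have "\<bar>\<integral>x. indicator N x * inner (Pr x) \<theta> \<partial>\<mu>\<bar> \<le> Rp * norm \<theta> * \<kappa> * ((lam ^ d - 1) * Rp ^ d + (Rp ^ d - Rm ^ d))"
    by (rule integral_N_tangential)
  also have "\<dots> \<le> (Rp * norm \<theta> * \<kappa>) * (h ^ d * (4 ^ d * (4 * ?a)))"
    using Rp_bounds kappa_pos by (intro mult_left_mono[OF br]) simp
  also have "\<dots> \<le> (2 * h * norm \<theta> * \<kappa>) * (h ^ d * (4 ^ d * (4 * ?a)))"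
  proof (rule mult_right_mono)
    show "Rp * norm \<theta> * \<kappa> \<le> 2 * h * norm \<theta> * \<kappa>"
      by (rule mult_right_mono[OF mult_right_mono[OF Rp_bounds(2)]]) (use kappa_pos in auto)
    show "0 \<le> h ^ d * (4 ^ d * (4 * ?a))" using a h_pos by simp
  qed
  also have "\<dots> = 256 * 4 ^ d * norm \<theta> * (h\<^sup>2 / \<rho>) * (\<kappa> * h ^ d)"
    by (simp add: t_def power2_eq_square)
  finally show ?thesis .
qed

lemma measure_N_le: "measure \<mu> N \<le> 4 ^ d * (\<kappa> * h ^ d)"
proof -
  have R: "0 \<le> R" "R \<le> h" using R_bounds h_pos by auto
  have "measure \<mu> N \<le> lam ^ d * (\<kappa> * Rp ^ d)"
    unfolding measure_def using emeasure_N_bounds(2) kappa_pos Rp_bounds t_bounds by (intro enn2real_leI) auto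
  also have "\<dots> \<le> 2 ^ d * (\<kappa> * (2 * h) ^ d)"
  proof (intro mult_mono)
    show "lam ^ d \<le> 2 ^ d" using t_bounds by (intro power_mono) auto
    show "Rp ^ d \<le> (2 * h) ^ d" by (rule power_mono[OF Rp_bounds(2)]) (use Rp_bounds(1) in linarith)
    show "0 \<le> \<kappa> * Rp ^ d" using kappa_pos Rp_bounds by simp
    show "0 \<le> Rp ^ d" by (rule zero_le_power) (use Rp_bounds(1) in linarith)
  qed (use kappa_pos in auto)
  also have "\<dots> = (2 ^ d * 2 ^ d) * (\<kappa> * h ^ d)" by (simp add: power_mult_distrib)
  also have "(2 ^ d * 2 ^ d :: real) = 4 ^ d" by (simp flip: power_mult_distrib)
  finally show ?thesis .
qed

lemma measure_N_ge: "\<kappa> * h ^ d \<le> 4 ^ d * measure \<mu> N"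
proof -
  have "h ^ d \<le> (4 * Rm) ^ d" by (rule power_mono) (use Rm_bounds h_pos in auto)
  then have "\<kappa> * h ^ d \<le> \<kappa> * (4 * Rm) ^ d" using kappa_pos by (intro mult_left_mono) auto
  also have "\<dots> = 4 ^ d * (\<kappa> * Rm ^ d)" by (simp only: power_mult_distrib mult_ac)
  also have "\<kappa> * Rm ^ d \<le> measure \<mu> N"
    using emeasure_N_bounds(1) finite_N by (simp add: emeasure_eq_ennreal_measure)
  finally show ?thesis by simp
qed

end

section \<open>Bias of the local mean\<close>

locale manifold_model = reach_manifold +
  fixes fmin fmax L :: real and D :: "fsv measure" and f :: "fsv \<Rightarrow> real"
  assumes d_pos: "1 \<le> d" and prob: "prob_space D"
    and D_eq: "D = density (hausdorff_measure d) (\<lambda>x. ennreal (indicator M x * f x))"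
    and fmin_pos: "0 < fmin" and f_bounds: "\<And>x. x \<in> M \<Longrightarrow> fmin \<le> f x \<and> f x \<le> fmax"
    and f_lip: "L-lipschitz_on M f"
begin

definition g :: "fsv \<Rightarrow> real" where "g x = indicator M x * f x"

lemma closed_M: "closed M"
  by (rule compact_imp_closed[OF compact_M])

lemma borel_M: "M \<in> sets borel"
  by (rule borel_closed[OF closed_M])

lemma borel_g: "g \<in> borel_measurable borel"
  using borel_measurable_continuous_on_indicator[OF borel_M lipschitz_on_continuous_on[OF f_lip]]
  by (simp add: g_def[abs_def])

lemma g_bounds: "0 \<le> g x" "g x \<le> fmax * indicator M x" "fmin * indicator M x \<le> g x"
  using f_bounds[of x] fmin_pos by (auto simp: g_def indicator_def)

lemma fmax_ge: "fmin \<le> fmax"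
proof -
  obtain x where "x \<in> M" using nonempty_M by blast
  from f_bounds[OF this] show ?thesis by linarith
qed

lemma D_g: "D = density (hausdorff_measure d) (\<lambda>x. ennreal (g x))"
  using D_eq by (simp add: g_def[abs_def])

lemma nn_integral_g: "(\<integral>\<^sup>+x. ennreal (g x) \<partial>hausdorff_measure d) = 1"
proof -
  have "emeasure D (space D) = 1" using prob_space.emeasure_space_1[OF prob] .
  then show ?thesis
    unfolding D_g using borel_g by (simp add: emeasure_density)
qed

text \<open>A zero measure, in particular the degenerate value of \<open>measure_of\<close>, would
  have no density of total mass 1. The model itself thus guarantees that the Hausdorff measure is
  the intended one.\<close>

lemma nonzero_hausdorff: "emeasure (hausdorff_measure d) UNIV \<noteq> 0"
proof
  assume "emeasure (hausdorff_measure d) UNIV = 0"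
  then have "AE x in hausdorff_measure d. ennreal (g x) = 0"
    by (intro AE_I[of _ _ UNIV]) auto
  then have "(\<integral>\<^sup>+x. ennreal (g x) \<partial>hausdorff_measure d) = 0"
    using borel_g by (subst nn_integral_0_iff_AE) auto
  then show False using nn_integral_g by simp
qed

lemma finite_hausdorff: "emeasure (hausdorff_measure d) M < \<infinity>"
proof -
  have "ennreal fmin * emeasure (hausdorff_measure d) M = (\<integral>\<^sup>+x. ennreal fmin * indicator M x \<partial>hausdorff_measure d)"
    using borel_M by (simp add: nn_integral_cmult_indicator)
  also have "\<dots> \<le> (\<integral>\<^sup>+x. ennreal (g x) \<partial>hausdorff_measure d)"
  proof (intro nn_integral_mono)
    fix x show "ennreal fmin * indicator M x \<le> ennreal (g x)"
      using f_bounds[of x] by (cases "x \<in> M") (auto simp: g_def intro: ennreal_leI)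
  qed
  also have "\<dots> = 1" by (rule nn_integral_g)
  finally have "ennreal fmin * emeasure (hausdorff_measure d) M < \<infinity>"
    by (rule le_less_trans) simp
  then show ?thesis using fmin_pos by (auto simp: ennreal_mult_less_top)
qed

lemma integral_D:
  assumes "q \<in> borel_measurable borel"
  shows "(\<integral>x. q x \<partial>D) = (\<integral>x. g x * q x \<partial>hausdorff_measure d)"
  unfolding D_g using assms borel_g g_bounds(1) by (subst integral_density) auto

end

locale local_model = manifold_model +
  fixes x0 p :: fsv and h :: real
  assumes p_in: "p \<in> M" and p_near: "\<And>y. y \<in> M \<Longrightarrow> norm (x0 - p) \<le> norm (x0 - y)"
    and h_gt: "0 < h" and h_le: "h \<le> \<rho> / 2240" and p_offset: "norm (x0 - p) \<le> h / 2"
begin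

sublocale local_measure n M \<rho> d x0 p h
  by unfold_locales (use d_pos p_in p_near h_gt h_le p_offset nonzero_hausdorff finite_hausdorff in auto)

definition mass :: real where "mass = (\<integral>x. indicator (cball x0 h) x \<partial>D)"

lemma integrable_bounded_on_N:
  fixes q :: "fsv \<Rightarrow> real"
  assumes "q \<in> borel_measurable borel" "\<And>x. \<bar>q x\<bar> \<le> c * indicator N x"
  shows "integrable \<mu> q"
proof (rule Bochner_Integration.integrable_bound)
  show "integrable \<mu> (\<lambda>x. c * indicator N x)"
    using finite_N borel_N by (intro integrable_mult_right integrable_real_indicator) auto
  show "q \<in> borel_measurable \<mu>" using assms(1) by (simp add: measurable_mu)
  show "AE x in \<mu>. norm (q x) \<le> norm (c * indicator N x)"
    using assms(2) by (intro AE_I2) (metis abs_ge_self order_trans real_norm_def)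
qed

lemma mass_eq: "mass = (\<integral>x. indicator N x * f x \<partial>\<mu>)"
proof -
  have "mass = (\<integral>x. g x * indicator (cball x0 h) x \<partial>\<mu>)"
    unfolding mass_def by (intro integral_D borel_measurable_indicator) auto
  also have "\<dots> = (\<integral>x. indicator N x * f x \<partial>\<mu>)"
    by (intro Bochner_Integration.integral_cong) (auto simp: g_def indicator_def)
  finally show ?thesis .
qed

lemma borel_Nf: "(\<lambda>x. indicator N x * f x) \<in> borel_measurable borel"
proof -
  have "continuous_on N f"
    by (rule continuous_on_subset[OF lipschitz_on_continuous_on[OF f_lip]]) auto
  from borel_measurable_continuous_on_indicator[OF borel_N this] show ?thesis by simp
qed

lemma f_abs_le: "x \<in> M \<Longrightarrow> \<bar>f x\<bar> \<le> fmax"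
  using f_bounds[of x] fmin_pos by auto

lemma integrable_Nf: "integrable \<mu> (\<lambda>x. indicator N x * f x)"
  by (rule integrable_bounded_on_N[OF borel_Nf, of fmax])
     (use f_abs_le in \<open>auto simp: indicator_def\<close>)

lemma integrable_N: "integrable \<mu> (\<lambda>x. indicator N x :: real)"
  using finite_N borel_N by (intro integrable_real_indicator) auto

lemma mass_ge: "fmin * measure \<mu> N \<le> mass"
proof -
  have "fmin * measure \<mu> N = (\<integral>x. fmin * indicator N x \<partial>\<mu>)" by simp
  also have "\<dots> \<le> mass"
    unfolding mass_eq
    by (intro integral_mono integrable_Nf integrable_mult_right integrable_N)
       (use f_bounds in \<open>auto simp: indicator_def\<close>)
  finally show ?thesis .
qed

text \<open>Here \<kappa> is traded for \<open>omega d\<close>. The base 8 collects the 2 of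
  \<open>kappa_ge\<close> and the 4 of \<open>measure_N_ge\<close>.\<close>

lemma mass_lower: "fmin * omega d * h ^ d \<le> 8 ^ d * mass"
proof -
  have "fmin * omega d * h ^ d \<le> fmin * (2 ^ d * \<kappa>) * h ^ d"
    using kappa_ge fmin_pos h_gt by (intro mult_right_mono mult_left_mono) (auto simp: field_simps)
  also have "\<dots> = 2 ^ d * fmin * (\<kappa> * h ^ d)" by (simp add: mult_ac)
  also have "\<dots> \<le> 2 ^ d * fmin * (4 ^ d * measure \<mu> N)"
    using measure_N_ge fmin_pos by (intro mult_left_mono) auto
  also have "\<dots> = (2 ^ d * 4 ^ d) * (fmin * measure \<mu> N)" by (simp only: mult_ac)
  also have "\<dots> \<le> (2 ^ d * 4 ^ d) * mass" using mass_ge by (intro mult_left_mono) auto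
  also have "(2 ^ d * 4 ^ d :: real) = 8 ^ d" by (simp flip: power_mult_distrib)
  finally show ?thesis .
qed

lemma mass_pos: "0 < mass"
proof -
  have "0 < fmin * omega d * h ^ d" using fmin_pos h_gt by (simp add: omega_def)
  then have "0 < 8 ^ d * mass" using mass_lower by linarith
  then show ?thesis by (simp add: zero_less_mult_iff)
qed

lemma kappa_h_le: "\<kappa> * h ^ d \<le> 4 ^ d * (mass / fmin)"
proof -
  have "measure \<mu> N \<le> mass / fmin" using mass_ge fmin_pos by (simp add: field_simps)
  then have "4 ^ d * measure \<mu> N \<le> 4 ^ d * (mass / fmin)" by (intro mult_left_mono) auto
  then show ?thesis using measure_N_ge by linarith
qed

text \<open>Split x - p into normal and tangential part, and f into f - f p and f p. The normal part
  is at most 4 h^2 / \<rho> (\<open>A\<close>); the variation of f times the tangential part is at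
  most L 2 h times 2 h (\<open>B\<close>); the constant density against the tangential part is the
  nearly symmetric first moment (\<open>C\<close>). The constant 260 is 4 + 256.\<close>

lemma local_mean_bias:
  "\<bar>\<integral>x. indicator (cball x0 h) x * inner (x - p) \<theta> \<partial>D\<bar> \<le>
     norm \<theta> * mass * (h\<^sup>2 / \<rho>) * (260 * 16 ^ d * ((fmax + L * \<rho>) / fmin))"
proof -
  have inner_m: "(\<lambda>w. inner w \<theta>) \<in> borel_measurable borel"
    by (intro borel_measurable_continuous_onI continuous_intros)
  have cont_nu: "continuous_on UNIV (\<lambda>x. inner ((x - p) - Pr x) \<theta>)"
    using continuous_Pr by (intro continuous_intros)
  define A where "A x = (indicator N x * f x) * inner ((x - p) - Pr x) \<theta>" for x
  define B where "B x = (indicator N x * f x - f p * indicator N x) * inner (Pr x) \<theta>" for x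
  define C where "C x = indicator N x * inner (Pr x) \<theta>" for x
  have m: "A \<in> borel_measurable borel" "B \<in> borel_measurable borel" "C \<in> borel_measurable borel"
    unfolding A_def B_def C_def
    by (intro borel_measurable_times borel_measurable_diff borel_Nf borel_measurable_indicator borel_N
        borel_measurable_const measurable_compose[OF borel_Pr inner_m]
        borel_measurable_continuous_onI[OF cont_nu])+
  have Pr_le: "norm (Pr x) \<le> 2 * h" if "x \<in> N" for x
  proof -
    have "Pr x \<in> Dsc Rp" using Pr_N_subset that by blast
    then have "norm (Pr x) \<le> Rp" by (simp add: disc_def)
    then show ?thesis using Rp_bounds(2) by linarith
  qed
  have nu_le: "norm ((x - p) - Pr x) \<le> 4 * (h\<^sup>2 / \<rho>)" if "x \<in> N" for x
  proof -
    have "\<rho> * norm ((x - p) - Pr x) \<le> (norm (x - p))\<^sup>2"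
      using tangent_deviation[OF p, of x] that by (auto simp: Pr_def)
    also have "\<dots> \<le> (2 * h)\<^sup>2" using N_near[OF that] by (intro power_mono) auto
    finally show ?thesis using rho_pos by (simp add: field_simps power_mult_distrib)
  qed
  have A_le: "\<bar>A x\<bar> \<le> 4 * (h\<^sup>2 / \<rho>) * norm \<theta> * (indicator N x * f x)" for x
  proof (cases "x \<in> N")
    case True
    have "\<bar>inner ((x - p) - Pr x) \<theta>\<bar> \<le> norm ((x - p) - Pr x) * norm \<theta>" by (rule Cauchy_Schwarz_ineq2)
    also have "\<dots> \<le> 4 * (h\<^sup>2 / \<rho>) * norm \<theta>" by (intro mult_right_mono nu_le True) auto
    finally have "f x * \<bar>inner ((x - p) - Pr x) \<theta>\<bar> \<le> f x * (4 * (h\<^sup>2 / \<rho>) * norm \<theta>)"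
      using f_bounds[of x] fmin_pos True by (intro mult_left_mono) auto
    then show ?thesis using True f_bounds[of x] fmin_pos by (simp add: A_def abs_mult mult_ac)
  qed (simp add: A_def)
  have L0: "0 \<le> L" using lipschitz_on_nonneg[OF f_lip] .
  have B_le: "\<bar>B x\<bar> \<le> 4 * L * h\<^sup>2 * norm \<theta> * indicator N x" for x
  proof (cases "x \<in> N")
    case True
    have "\<bar>f x - f p\<bar> \<le> L * norm (x - p)"
      using lipschitz_onD[OF f_lip, of x p] True p by (simp add: dist_norm)
    also have "\<dots> \<le> L * (2 * h)" using N_near[OF True] L0 by (intro mult_left_mono) auto
    finally have 1: "\<bar>f x - f p\<bar> \<le> L * (2 * h)" .
    have "\<bar>inner (Pr x) \<theta>\<bar> \<le> norm (Pr x) * norm \<theta>" by (rule Cauchy_Schwarz_ineq2)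
    also have "\<dots> \<le> 2 * h * norm \<theta>" by (intro mult_right_mono Pr_le True) auto
    finally have "\<bar>f x - f p\<bar> * \<bar>inner (Pr x) \<theta>\<bar> \<le> (L * (2 * h)) * (2 * h * norm \<theta>)"
      using 1 L0 h_gt by (intro mult_mono) auto
    then show ?thesis using True by (simp add: B_def abs_mult power2_eq_square mult_ac)
  qed (simp add: B_def)
  have fm: "0 \<le> fmax" using fmax_ge fmin_pos by simp
  have intA: "integrable \<mu> A"
  proof (rule integrable_bounded_on_N[OF m(1), of "4 * (h\<^sup>2 / \<rho>) * norm \<theta> * fmax"])
    fix x
    have "4 * (h\<^sup>2 / \<rho>) * norm \<theta> * (indicator N x * f x) \<le> 4 * (h\<^sup>2 / \<rho>) * norm \<theta> * (fmax * indicator N x)"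
      using f_bounds[of x] rho_pos by (intro mult_left_mono) (auto simp: indicator_def)
    then show "\<bar>A x\<bar> \<le> 4 * (h\<^sup>2 / \<rho>) * norm \<theta> * fmax * indicator N x" using A_le[of x] by (simp add: mult.assoc)
  qed
  have intB: "integrable \<mu> B" by (rule integrable_bounded_on_N[OF m(2) B_le])
  have intC: "integrable \<mu> C"
  proof (rule integrable_bounded_on_N[OF m(3), of "2 * h * norm \<theta>"])
    fix x
    have "\<bar>inner (Pr x) \<theta>\<bar> \<le> norm (Pr x) * norm \<theta>" by (rule Cauchy_Schwarz_ineq2)
    moreover have "norm (Pr x) * norm \<theta> \<le> 2 * h * norm \<theta>" if "x \<in> N" using Pr_le[OF that] by (intro mult_right_mono) auto
    ultimately show "\<bar>C x\<bar> \<le> 2 * h * norm \<theta> * indicator N x" by (cases "x \<in> N") (auto simp: C_def)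
  qed
  have "(\<integral>x. indicator (cball x0 h) x * inner (x - p) \<theta> \<partial>D) = (\<integral>x. g x * (indicator (cball x0 h) x * inner (x - p) \<theta>) \<partial>\<mu>)"
    by (intro integral_D borel_measurable_times borel_measurable_indicator borel_measurable_continuous_onI continuous_intros) auto
  also have "\<dots> = (\<integral>x. A x + B x + f p * C x \<partial>\<mu>)"
    by (intro Bochner_Integration.integral_cong)
       (auto simp: A_def B_def C_def g_def indicator_def inner_diff_left algebra_simps)
  also have "\<dots> = (\<integral>x. A x \<partial>\<mu>) + (\<integral>x. B x \<partial>\<mu>) + f p * (\<integral>x. C x \<partial>\<mu>)"
    using intA intB intC by simp
  finally have eq: "(\<integral>x. indicator (cball x0 h) x * inner (x - p) \<theta> \<partial>D) = (\<integral>x. A x \<partial>\<mu>) + (\<integral>x. B x \<partial>\<mu>) + f p * (\<integral>x. C x \<partial>\<mu>)" .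
  define K where "K = h\<^sup>2 / \<rho> * norm \<theta> * mass"
  have K0: "0 \<le> K" using rho_pos mass_pos by (simp add: K_def)
  have "\<bar>\<integral>x. A x \<partial>\<mu>\<bar> \<le> (\<integral>x. \<bar>A x\<bar> \<partial>\<mu>)" by (rule integral_abs_bound)
  also have "\<dots> \<le> (\<integral>x. 4 * (h\<^sup>2 / \<rho>) * norm \<theta> * (indicator N x * f x) \<partial>\<mu>)"
    by (intro integral_mono A_le integrable_abs intA integrable_mult_right integrable_Nf)
  also have "\<dots> = 4 * K" by (simp add: mass_eq K_def)
  finally have bA: "\<bar>\<integral>x. A x \<partial>\<mu>\<bar> \<le> 4 * K" .
  have kh: "\<kappa> * h ^ d \<le> 4 ^ d * (mass / fmin)" by (rule kappa_h_le)
  have "measure \<mu> N \<le> 4 ^ d * (4 ^ d * (mass / fmin))"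
    by (rule order_trans[OF measure_N_le]) (intro mult_left_mono kh, simp)
  also have "\<dots> = 16 ^ d * (mass / fmin)" by (simp add: mult.assoc[symmetric] flip: power_mult_distrib)
  finally have mN: "measure \<mu> N \<le> 16 ^ d * (mass / fmin)" .
  have "\<bar>\<integral>x. B x \<partial>\<mu>\<bar> \<le> (\<integral>x. \<bar>B x\<bar> \<partial>\<mu>)" by (rule integral_abs_bound)
  also have "\<dots> \<le> (\<integral>x. 4 * L * h\<^sup>2 * norm \<theta> * indicator N x \<partial>\<mu>)"
    by (intro integral_mono B_le integrable_abs intB integrable_mult_right integrable_N)
  also have "\<dots> = 4 * L * h\<^sup>2 * norm \<theta> * measure \<mu> N" by simp
  also have "\<dots> \<le> 4 * L * h\<^sup>2 * norm \<theta> * (16 ^ d * (mass / fmin))"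
    using L0 by (intro mult_left_mono mN) auto
  also have "\<dots> = 4 * 16 ^ d * K * (L * \<rho> / fmin)" using rho_pos by (simp add: K_def)
  finally have bB: "\<bar>\<integral>x. B x \<partial>\<mu>\<bar> \<le> 4 * 16 ^ d * K * (L * \<rho> / fmin)" .
  have "\<bar>\<integral>x. C x \<partial>\<mu>\<bar> \<le> 256 * 4 ^ d * norm \<theta> * (h\<^sup>2 / \<rho>) * (\<kappa> * h ^ d)"
    unfolding C_def by (rule tangential_bound)
  also have "\<dots> \<le> 256 * 4 ^ d * norm \<theta> * (h\<^sup>2 / \<rho>) * (4 ^ d * (mass / fmin))"
    using rho_pos by (intro mult_left_mono kh) auto
  also have "\<dots> = 256 * (4 ^ d * 4 ^ d) * K / fmin" by (simp add: K_def)
  also have "(4 ^ d * 4 ^ d :: real) = 16 ^ d" by (simp flip: power_mult_distrib)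
  finally have bC: "\<bar>\<integral>x. C x \<partial>\<mu>\<bar> \<le> 256 * 16 ^ d * K / fmin" .
  have "\<bar>f p\<bar> * \<bar>\<integral>x. C x \<partial>\<mu>\<bar> \<le> fmax * (256 * 16 ^ d * K / fmin)"
    using bC f_abs_le[OF p] fm by (intro mult_mono) auto
  then have bC': "\<bar>f p * (\<integral>x. C x \<partial>\<mu>)\<bar> \<le> 256 * 16 ^ d * K * (fmax / fmin)" by (simp add: abs_mult mult_ac)
  \<comment> \<open>Brings the bound for \<open>A\<close> into the form of the other two.\<close>
  have "1 * 1 \<le> 16 ^ d * (fmax / fmin)" using fmax_ge fmin_pos by (intro mult_mono) (auto simp: one_le_power)
  then have "4 * K * 1 \<le> 4 * K * (16 ^ d * (fmax / fmin))" using K0 by (intro mult_left_mono) auto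
  then have bA': "4 * K \<le> 4 * 16 ^ d * K * (fmax / fmin)" by (simp add: mult_ac)
  define X where "X = 16 ^ d * K * (fmax / fmin)"
  define Y where "Y = 16 ^ d * K * (L * \<rho> / fmin)"
  have Y0: "0 \<le> Y" using K0 L0 rho_pos fmin_pos by (simp add: Y_def)
  have "\<bar>\<integral>x. A x \<partial>\<mu>\<bar> \<le> 4 * X" "\<bar>\<integral>x. B x \<partial>\<mu>\<bar> \<le> 4 * Y" "\<bar>f p * (\<integral>x. C x \<partial>\<mu>)\<bar> \<le> 256 * X"
    using order_trans[OF bA bA'] bB bC' by (simp_all add: X_def Y_def mult.assoc)
  moreover have "\<bar>a + b + c\<bar> \<le> 260 * (X + Y)" if "\<bar>a\<bar> \<le> 4 * X" "\<bar>b\<bar> \<le> 4 * Y" "\<bar>c\<bar> \<le> 256 * X" for a b c :: real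
    using that Y0 by (auto simp: abs_le_iff)
  ultimately have "\<bar>\<integral>x. indicator (cball x0 h) x * inner (x - p) \<theta> \<partial>D\<bar> \<le> 260 * (X + Y)"
    unfolding eq by blast
  also have "\<dots> = norm \<theta> * mass * (h\<^sup>2 / \<rho>) * (260 * 16 ^ d * ((fmax + L * \<rho>) / fmin))"
    by (simp add: X_def Y_def K_def add_divide_distrib algebra_simps)
  finally show ?thesis .
qed

end

section \<open>The statistical query algorithm\<close>

text \<open>The first ball of the list containing the point decides, so each piece is a Borel set
  and the selected coefficients are constant on it.\<close>

primrec net_select :: "(fsv \<Rightarrow> nat \<Rightarrow> real) \<Rightarrow> real \<Rightarrow> fsv list \<Rightarrow> nat \<Rightarrow> fsv \<Rightarrow> real" where
  "net_select c \<eta> [] j x = 0"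
| "net_select c \<eta> (y # ys) j x = (if x \<in> ball y \<eta> then c y j else net_select c \<eta> ys j x)"

lemma net_select_measurable: "net_select c \<eta> ys j \<in> borel_measurable borel"
proof (induction ys)
  case Nil
  show ?case by (simp add: net_select.simps(1)[abs_def])
next
  case (Cons y ys)
  have "{x \<in> space borel. x \<in> ball y \<eta>} = ball y \<eta>" by auto
  then have "{x \<in> space borel. x \<in> ball y \<eta>} \<in> sets (borel :: fsv measure)"
    using borel_open[OF open_ball] by simp
  then have "(\<lambda>x. if x \<in> ball y \<eta> then c y j else net_select c \<eta> ys j x) \<in> borel_measurable borel"
    using Cons by (intro measurable_If) auto
  then show ?case by (simp add: net_select.simps(2)[abs_def])
qed

lemma net_select_hit:
  "x \<in> (\<Union>y\<in>set ys. ball y \<eta>) \<Longrightarrow> \<exists>y\<in>set ys. x \<in> ball y \<eta> \<and> (\<forall>j. net_select c \<eta> ys j x = c y j)"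
  by (induction ys) auto

lemma net_select_abs_le:
  assumes "\<And>y j. y \<in> set ys \<Longrightarrow> \<bar>c y j\<bar> \<le> 1"
  shows "\<bar>net_select c \<eta> ys j x\<bar> \<le> 1"
  using assms by (induction ys) auto

text \<open>Exact Kashin coefficients need not depend measurably on the point; replacing the point by a
  nearby element of a finite net makes them simple functions.\<close>

lemma measurable_kashin_coefficients:
  assumes rep: "\<And>x. x \<in> Rn n \<Longrightarrow> norm x \<le> 1 \<Longrightarrow> \<exists>a. (\<forall>j. \<bar>a j\<bar> \<le> 1) \<and> x = (\<Sum>j<N. a j *\<^sub>R u j)"
    and \<eta>: "0 < \<eta>"
  shows "\<exists>a :: nat \<Rightarrow> fsv \<Rightarrow> real. (\<forall>j. a j \<in> borel_measurable borel) \<and> (\<forall>j x. \<bar>a j x\<bar> \<le> 1) \<and>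
    (\<forall>x\<in>Rn n. norm x \<le> 1 \<longrightarrow> norm (x - (\<Sum>j<N. a j x *\<^sub>R u j)) \<le> \<eta>)"
proof -
  let ?S = "cball 0 1 \<inter> Rn n"
  obtain c where c: "\<And>y j. y \<in> ?S \<Longrightarrow> \<bar>c y j\<bar> \<le> 1" "\<And>y. y \<in> ?S \<Longrightarrow> y = (\<Sum>j<N. c y j *\<^sub>R u j)"
  proof -
    have "\<forall>y. \<exists>a. y \<in> ?S \<longrightarrow> (\<forall>j. \<bar>a j\<bar> \<le> 1) \<and> y = (\<Sum>j<N. a j *\<^sub>R u j)" using rep by auto
    then obtain c where "\<forall>y. y \<in> ?S \<longrightarrow> (\<forall>j. \<bar>c y j\<bar> \<le> 1) \<and> y = (\<Sum>j<N. c y j *\<^sub>R u j)" by metis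
    then show ?thesis using that by blast
  qed
  obtain Y where Y: "finite Y" "Y \<subseteq> ?S" "?S \<subseteq> (\<Union>y\<in>Y. ball y \<eta>)"
  proof -
    have sub: "?S \<subseteq> (\<Union>y\<in>?S. ball y \<eta>)" using \<eta> by auto
    obtain Y where "Y \<subseteq> ?S" "finite Y" "?S \<subseteq> (\<Union>y\<in>Y. ball y \<eta>)"
      by (rule compactE_image[OF compact_cball_Rn _ sub]) (rule open_ball)
    then show ?thesis by (intro that)
  qed
  obtain ys where ys: "set ys = Y" using finite_list[OF Y(1)] by blast
  define a where "a j x = net_select c \<eta> ys j x" for j x
  have "norm (x - (\<Sum>j<N. a j x *\<^sub>R u j)) \<le> \<eta>" if "x \<in> Rn n" "norm x \<le> 1" for x
  proof -
    have "x \<in> ?S" using that by simp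
    then have "x \<in> (\<Union>y\<in>set ys. ball y \<eta>)" unfolding ys using Y(3) by blast
    then obtain y where y: "y \<in> Y" "x \<in> ball y \<eta>" "\<And>j. a j x = c y j"
      using net_select_hit[where x=x and ys=ys and \<eta>=\<eta> and c=c] ys unfolding a_def by blast
    have "y \<in> ?S" using y(1) Y(2) by blast
    then have "(\<Sum>j<N. a j x *\<^sub>R u j) = y" unfolding y(3) using c(2)[of y] by simp
    then show ?thesis using y(2) by (simp add: dist_norm norm_minus_commute)
  qed
  moreover have "a j \<in> borel_measurable borel" for j
    using net_select_measurable[of c \<eta> ys j] by (simp add: a_def[abs_def])
  moreover have "\<bar>a j x\<bar> \<le> 1" for j x
    unfolding a_def by (rule net_select_abs_le, rule c(1)) (use ys Y(2) in blast)
  ultimately show ?thesis by blast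
qed

text \<open>Rescaling the ball to the unit ball makes the j-th Kashin coefficient an admissible
  query. Its expectations are the coefficients of the unnormalised first moment around
  \<open>x0\<close>, divided by h, up to the net error.\<close>

definition ball_query :: "fsv \<Rightarrow> real \<Rightarrow> (nat \<Rightarrow> fsv \<Rightarrow> real) \<Rightarrow> nat \<Rightarrow> fsv \<Rightarrow> real" where
  "ball_query x0 h a j x = indicator (cball x0 h) x * a j ((x - x0) /\<^sub>R h)"

lemma ball_query_measurable:
  assumes "a j \<in> borel_measurable borel"
  shows "ball_query x0 h a j \<in> borel_measurable borel"
proof -
  have "(\<lambda>x. (x - x0) /\<^sub>R h) \<in> borel_measurable borel"
    by (intro borel_measurable_continuous_onI continuous_intros)
  from measurable_compose[OF this assms] show ?thesis
    unfolding ball_query_def[abs_def] by (intro borel_measurable_times borel_measurable_indicator) auto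
qed

lemma ball_query_abs_le: "(\<And>x. \<bar>a j x\<bar> \<le> 1) \<Longrightarrow> \<bar>ball_query x0 h a j x\<bar> \<le> 1"
  by (auto simp: ball_query_def indicator_def)

context local_model
begin

lemma sets_D: "sets D = sets borel"
  by (subst D_g) simp

lemma integrable_D:
  fixes q :: "fsv \<Rightarrow> real"
  assumes "q \<in> borel_measurable borel" "\<And>x. \<bar>q x\<bar> \<le> c"
  shows "integrable D q"
proof -
  interpret prob_space D by (rule prob)
  have "q \<in> borel_measurable D" using assms(1) measurable_cong_sets[OF sets_D refl] by blast
  then show ?thesis
    by (intro integrable_const_bound[of _ c]) (use assms(2) in auto)
qed

text \<open>Kashin representations exist only on \<open>Rn n\<close>, so pointwise estimates under
  the integral hold only almost everywhere.\<close>

lemma AE_in_M: "AE x in D. x \<in> M"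
proof -
  have "AE x in \<mu>. 0 < ennreal (g x) \<longrightarrow> x \<in> M" by (intro AE_I2) (auto simp: g_def indicator_def)
  then show ?thesis
    unfolding D_g using borel_g by (subst AE_density) (auto simp: measurable_mu)
qed

text \<open>The answer errors, divided by \<tau>, form one coefficient vector bounded by 1, to which
  the stability of the representation applies as a whole; this gives K without any dependence on the
  number of queries. The additional 1 is the net error \<tau> of the coefficients.\<close>

lemma kashin_mean_estimate:
  assumes x0: "x0 \<in> Rn n" and \<tau>: "0 < \<tau>" and a_meas: "\<And>j. a j \<in> borel_measurable borel"
    and a_le: "\<And>j x. \<bar>a j x\<bar> \<le> 1"
    and a_rep: "\<And>x. x \<in> Rn n \<Longrightarrow> norm x \<le> 1 \<Longrightarrow> norm (x - (\<Sum>j<m. a j x *\<^sub>R u j)) \<le> \<tau>"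
    and u_bound: "\<And>e. (\<forall>j<m. \<bar>e j\<bar> \<le> 1) \<Longrightarrow> norm (\<Sum>j<m. e j *\<^sub>R u j) \<le> K"
    and ans: "\<And>j. j < m \<Longrightarrow> \<bar>r j - (\<integral>x. ball_query x0 h a j x \<partial>D)\<bar> \<le> \<tau>"
  shows "\<bar>inner (h *\<^sub>R (\<Sum>j<m. r j *\<^sub>R u j)) \<theta> - (\<integral>x. indicator (cball x0 h) x * inner (x - x0) \<theta> \<partial>D)\<bar>
    \<le> (K + 1) * h * \<tau> * norm \<theta>"
proof -
  interpret prob_space D by (rule prob)
  let ?q = "\<lambda>j. ball_query x0 h a j"
  let ?E = "\<lambda>j. \<integral>x. ?q j x \<partial>D"
  define e where "e j = (r j - ?E j) / \<tau>" for j
  have e: "\<forall>j<m. \<bar>e j\<bar> \<le> 1" using ans \<tau> by (auto simp: e_def field_simps)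
  have r: "r j = ?E j + \<tau> * e j" for j using \<tau> by (simp add: e_def)
  have int_q: "integrable D (?q j)" for j
    by (rule integrable_D[OF ball_query_measurable[of a, OF a_meas] ball_query_abs_le[of a, OF a_le]])
  have sum_q: "(\<Sum>j<m. ?E j * inner (u j) \<theta>) = (\<integral>x. (\<Sum>j<m. ?q j x * inner (u j) \<theta>) \<partial>D)"
    using int_q by (simp add: Bochner_Integration.integral_sum)
  have "inner (h *\<^sub>R (\<Sum>j<m. r j *\<^sub>R u j)) \<theta> = h * (\<Sum>j<m. ?E j * inner (u j) \<theta>) + h * \<tau> * inner (\<Sum>j<m. e j *\<^sub>R u j) \<theta>"
    unfolding r
    by (simp add: inner_sum_left distrib_right sum.distrib distrib_left sum_distrib_left mult_ac)
  also have "h * (\<Sum>j<m. ?E j * inner (u j) \<theta>) = (\<integral>x. h * (\<Sum>j<m. ?q j x * inner (u j) \<theta>) \<partial>D)"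
    unfolding sum_q by simp
  finally have lhs: "inner (h *\<^sub>R (\<Sum>j<m. r j *\<^sub>R u j)) \<theta> =
      (\<integral>x. h * (\<Sum>j<m. ?q j x * inner (u j) \<theta>) \<partial>D) + h * \<tau> * inner (\<Sum>j<m. e j *\<^sub>R u j) \<theta>" .
  have int1: "integrable D (\<lambda>x. h * (\<Sum>j<m. ?q j x * inner (u j) \<theta>))" using int_q by simp
  have int2: "integrable D (\<lambda>x. indicator (cball x0 h) x * inner (x - x0) \<theta>)"
  proof (rule integrable_D[of _ "h * norm \<theta>"])
    fix x show "\<bar>indicator (cball x0 h) x * inner (x - x0) \<theta>\<bar> \<le> h * norm \<theta>"
    proof (cases "x \<in> cball x0 h")
      case True
      have "\<bar>inner (x - x0) \<theta>\<bar> \<le> norm (x - x0) * norm \<theta>" by (rule Cauchy_Schwarz_ineq2)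
      also have "\<dots> \<le> h * norm \<theta>" using True by (intro mult_right_mono) (auto simp: dist_norm norm_minus_commute)
      finally show ?thesis using True by simp
    qed (use h_gt in simp)
  qed (intro borel_measurable_times borel_measurable_indicator borel_measurable_continuous_onI continuous_intros, simp)
  have pt: "\<bar>h * (\<Sum>j<m. ?q j x * inner (u j) \<theta>) - indicator (cball x0 h) x * inner (x - x0) \<theta>\<bar> \<le> h * \<tau> * norm \<theta>"
    if "x \<in> M" for x
  proof (cases "x \<in> cball x0 h")
    case True
    let ?y = "(x - x0) /\<^sub>R h"
    have yR: "?y \<in> Rn n" using x0 M_in_Rn[OF that] by auto
    have "norm (x - x0) \<le> h" using True by (simp add: dist_norm norm_minus_commute)
    then have "norm ?y \<le> 1" unfolding norm_scaleR using h_gt by (simp add: field_simps)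
    from a_rep[OF yR this] have w: "norm (?y - (\<Sum>j<m. a j ?y *\<^sub>R u j)) \<le> \<tau>" .
    have "h * (\<Sum>j<m. ?q j x * inner (u j) \<theta>) - indicator (cball x0 h) x * inner (x - x0) \<theta>
        = - (h * inner (?y - (\<Sum>j<m. a j ?y *\<^sub>R u j)) \<theta>)"
    proof -
      have hy: "h * inner ?y \<theta> = inner (x - x0) \<theta>"
        using h_gt unfolding inner_scaleR_left by simp
      have "- (h * inner (?y - (\<Sum>j<m. a j ?y *\<^sub>R u j)) \<theta>) = h * inner (\<Sum>j<m. a j ?y *\<^sub>R u j) \<theta> - h * inner ?y \<theta>"
        unfolding inner_diff_left[of ?y] by (simp only: right_diff_distrib minus_diff_eq)
      also have "\<dots> = h * (\<Sum>j<m. a j ?y * inner (u j) \<theta>) - inner (x - x0) \<theta>"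
        using hy by (simp only: inner_sum_left inner_scaleR_left)
      finally show ?thesis using True by (simp add: ball_query_def)
    qed
    also have "\<bar>\<dots>\<bar> = h * \<bar>inner (?y - (\<Sum>j<m. a j ?y *\<^sub>R u j)) \<theta>\<bar>" using h_gt by (simp add: abs_mult)
    also have "\<dots> \<le> h * (norm (?y - (\<Sum>j<m. a j ?y *\<^sub>R u j)) * norm \<theta>)"
      using h_gt by (intro mult_left_mono Cauchy_Schwarz_ineq2) auto
    also have "\<dots> \<le> h * (\<tau> * norm \<theta>)" using w h_gt by (intro mult_left_mono mult_right_mono) auto
    finally show ?thesis by (simp add: mult.assoc)
  qed (use h_gt \<tau> in \<open>simp add: ball_query_def\<close>)
  have "\<bar>(\<integral>x. h * (\<Sum>j<m. ?q j x * inner (u j) \<theta>) \<partial>D) - (\<integral>x. indicator (cball x0 h) x * inner (x - x0) \<theta> \<partial>D)\<bar>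
      = \<bar>\<integral>x. h * (\<Sum>j<m. ?q j x * inner (u j) \<theta>) - indicator (cball x0 h) x * inner (x - x0) \<theta> \<partial>D\<bar>"
    using int1 int2 by simp
  also have "\<dots> \<le> (\<integral>x. \<bar>h * (\<Sum>j<m. ?q j x * inner (u j) \<theta>) - indicator (cball x0 h) x * inner (x - x0) \<theta>\<bar> \<partial>D)"
    by (rule integral_abs_bound)
  also have "\<dots> \<le> (\<integral>x. h * \<tau> * norm \<theta> \<partial>D)"
    using AE_in_M pt int1 int2 by (intro integral_mono_AE) auto
  also have "\<dots> = h * \<tau> * norm \<theta>" by (simp add: prob_space)
  finally have 1: "\<bar>(\<integral>x. h * (\<Sum>j<m. ?q j x * inner (u j) \<theta>) \<partial>D) - (\<integral>x. indicator (cball x0 h) x * inner (x - x0) \<theta> \<partial>D)\<bar> \<le> h * \<tau> * norm \<theta>" .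
  have "\<bar>inner (\<Sum>j<m. e j *\<^sub>R u j) \<theta>\<bar> \<le> norm (\<Sum>j<m. e j *\<^sub>R u j) * norm \<theta>" by (rule Cauchy_Schwarz_ineq2)
  also have "\<dots> \<le> K * norm \<theta>" using u_bound[OF e] by (intro mult_right_mono) auto
  finally have "h * \<tau> * \<bar>inner (\<Sum>j<m. e j *\<^sub>R u j) \<theta>\<bar> \<le> h * \<tau> * (K * norm \<theta>)"
    using h_gt \<tau> by (intro mult_left_mono) auto
  then have 2: "\<bar>h * \<tau> * inner (\<Sum>j<m. e j *\<^sub>R u j) \<theta>\<bar> \<le> h * \<tau> * (K * norm \<theta>)"
    using h_gt \<tau> by (simp add: abs_mult)
  have "(K + 1) * h * \<tau> * norm \<theta> = h * \<tau> * norm \<theta> + h * \<tau> * (K * norm \<theta>)" by (simp add: algebra_simps)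
  then show ?thesis unfolding lhs using 1 2 by linarith
qed

text \<open>The scalar estimates are tested against \<theta> equal to the error vector itself, which
  turns them into a bound on its norm. Since moments are centred at \<open>x0\<close>, the error of
  the mass is multiplied only by |x0 - p| \<le> h and raises K + 1 to K + 2. Dividing by s is safe
  because \<tau> \<le> mass / 2 leaves s \<ge> mass / 2.\<close>

lemma projection_estimate:
  assumes x0: "x0 \<in> Rn n" and \<tau>: "0 < \<tau>" "\<tau> \<le> mass / 2" and K: "0 \<le> K"
    and est: "\<And>\<theta>. \<bar>inner v \<theta> - (\<integral>x. indicator (cball x0 h) x * inner (x - x0) \<theta> \<partial>D)\<bar> \<le> (K + 1) * h * \<tau> * norm \<theta>"
    and s: "\<bar>s - mass\<bar> \<le> \<tau>"
  shows "norm (x0 + (1 / s) *\<^sub>R v - p) \<le> 2 * (K + 2) * h * (\<tau> / mass) + 2 * ((h\<^sup>2 / \<rho>) * (260 * 16 ^ d * ((fmax + L * \<rho>) / fmin)))"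
proof -
  define \<theta> where "\<theta> = x0 + (1 / s) *\<^sub>R v - p"
  define b where "b = (h\<^sup>2 / \<rho>) * (260 * 16 ^ d * ((fmax + L * \<rho>) / fmin))"
  have s_pos: "mass / 2 \<le> s" "0 < s" using s \<tau> mass_pos by (auto simp: abs_le_iff)
  have int_ind: "integrable D (\<lambda>x. indicator (cball x0 h) x :: real)"
    by (intro integrable_D[of _ 1] borel_measurable_indicator) (auto simp: indicator_def)
  have int_p: "integrable D (\<lambda>x. indicator (cball x0 h) x * inner (x - p) \<theta>)"
  proof (rule integrable_D[of _ "2 * h * norm \<theta>"])
    fix x show "\<bar>indicator (cball x0 h) x * inner (x - p) \<theta>\<bar> \<le> 2 * h * norm \<theta>"
    proof (cases "x \<in> cball x0 h")
      case True
      have "\<bar>inner (x - p) \<theta>\<bar> \<le> norm (x - p) * norm \<theta>" by (rule Cauchy_Schwarz_ineq2)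
      also have "norm (x - p) \<le> 2 * h"
        using norm_triangle_ineq[of "x - x0" "x0 - p"] True p_offset h_gt by (auto simp: dist_norm norm_minus_commute)
      finally show ?thesis using True by (simp add: mult_right_mono)
    qed (use h_gt in simp)
  qed (intro borel_measurable_times borel_measurable_indicator borel_measurable_continuous_onI continuous_intros, simp)
  have "(\<integral>x. indicator (cball x0 h) x * inner (x - x0) \<theta> \<partial>D) =
      (\<integral>x. indicator (cball x0 h) x * inner (x - p) \<theta> + inner (p - x0) \<theta> * indicator (cball x0 h) x \<partial>D)"
    by (intro Bochner_Integration.integral_cong) (auto simp: inner_diff_left algebra_simps)
  also have "\<dots> = (\<integral>x. indicator (cball x0 h) x * inner (x - p) \<theta> \<partial>D) + inner (p - x0) \<theta> * mass"
    unfolding mass_def using int_p int_ind by simp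
  finally have split: "(\<integral>x. indicator (cball x0 h) x * inner (x - x0) \<theta> \<partial>D) =
      (\<integral>x. indicator (cball x0 h) x * inner (x - p) \<theta> \<partial>D) + inner (p - x0) \<theta> * mass" .
  have "s * (norm \<theta>)\<^sup>2 = s * inner (x0 - p) \<theta> + inner v \<theta>"
  proof -
    have "(norm \<theta>)\<^sup>2 = inner (x0 - p + (1 / s) *\<^sub>R v) \<theta>"
      unfolding power2_norm_eq_inner by (rule arg_cong[where f="\<lambda>w. inner w \<theta>"]) (simp add: \<theta>_def)
    then show ?thesis using s_pos by (simp add: inner_add_left distrib_left)
  qed
  also have "\<dots> \<le> s * inner (x0 - p) \<theta> + ((\<integral>x. indicator (cball x0 h) x * inner (x - p) \<theta> \<partial>D) + inner (p - x0) \<theta> * mass + (K + 1) * h * \<tau> * norm \<theta>)"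
    using est[of \<theta>] unfolding split by linarith
  also have "\<dots> = (s - mass) * inner (x0 - p) \<theta> + (\<integral>x. indicator (cball x0 h) x * inner (x - p) \<theta> \<partial>D) + (K + 1) * h * \<tau> * norm \<theta>"
    by (simp add: inner_diff_left algebra_simps)
  also have "(s - mass) * inner (x0 - p) \<theta> \<le> \<tau> * (h * norm \<theta>)"
  proof -
    have "\<bar>inner (x0 - p) \<theta>\<bar> \<le> norm (x0 - p) * norm \<theta>" by (rule Cauchy_Schwarz_ineq2)
    also have "\<dots> \<le> h * norm \<theta>" using p_offset h_gt by (intro mult_right_mono) auto
    finally have "\<bar>s - mass\<bar> * \<bar>inner (x0 - p) \<theta>\<bar> \<le> \<tau> * (h * norm \<theta>)" using s \<tau> by (intro mult_mono) auto
    then show ?thesis by (metis abs_ge_self abs_mult order_trans)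
  qed
  also have "(\<integral>x. indicator (cball x0 h) x * inner (x - p) \<theta> \<partial>D) \<le> norm \<theta> * mass * b"
    using local_mean_bias[of \<theta>] by (simp add: b_def mult.assoc abs_le_iff)
  finally have "s * (norm \<theta>)\<^sup>2 \<le> ((K + 2) * h * \<tau> + mass * b) * norm \<theta>" by (simp add: algebra_simps)
  then have "norm \<theta> * (s * norm \<theta>) \<le> norm \<theta> * ((K + 2) * h * \<tau> + mass * b)"
    by (simp add: power2_eq_square mult_ac)
  moreover have "0 \<le> (K + 2) * h * \<tau> + mass * b"
    using K h_gt \<tau> mass_pos rho_pos fmin_pos fmax_ge lipschitz_on_nonneg[OF f_lip] by (auto simp: b_def intro!: add_nonneg_nonneg mult_nonneg_nonneg divide_nonneg_nonneg)
  ultimately have "s * norm \<theta> \<le> (K + 2) * h * \<tau> + mass * b"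
    by (cases "norm \<theta> = 0") (auto simp: mult_le_cancel_left)
  moreover have "mass / 2 * norm \<theta> \<le> s * norm \<theta>" using s_pos by (intro mult_right_mono) auto
  ultimately have "mass / 2 * norm \<theta> \<le> (K + 2) * h * \<tau> + mass * b" by (rule order_trans[rotated])
  then have "2 * (mass / 2 * norm \<theta>) \<le> 2 * ((K + 2) * h * \<tau> + mass * b)" by (rule mult_left_mono) simp
  then have "mass * norm \<theta> \<le> 2 * ((K + 2) * h * \<tau> + mass * b)" by simp
  also have "\<dots> = mass * (2 * (K + 2) * h * (\<tau> / mass) + 2 * b)"
    using mass_pos by (simp add: field_simps)
  finally have "mass * norm \<theta> \<le> mass * (2 * (K + 2) * h * (\<tau> / mass) + 2 * b)" .
  then have "norm \<theta> \<le> 2 * (K + 2) * h * (\<tau> / mass) + 2 * b"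
    by (rule mult_left_le_imp_le[OF _ mass_pos])
  then show ?thesis unfolding \<theta>_def b_def .
qed

end

text \<open>The radius \<open>h\<close> balances the bias \<open>h\<^sup>2 / \<rho>\<close> of the local mean against the query noise
  \<open>h \<tau> / mass\<close>, and it has to dominate the distance \<open>\<Lambda>\<close> of \<open>x0\<close> to the manifold.\<close>

lemma projection_algorithm_error:
  assumes model: "in_model n d \<rho> fmin fmax L D M f"
    and d: "1 \<le> d" and \<rho>: "0 < \<rho>" and fmin: "0 < fmin" "fmin \<le> fmax" and L: "0 \<le> L" and \<tau>: "0 < \<tau>"
    and \<Gamma>: "\<Gamma> = fmin / (fmax + L * \<rho>)" and h0: "0 < h0" "h0 ^ (d + 1) = \<rho> ^ (d + 1) * (\<Gamma> * (\<tau> / (omega d * fmin * \<rho> ^ d)))"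
    and h: "h0 \<le> h" "2 * \<Lambda> \<le> h" "h \<le> (1/2240) ^ d * \<Gamma> * \<rho>"
    and x0: "x0 \<in> Rn n" "infdist x0 M \<le> \<Lambda>"
    and a_meas: "\<And>j. a j \<in> borel_measurable borel" and a_le: "\<And>j x. \<bar>a j x\<bar> \<le> 1"
    and a_rep: "\<And>x. x \<in> Rn n \<Longrightarrow> norm x \<le> 1 \<Longrightarrow> norm (x - (\<Sum>j<m. a j x *\<^sub>R u j)) \<le> \<tau>"
    and u_bound: "\<And>e. (\<forall>j<m. \<bar>e j\<bar> \<le> 1) \<Longrightarrow> norm (\<Sum>j<m. e j *\<^sub>R u j) \<le> 16200000"
    and ans: "\<And>j. j < m \<Longrightarrow> \<bar>r j - (\<integral>x. ball_query x0 h a j x \<partial>D)\<bar> \<le> \<tau>"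
    and s: "\<bar>s - (\<integral>x. indicator (cball x0 h) x \<partial>D)\<bar> \<le> \<tau>"
  shows "norm (x0 + (1 / s) *\<^sub>R (h *\<^sub>R (\<Sum>j<m. r j *\<^sub>R u j)) - proj M x0) \<le> 32400524 * 16 ^ d / \<Gamma> * (h\<^sup>2 / \<rho>)"
proof -
  have M: "M \<noteq> {}" "compact M" "C2_submanifold n d M" "ereal \<rho> \<le> reach n M"
    using model by (auto simp: in_model_def manifold_class_def)
  have "0 \<le> L * \<rho>" using L \<rho> by simp
  then have \<Gamma>pos: "0 < \<Gamma>" and \<Gamma>le: "\<Gamma> \<le> 1"
    using fmin unfolding \<Gamma> by auto
  interpret mm: manifold_model n M \<rho> d fmin fmax L D f
  proof -
    have "M \<subseteq> Rn n" using M(3) by (simp add: C2_submanifold_def)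
    then show "manifold_model n M \<rho> d fmin fmax L D f"
      using M model \<rho> d
      unfolding manifold_model_def manifold_model_axioms_def reach_manifold_def
        reach_manifold_axioms_def positive_reach_def in_model_def by blast
  qed
  let ?p = "proj M x0"
  have hpos: "0 < h" using h h0 by linarith
  have "(1/2240 :: real) ^ d \<le> (1/2240) ^ 1" using d by (intro power_decreasing) auto
  then have "(1/2240) ^ d * \<Gamma> * \<rho> \<le> 1/2240 * 1 * \<rho>"
    using \<Gamma>pos \<Gamma>le \<rho> by (intro mult_right_mono mult_mono) auto
  then have h_le: "h \<le> \<rho> / 2240" using h(3) by simp
  have pdist: "norm (x0 - ?p) = infdist x0 M"
    using mm.proj_nearest(2)[of x0] by (simp add: dist_norm norm_minus_commute)
  interpret lm: local_model n M \<rho> d fmin fmax L D f x0 ?p h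
  proof unfold_locales
    show "?p \<in> M" by (rule mm.proj_nearest)
    show "norm (x0 - ?p) \<le> norm (x0 - y)" if "y \<in> M" for y
      unfolding pdist by (rule mm.infdist_le_dist[OF that])
    show "norm (x0 - ?p) \<le> h / 2" unfolding pdist using x0(2) h(2) by simp
  qed (use hpos h_le in auto)
  have om: "0 < omega d" by (simp add: omega_def)
  \<comment> \<open>The defining equation of \<open>h0\<close>; with \<open>mass_lower\<close> it
    bounds the relative noise \<tau> / mass by a multiple of h / (\<Gamma> \<rho>), the same order
    as the bias over h.\<close>
  have "\<tau> * (\<Gamma> * \<rho>) = omega d * fmin * h0 ^ (d + 1)"
    unfolding h0(2) using om fmin \<rho> by (simp add: field_simps)
  also have "\<dots> \<le> omega d * fmin * h ^ (d + 1)"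
    using om fmin h h0 by (intro mult_left_mono power_mono) auto
  also have "\<dots> = fmin * omega d * h ^ d * h" by simp
  also have "\<dots> \<le> 8 ^ d * lm.mass * h" using lm.mass_lower hpos by (intro mult_right_mono) auto
  finally have "\<tau> * (\<Gamma> * \<rho>) \<le> (8 ^ d * h) * lm.mass" by (simp add: mult_ac)
  then have ratio: "\<tau> / lm.mass \<le> 8 ^ d * h / (\<Gamma> * \<rho>)"
    using lm.mass_pos \<Gamma>pos \<rho> by (simp add: field_simps)
  \<comment> \<open>The d-th power of 1/2240 in the cap on h outweighs the 8 ^ d lost in the mass,
    which yields \<tau> \<le> mass / 2.\<close>
  have "8 ^ d * h \<le> 8 ^ d * ((1/2240) ^ d * \<Gamma> * \<rho>)" using h(3) by (intro mult_left_mono) auto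
  also have "\<dots> = (8 * (1/2240)) ^ d * (\<Gamma> * \<rho>)" by (simp only: power_mult_distrib mult_ac)
  also have "\<dots> \<le> 1/2 * (\<Gamma> * \<rho>)"
  proof (rule mult_right_mono)
    have "(8 * (1/2240) :: real) ^ d \<le> (8 * (1/2240)) ^ 1" using d by (intro power_decreasing) auto
    then show "(8 * (1/2240) :: real) ^ d \<le> 1/2" by simp
  qed (use \<Gamma>pos \<rho> in simp)
  finally have "8 ^ d * h / (\<Gamma> * \<rho>) \<le> 1/2" using \<Gamma>pos \<rho> by (simp add: field_simps)
  then have "\<tau> / lm.mass \<le> 1/2" using ratio by linarith
  then have \<tau>le: "\<tau> \<le> lm.mass / 2" using lm.mass_pos by (simp add: field_simps)
  have "norm (x0 + (1 / s) *\<^sub>R (h *\<^sub>R (\<Sum>j<m. r j *\<^sub>R u j)) - ?p) \<le>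
      2 * (16200000 + 2) * h * (\<tau> / lm.mass) + 2 * ((h\<^sup>2 / \<rho>) * (260 * 16 ^ d * ((fmax + L * \<rho>) / fmin)))"
  proof (rule lm.projection_estimate[OF x0(1) \<tau> \<tau>le])
    show "\<bar>inner (h *\<^sub>R (\<Sum>j<m. r j *\<^sub>R u j)) \<theta> - (\<integral>x. indicator (cball x0 h) x * inner (x - x0) \<theta> \<partial>D)\<bar>
        \<le> (16200000 + 1) * h * \<tau> * norm \<theta>" for \<theta>
      by (rule lm.kashin_mean_estimate[OF x0(1) \<tau> a_meas a_le a_rep u_bound ans])
    show "\<bar>s - lm.mass\<bar> \<le> \<tau>" using s unfolding lm.mass_def .
  qed simp
  \<comment> \<open>Noise contributes 2 (16200000 + 2), bias 2 times 260; the noise base 8 is raised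
    to the 16 of the bias.\<close>
  also have "\<dots> \<le> 32400004 * 16 ^ d / \<Gamma> * (h\<^sup>2 / \<rho>) + 520 * 16 ^ d / \<Gamma> * (h\<^sup>2 / \<rho>)"
  proof (rule add_mono)
    have "2 * (16200000 + 2) * h * (\<tau> / lm.mass) \<le> 2 * (16200000 + 2) * h * (16 ^ d * h / (\<Gamma> * \<rho>))"
    proof (rule mult_left_mono)
      have "8 ^ d * h / (\<Gamma> * \<rho>) \<le> 16 ^ d * h / (\<Gamma> * \<rho>)"
        using hpos \<Gamma>pos \<rho> by (intro divide_right_mono mult_right_mono power_mono) auto
      then show "\<tau> / lm.mass \<le> 16 ^ d * h / (\<Gamma> * \<rho>)" using ratio by linarith
    qed (use hpos in simp)
    then show "2 * (16200000 + 2) * h * (\<tau> / lm.mass) \<le> 32400004 * 16 ^ d / \<Gamma> * (h\<^sup>2 / \<rho>)"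
      by (simp add: power2_eq_square mult_ac)
    show "2 * ((h\<^sup>2 / \<rho>) * (260 * 16 ^ d * ((fmax + L * \<rho>) / fmin))) \<le> 520 * 16 ^ d / \<Gamma> * (h\<^sup>2 / \<rho>)"
      by (simp add: \<Gamma> mult_ac)
  qed
  also have "\<dots> = 32400524 * 16 ^ d / \<Gamma> * (h\<^sup>2 / \<rho>)"
    by (simp add: add_divide_distrib[symmetric] distrib_right[symmetric])
  finally show ?thesis .
qed

text \<open>The length of the answer list only serves as the index of the query; the answers
  themselves are ignored. Index \<open>m\<close> asks for the mass, by which the output
  divides.\<close>

definition projection_query :: "nat \<Rightarrow> fsv \<Rightarrow> real \<Rightarrow> (nat \<Rightarrow> fsv \<Rightarrow> real) \<Rightarrow> real list \<Rightarrow> fsv \<Rightarrow> real" where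
  "projection_query m x0 h a as x = (if length as < m then ball_query x0 h a (length as) x else indicator (cball x0 h) x)"

definition projection_output :: "nat \<Rightarrow> fsv \<Rightarrow> real \<Rightarrow> (nat \<Rightarrow> fsv) \<Rightarrow> real list \<Rightarrow> fsv" where
  "projection_output m x0 h u as = x0 + (1 / as ! m) *\<^sub>R (h *\<^sub>R (\<Sum>j<m. (as ! j) *\<^sub>R u j))"

lemma SQ_projection_algorithm:
  assumes "\<And>j. a j \<in> borel_measurable borel" "\<And>j x. \<bar>a j x\<bar> \<le> 1" "x0 \<in> Rn n" "\<And>j. j < m \<Longrightarrow> u j \<in> Rn n"
  shows "SQ_algorithm n (projection_query m x0 h a) (projection_output m x0 h u)"
  unfolding SQ_algorithm_def
proof (intro conjI allI)
  fix as
  show "projection_query m x0 h a as \<in> borel_measurable borel"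
  proof (cases "length as < m")
    case True
    then show ?thesis
      using ball_query_measurable[of a "length as" x0 h] assms(1) by (simp add: projection_query_def[abs_def])
  next
    case False
    then show ?thesis
      by (simp add: projection_query_def[abs_def] borel_measurable_indicator)
  qed
  show "\<bar>projection_query m x0 h a as x\<bar> \<le> 1" for x
    using ball_query_abs_le[of a] assms(2) by (auto simp: projection_query_def indicator_def)
  show "projection_output m x0 h u as \<in> Rn n"
    unfolding projection_output_def using assms(3,4) by (intro Rn_intros Rn_sum) auto
qed

theorem theorem4p1:
  "\<exists>c C :: real. 0 < c \<and> 0 < C \<and>
    (\<forall>(n::nat) (d::nat) (rch::real) (fmin::real) (fmax::real) (L::real) (\<tau>::real) (\<Lambda>::real) x0.
      1 \<le> d \<longrightarrow> 0 < rch \<longrightarrow> 0 < fmin \<longrightarrow> fmin \<le> fmax \<longrightarrow> 0 \<le> L \<longrightarrow>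
      0 < \<tau> \<longrightarrow> 0 < \<Lambda> \<longrightarrow>
      (let \<Gamma> = fmin / (fmax + L * rch) in
        \<tau> / (omega d * fmin * rch ^ d) \<le> c ^ (d * (d + 1)) * \<Gamma> ^ d \<longrightarrow>
        \<Lambda> \<le> rch / 16 \<longrightarrow>
        x0 \<in> Rn n \<longrightarrow>
        (\<exists>Q out. SQ_algorithm n Q out \<and>
          (\<forall>D M f. in_model n d rch fmin fmax L D M f \<longrightarrow> infdist x0 M \<le> \<Lambda> \<longrightarrow>
            (\<forall>as. valid_answers (2 * n + 1) \<tau> D Q as \<longrightarrow>
              norm (out as - proj M x0) \<le>
                C ^ d / \<Gamma> * max (\<Lambda>\<^sup>2 / rch)
                  (\<Gamma> powr (2 / (real d + 1)) * rch *
                   (\<tau> / (omega d * fmin * rch ^ d)) powr (2 / (real d + 1))))))))"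
proof (rule exI[of _ "1/2240 :: real"], rule exI[of _ "10 ^ 10 :: real"], intro conjI allI impI)
  fix n d :: nat and \<rho> fmin fmax L \<tau> \<Lambda> :: real and x0 :: fsv
  assume d: "1 \<le> d" and \<rho>: "0 < \<rho>" and fmin: "0 < fmin" "fmin \<le> fmax" and L: "0 \<le> L"
    and \<tau>: "0 < \<tau>" and \<Lambda>: "0 < \<Lambda>"
  define \<Gamma> where "\<Gamma> = fmin / (fmax + L * \<rho>)"
  define \<tau>' where "\<tau>' = \<tau> / (omega d * fmin * \<rho> ^ d)"
  define B where "B = max (\<Lambda>\<^sup>2 / \<rho>) (\<Gamma> powr (2 / (real d + 1)) * \<rho> * \<tau>' powr (2 / (real d + 1)))"
  have om: "0 < omega d" by (simp add: omega_def)
  have \<Gamma>pos: "0 < \<Gamma>"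
    unfolding \<Gamma>_def using fmin L \<rho> by (intro divide_pos_pos add_pos_nonneg) auto
  have \<tau>'pos: "0 < \<tau>'" using \<tau> om fmin \<rho> by (simp add: \<tau>'_def)
  have B: "\<Lambda>\<^sup>2 / \<rho> \<le> B" "0 \<le> B" using \<rho> by (auto simp: B_def intro: order_trans[OF _ max.cobounded1])
  have main: "\<exists>Q out. SQ_algorithm n Q out \<and>
      (\<forall>D M f. in_model n d \<rho> fmin fmax L D M f \<longrightarrow> infdist x0 M \<le> \<Lambda> \<longrightarrow>
        (\<forall>as. valid_answers (2 * n + 1) \<tau> D Q as \<longrightarrow> norm (out as - proj M x0) \<le> (10 ^ 10) ^ d / \<Gamma> * B))"
    if small: "\<tau>' \<le> (1/2240) ^ (d * (d + 1)) * \<Gamma> ^ d" and x0: "x0 \<in> Rn n"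
  proof -
    have trivial_SQ: "SQ_algorithm n (\<lambda>_ _. 0) (\<lambda>_. x0)" using x0 by (simp add: SQ_algorithm_def)
    \<comment> \<open>Kashin's theorem needs n \<ge> 1, and \<open>Rn 0\<close> is a single point.
      In the second case \<Lambda> is itself bounded by a multiple of \<Lambda>^2 / (\<Gamma>
      \<rho>), so answering \<open>x0\<close> is good enough. Otherwise 2 \<Lambda> is an admissible
      radius.\<close>
    consider "n = 0" | "(1/2240) ^ d * \<Gamma> * \<rho> < 2 * \<Lambda>" | "1 \<le> n" "2 * \<Lambda> \<le> (1/2240) ^ d * \<Gamma> * \<rho>"
      by linarith
    then show ?thesis
    proof cases
      case 1
      have "norm (x0 - proj M x0) \<le> (10 ^ 10) ^ d / \<Gamma> * B" if model: "in_model n d \<rho> fmin fmax L D M f" for D M f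
      proof -
        interpret positive_reach n M \<rho>
          using model \<rho> by unfold_locales (auto simp: in_model_def manifold_class_def C2_submanifold_def)
        have "proj M x0 \<in> Rn 0" using M_in_Rn[OF proj_nearest(1)] 1 by simp
        then have "x0 = proj M x0" using x0 1 by (auto simp: Rn_def intro!: fsv_eqI)
        then have "x0 - proj M x0 = 0" by simp
        then show ?thesis using B \<Gamma>pos by (simp only: norm_zero) simp
      qed
      then show ?thesis using trivial_SQ by blast
    next
      case 2
      have "norm (x0 - proj M x0) \<le> (10 ^ 10) ^ d / \<Gamma> * B"
        if model: "in_model n d \<rho> fmin fmax L D M f" and near: "infdist x0 M \<le> \<Lambda>" for D M f
      proof -
        interpret positive_reach n M \<rho>
          using model \<rho> by unfold_locales (auto simp: in_model_def manifold_class_def C2_submanifold_def)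
        have "norm (x0 - proj M x0) \<le> \<Lambda>"
          using proj_nearest(2)[of x0] near by (simp add: dist_norm norm_minus_commute)
        also have "\<Lambda> \<le> (2 * 2240 ^ d) / \<Gamma> * (\<Lambda>\<^sup>2 / \<rho>)"
        proof -
          have "\<Gamma> * \<rho> \<le> 2240 ^ d * (2 * \<Lambda>)" using 2 by (simp add: power_divide field_simps)
          then have "\<Lambda> * (\<Gamma> * \<rho>) \<le> \<Lambda> * (2240 ^ d * (2 * \<Lambda>))" using \<Lambda> by (intro mult_left_mono) auto
          then show ?thesis using \<Gamma>pos \<rho> by (simp add: field_simps power2_eq_square)
        qed
        also have "\<dots> \<le> (10 ^ 10) ^ d / \<Gamma> * B"
        proof (intro mult_mono divide_right_mono B)
          have "2 * 2240 ^ d \<le> (2 * 2240 :: real) ^ d"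
            unfolding power_mult_distrib using d by (intro mult_right_mono) (auto simp: self_le_power)
          also have "\<dots> \<le> (10 ^ 10) ^ d" by (intro power_mono) auto
          finally show "2 * 2240 ^ d \<le> (10 ^ 10 :: real) ^ d" .
        qed (use \<Gamma>pos \<rho> in auto)
        finally show ?thesis .
      qed
      then show ?thesis using trivial_SQ by blast
    next
      case 3
      obtain u :: "nat \<Rightarrow> fsv" where u: "\<And>j. j < 2 * n \<Longrightarrow> u j \<in> Rn n"
          "\<And>x. x \<in> Rn n \<Longrightarrow> norm x \<le> 1 \<Longrightarrow> \<exists>a. (\<forall>j. \<bar>a j\<bar> \<le> 1) \<and> x = (\<Sum>j<2 * n. a j *\<^sub>R u j)"
          "\<And>e. (\<forall>j<2 * n. \<bar>e j\<bar> \<le> 1) \<Longrightarrow> norm (\<Sum>j<2 * n. e j *\<^sub>R u j) \<le> 16200000"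
        using kashin[OF 3(1)] by blast
      obtain a :: "nat \<Rightarrow> fsv \<Rightarrow> real" where a: "\<And>j. a j \<in> borel_measurable borel" "\<And>j x. \<bar>a j x\<bar> \<le> 1"
          "\<And>x. x \<in> Rn n \<Longrightarrow> norm x \<le> 1 \<Longrightarrow> norm (x - (\<Sum>j<2 * n. a j x *\<^sub>R u j)) \<le> \<tau>"
        using measurable_kashin_coefficients[OF u(2) \<tau>] by blast
      \<comment> \<open>Solves the balance of bias and noise: h0^(d+1) = \<rho>^(d+1) \<Gamma>
        \<tau>'.\<close>
      define h0 where "h0 = \<rho> * (\<Gamma> * \<tau>') powr (1 / (real d + 1))"
      define h where "h = max h0 (2 * \<Lambda>)"
      have pw: "((\<Gamma> * \<tau>') powr (1 / (real d + 1))) ^ (d + 1) = \<Gamma> * \<tau>'"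
        using \<Gamma>pos \<tau>'pos by (subst powr_realpow[symmetric]) (auto simp: powr_powr add.commute)
      have h0pos: "0 < h0" using \<rho> \<Gamma>pos \<tau>'pos by (simp add: h0_def)
      have h0pow: "h0 ^ (d + 1) = \<rho> ^ (d + 1) * (\<Gamma> * \<tau>')"
        unfolding h0_def power_mult_distrib pw ..
      \<comment> \<open>Raised to the power d + 1 this is exactly the smallness assumption on
        \<tau>', which explains its exponents d (d + 1) and d.\<close>
      have "h0 \<le> (1/2240) ^ d * \<Gamma> * \<rho>"
      proof (rule power_le_imp_le_base)
        have "h0 ^ Suc d \<le> \<rho> ^ (d + 1) * (\<Gamma> * ((1/2240) ^ (d * (d + 1)) * \<Gamma> ^ d))"
          using h0pow small \<rho> \<Gamma>pos by (simp add: mult_left_mono)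
        also have "\<dots> = ((1/2240) ^ d * \<Gamma> * \<rho>) ^ Suc d"
          by (simp only: power_mult_distrib power_mult Suc_eq_plus1 power_add power_one_right mult_ac)
        finally show "h0 ^ Suc d \<le> ((1/2240) ^ d * \<Gamma> * \<rho>) ^ Suc d" .
      qed (use \<Gamma>pos \<rho> in simp)
      then have h: "h0 \<le> h" "2 * \<Lambda> \<le> h" "h \<le> (1/2240) ^ d * \<Gamma> * \<rho>" using 3(2) by (auto simp: h_def)
      \<comment> \<open>The factor 4 comes from the square of 2 \<Lambda>; the other alternative
        h0^2 / \<rho> is the second term of the maximum.\<close>
      have hB: "h\<^sup>2 / \<rho> \<le> 4 * B"
      proof -
        have "h0\<^sup>2 = \<rho>\<^sup>2 * (\<Gamma> powr (2 / (real d + 1)) * \<tau>' powr (2 / (real d + 1)))"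
        proof -
          have sq: "(x powr (1 / (real d + 1)))\<^sup>2 = x powr (2 / (real d + 1))" for x :: real
            by (simp add: power2_eq_square add_divide_distrib[symmetric] flip: powr_add)
          show ?thesis
            using \<Gamma>pos \<tau>'pos by (simp only: h0_def power_mult_distrib powr_mult sq less_imp_le)
        qed
        then have "h0\<^sup>2 / \<rho> = \<Gamma> powr (2 / (real d + 1)) * \<rho> * \<tau>' powr (2 / (real d + 1))"
          using \<rho> by (simp add: power2_eq_square)
        then have "h0\<^sup>2 / \<rho> \<le> B" by (simp add: B_def)
        moreover have "(2 * \<Lambda>)\<^sup>2 / \<rho> \<le> 4 * B" using B(1) by (simp add: power_mult_distrib)
        ultimately show ?thesis using B(2) by (simp add: h_def max_def)
      qed
      have "norm (projection_output (2 * n) x0 h u as - proj M x0) \<le> (10 ^ 10) ^ d / \<Gamma> * B"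
        if model: "in_model n d \<rho> fmin fmax L D M f" and near: "infdist x0 M \<le> \<Lambda>"
          and valid: "valid_answers (2 * n + 1) \<tau> D (projection_query (2 * n) x0 h a) as" for D M f as
      proof -
        have ans: "\<bar>as ! j - (\<integral>x. ball_query x0 h a j x \<partial>D)\<bar> \<le> \<tau>" if "j < 2 * n" for j
        proof -
          have "projection_query (2 * n) x0 h a (take j as) = ball_query x0 h a j"
            using valid that by (auto simp: valid_answers_def projection_query_def)
          then show ?thesis using valid that unfolding valid_answers_def
            by (metis add.commute less_SucI plus_1_eq_Suc)
        qed
        have s: "\<bar>as ! (2 * n) - (\<integral>x. indicator (cball x0 h) x \<partial>D)\<bar> \<le> \<tau>"
        proof -
          have "projection_query (2 * n) x0 h a (take (2 * n) as) = indicator (cball x0 h)"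
            using valid by (auto simp: valid_answers_def projection_query_def)
          then show ?thesis using valid unfolding valid_answers_def
            by (metis add.commute lessI plus_1_eq_Suc)
        qed
        have "norm (projection_output (2 * n) x0 h u as - proj M x0) \<le> 32400524 * 16 ^ d / \<Gamma> * (h\<^sup>2 / \<rho>)"
          unfolding projection_output_def
          by (rule projection_algorithm_error[OF model d \<rho> fmin L \<tau> \<Gamma>_def h0pos h0pow[unfolded \<tau>'_def] h x0 near a u(3) ans s])
        also have "\<dots> \<le> 32400524 * 16 ^ d / \<Gamma> * (4 * B)"
          using \<Gamma>pos by (intro mult_left_mono hB) auto
        also have "\<dots> = (129602096 * 16 ^ d) / \<Gamma> * B" by simp
        also have "\<dots> \<le> (10 ^ 10) ^ d / \<Gamma> * B"
        \<comment> \<open>As d \<ge> 1, the constant factor fits into the d-th power, and 129602096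
          * 16 is below 10^10.\<close>
        proof (intro mult_right_mono divide_right_mono B)
          have "(129602096 * 16 ^ d :: real) \<le> (129602096 * 16) ^ d"
            unfolding power_mult_distrib using d by (intro mult_right_mono) (auto simp: self_le_power)
          also have "\<dots> \<le> (10 ^ 10) ^ d" by (intro power_mono) auto
          finally show "(129602096 * 16 ^ d :: real) \<le> (10 ^ 10) ^ d" .
        qed (use \<Gamma>pos in auto)
        finally show ?thesis .
      qed
      then show ?thesis using SQ_projection_algorithm[where a=a and u=u and m="2 * n" and h=h, OF a(1,2) x0 u(1)]
        by blast
    qed
  qed
  show "let \<Gamma> = fmin / (fmax + L * \<rho>) in
        \<tau> / (omega d * fmin * \<rho> ^ d) \<le> (1/2240) ^ (d * (d + 1)) * \<Gamma> ^ d \<longrightarrow>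
        \<Lambda> \<le> \<rho> / 16 \<longrightarrow>
        x0 \<in> Rn n \<longrightarrow>
        (\<exists>Q out. SQ_algorithm n Q out \<and>
          (\<forall>D M f. in_model n d \<rho> fmin fmax L D M f \<longrightarrow> infdist x0 M \<le> \<Lambda> \<longrightarrow>
            (\<forall>as. valid_answers (2 * n + 1) \<tau> D Q as \<longrightarrow>
              norm (out as - proj M x0) \<le>
                (10 ^ 10) ^ d / \<Gamma> * max (\<Lambda>\<^sup>2 / \<rho>)
                  (\<Gamma> powr (2 / (real d + 1)) * \<rho> *
                   (\<tau> / (omega d * fmin * \<rho> ^ d)) powr (2 / (real d + 1))))))"
    using main unfolding Let_def \<Gamma>_def[symmetric] \<tau>'_def[symmetric] B_def[symmetric] by blast
qed simp_all

end
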